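(* Let $\sigma>0$ and $\mu,\nu\in\mathcal P(\mathcal X)$. There exist independent, tight $\mu$- and $\nu$-Brownian bridge processes $G_\mu$ and $G'_\nu$ in $\ell^\infty(\mathcal F_\sigma)$, respectively, such that the following hold. (i) We have $$\sqrt n\big(\mathsf W_1^{(\sigma)}(\hat\mu_n,\nu)-\mathsf W_1^{(\sigma)}(\mu,\nu)\big)\stackrel{d}{\to}\sup_{f\in M_\sigma}G_\mu(f),$$ where $M_\sigma=\{f\in\overline{\mathcal F}_\sigma^\mu:\mu(f-\nu(f))=\mathsf W_1^{(\sigma)}(\mu,\nu)\}$ and $\overline{\mathcal F}_\sigma^\mu$ is the completion of $\mathcal F_\sigma$ for the pseudometric $(f,g)\mapsto\sqrt{\mathrm{Var}_\mu(f-g)}$. (ii) We have $$\sqrt n\big(\mathsf W_1^{(\sigma)}(\hat\mu_n,\hat\nu_n)-\mathsf W_1^{(\sigma)}(\mu,\nu)\big)\stackrel{d}{\to}\sup_{f\in M'_\sigma}[G_\mu(f)-G'_\nu(f)],$$ where $M'_\sigma=\{f\in\overline{\mathcal F}_\sigma^{\mu,\nu}:(\mu-\nu)(f)=\mathsf W_1^{(\sigma)}(\mu,\nu)\}$ and $\overline{\mathcal F}_\sigma^{\mu,\nu}$ is the completion of $\mathcal F_\sigma$ for the pseudometric $(f,g)\mapsto\sqrt{\mathrm{Var}_\mu(f-g)}+\sqrt{\mathrm{Var}_\nu(f-g)}$.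
   Context: Smoothing kernel: $\chi\in C^\infty(\mathbb R^d)$ is nonnegative, even, compactly supported, with $\int\chi=1$; for $\sigma>0$, $\chi_\sigma=\sigma^{-d}\chi(\cdot/\sigma)$, and $\eta_\sigma$ is the probability measure with Lebesgue density $\chi_\sigma$. It is assumed that $\chi_\sigma$ is identically zero on $\mathbb R^d\setminus B(0,\sigma)$, where $B(0,\sigma)$ is the open ball. $\mathcal X\subset\mathbb R^d$ is a fixed compact set; $\mathcal P(\mathcal X)$ is identified with the Borel probability measures on $\mathbb R^d$ with support in $\mathcal X$. $\mathsf W_1$ is the 1-Wasserstein distance and $\mathsf W_1^{(\sigma)}(\mu,\nu)=\mathsf W_1(\mu*\eta_\sigma,\nu*\eta_\sigma)$. $\mathsf{Lip}_{1,0}$ is the set of 1-Lipschitz functions $f$ on $\mathbb R^d$ with $f(0)=0$, and $\mathcal F_\sigma=\{f*\chi_\sigma:f\in\mathsf{Lip}_{1,0}\}$. $\ell^\infty(\mathcal F_\sigma)$ is the space of bounded real functions on $\mathcal F_\sigma$ with sup-norm, where, because $\mu,\nu$ are supported in $\mathcal X$, processes such as $\hat\mu_n-\mu$ act by $f\mapsto(\hat\mu_n-\mu)(f)$. A tight $\mu$-Brownian bridge in $\ell^\infty(\mathcal F_\sigma)$ is a tight mean-zero Gaussian process with covariance $\mathrm{Cov}_\mu(f,g)$; it has uniformly continuous paths for the standard deviation pseudometric and is extended to the completion by continuity (same symbol). Completions are in the pseudometric sense (elements at distance zero are not identified). $X_1,X_2,\dots\sim\mu$ and $Y_1,Y_2,\dots\sim\nu$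 are independent i.i.d. sequences; $\hat\mu_n=n^{-1}\sum_{i=1}^n\delta_{X_i}$, $\hat\nu_n=n^{-1}\sum_{i=1}^n\delta_{Y_i}$. *)

theory Defs
  imports "HOL-Probability.Probability"
begin

section \<open>Smoothing kernels\<close>

primrec times_cont_differentiable :: "nat \<Rightarrow> ('a::real_normed_vector \<Rightarrow> 'b::real_normed_vector) \<Rightarrow> bool" where
  "times_cont_differentiable 0 f \<longleftrightarrow> continuous_on UNIV f"
| "times_cont_differentiable (Suc k) f \<longleftrightarrow>
     (\<forall>x. f differentiable (at x)) \<and>
     (\<forall>v. times_cont_differentiable k (\<lambda>x. frechet_derivative f (at x) v))"

definition smooth :: "('a::real_normed_vector \<Rightarrow> 'b::real_normed_vector) \<Rightarrow> bool" where
  "smooth f \<longleftrightarrow> (\<forall>k. times_cont_differentiable k f)"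

definition scaled_kernel :: "(real ^ 'n \<Rightarrow> real) \<Rightarrow> real \<Rightarrow> real ^ 'n \<Rightarrow> real" where
  "scaled_kernel \<kappa> \<sigma> x = \<kappa> (x /\<^sub>R \<sigma>) / \<sigma> ^ CARD('n)"

definition smoothing_kernel :: "(real ^ 'n \<Rightarrow> real) \<Rightarrow> bool" where
  "smoothing_kernel \<kappa> \<longleftrightarrow>
     smooth \<kappa> \<and> (\<forall>x. 0 \<le> \<kappa> x) \<and> (\<forall>x. \<kappa> (- x) = \<kappa> x) \<and>
     compact (closure {x. \<kappa> x \<noteq> 0}) \<and>
     integrable lborel \<kappa> \<and> (LINT x|lborel. \<kappa> x) = 1 \<and>
     (\<forall>\<sigma>>0. \<forall>x. x \<notin> ball 0 \<sigma> \<longrightarrow> scaled_kernel \<kappa> \<sigma> x = 0)"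

definition kernel_measure :: "(real ^ 'n \<Rightarrow> real) \<Rightarrow> real \<Rightarrow> (real ^ 'n) measure" where
  "kernel_measure \<kappa> \<sigma> = density lborel (\<lambda>x. ennreal (scaled_kernel \<kappa> \<sigma> x))"


section \<open>Measures and Wasserstein distances\<close>

definition measure_support :: "'a::topological_space measure \<Rightarrow> 'a set" where
  "measure_support M = {x. \<forall>U. open U \<and> x \<in> U \<longrightarrow> 0 < emeasure M U}"

definition prob_measures_on :: "'a::topological_space set \<Rightarrow> 'a measure set" where
  "prob_measures_on S = {M. prob_space M \<and> sets M = sets borel \<and> measure_support M \<subseteq> S}"

definition couplings :: "'a::metric_space measure \<Rightarrow> 'a measure \<Rightarrow> ('a \<times> 'a) measure set" where
  "couplings \<mu> \<nu> = {\<pi>. sets \<pi> = sets (borel \<Otimes>\<^sub>M borel) \<and> distr \<pi> borel fst = \<mu> \<and> distr \<pi> borel snd = \<nu>}"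

definition wasserstein1 :: "'a::metric_space measure \<Rightarrow> 'a measure \<Rightarrow> ennreal" where
  "wasserstein1 \<mu> \<nu> = (INF \<pi>\<in>couplings \<mu> \<nu>. \<integral>\<^sup>+ z. ennreal (dist (fst z) (snd z)) \<partial>\<pi>)"

(* Real-valued, so meaningful only where the distance is finite, as it is for measures of
   bounded support. *)
definition smooth_wasserstein1 ::
  "(real ^ 'n \<Rightarrow> real) \<Rightarrow> real \<Rightarrow> (real ^ 'n) measure \<Rightarrow> (real ^ 'n) measure \<Rightarrow> real" where
  "smooth_wasserstein1 \<kappa> \<sigma> \<mu> \<nu> =
     enn2real (wasserstein1 (\<mu> \<star> kernel_measure \<kappa> \<sigma>) (\<nu> \<star> kernel_measure \<kappa> \<sigma>))"

(* The push-forward of the uniform law on the indices 0, ..., n - 1 is the average of the n Dirac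
   measures at x 0, ..., x (n - 1). *)
definition empirical_measure :: "nat \<Rightarrow> (nat \<Rightarrow> 'a::topological_space) \<Rightarrow> 'a measure" where
  "empirical_measure n x = distr (uniform_count_measure {..<n}) borel x"


section \<open>The function class\<close>

definition Lip10 :: "('a::real_normed_vector \<Rightarrow> real) set" where
  "Lip10 = {f. lipschitz_on 1 UNIV f \<and> f 0 = 0}"

definition fun_convolution :: "('a::euclidean_space \<Rightarrow> real) \<Rightarrow> ('a \<Rightarrow> real) \<Rightarrow> 'a \<Rightarrow> real" where
  "fun_convolution f g x = (LINT y|lborel. f y * g (x - y))"

definition smoothed_Lip :: "(real ^ 'n \<Rightarrow> real) \<Rightarrow> real \<Rightarrow> (real ^ 'n \<Rightarrow> real) set" where
  "smoothed_Lip \<kappa> \<sigma> = (\<lambda>f. fun_convolution f (scaled_kernel \<kappa> \<sigma>)) ` Lip10"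

definition cov :: "'a measure \<Rightarrow> ('a \<Rightarrow> real) \<Rightarrow> ('a \<Rightarrow> real) \<Rightarrow> real" where
  "cov M f g = (LINT x|M. (f x - (LINT y|M. f y)) * (g x - (LINT y|M. g y)))"

definition sd_dist :: "'a measure \<Rightarrow> ('a \<Rightarrow> real) \<Rightarrow> ('a \<Rightarrow> real) \<Rightarrow> real" where
  "sd_dist M f g = sqrt (prob_space.variance M (\<lambda>x. f x - g x))"


section \<open>Pseudometric completions\<close>

(* The points of the completion are all Cauchy sequences in F, with the pseudometric
   lim (\<lambda>k. d (u k) (v k)); points at distance zero are not identified. F embeds isometrically
   and densely as the constant sequences. *)
definition pseudo_completion :: "('f \<Rightarrow> 'f \<Rightarrow> real) \<Rightarrow> 'f set \<Rightarrow> (nat \<Rightarrow> 'f) set" where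
  "pseudo_completion d F =
     {u. range u \<subseteq> F \<and> (\<forall>e>0. \<exists>N. \<forall>m\<ge>N. \<forall>n\<ge>N. d (u m) (u n) < e)}"

(* For h uniformly continuous on F, the extension of h by continuity. *)
definition completion_ext :: "('f \<Rightarrow> real) \<Rightarrow> (nat \<Rightarrow> 'f) \<Rightarrow> real" where
  "completion_ext h u = lim (\<lambda>k. h (u k))"

(* The functional \<mu> - \<nu> need not be continuous for the standard deviation pseudometrics: if \<mu>
   and \<nu> are distinct Dirac measures, both pseudometrics vanish identically. So it has no
   extension by continuity, and points at distance zero may have different values. At a Cauchy
   sequence the value is the limit along that sequence, when there is one. *)
definition optimal_potentials1 ::
  "(real ^ 'n \<Rightarrow> real) \<Rightarrow> real \<Rightarrow> (real ^ 'n) measure \<Rightarrow> (real ^ 'n) measure \<Rightarrow>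
   (nat \<Rightarrow> real ^ 'n \<Rightarrow> real) set" where
  "optimal_potentials1 \<kappa> \<sigma> \<mu> \<nu> =
     {u \<in> pseudo_completion (sd_dist \<mu>) (smoothed_Lip \<kappa> \<sigma>).
        (\<lambda>k. LINT x|\<mu>. (u k x - (LINT y|\<nu>. u k y))) \<longlonglongrightarrow> smooth_wasserstein1 \<kappa> \<sigma> \<mu> \<nu>}"

definition optimal_potentials2 ::
  "(real ^ 'n \<Rightarrow> real) \<Rightarrow> real \<Rightarrow> (real ^ 'n) measure \<Rightarrow> (real ^ 'n) measure \<Rightarrow>
   (nat \<Rightarrow> real ^ 'n \<Rightarrow> real) set" where
  "optimal_potentials2 \<kappa> \<sigma> \<mu> \<nu> =
     {u \<in> pseudo_completion (\<lambda>f g. sd_dist \<mu> f g + sd_dist \<nu> f g) (smoothed_Lip \<kappa> \<sigma>).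
        (\<lambda>k. (LINT x|\<mu>. u k x) - (LINT x|\<nu>. u k x)) \<longlonglongrightarrow> smooth_wasserstein1 \<kappa> \<sigma> \<mu> \<nu>}"


section \<open>Brownian bridges in \<open>\<ell>\<^sup>\<infinity>\<close>\<close>

definition linf :: "'f set \<Rightarrow> ('f \<Rightarrow> real) metric" where
  "linf F = funspace F euclidean_metric"

definition borel_of_metric :: "'a metric \<Rightarrow> 'a measure" where
  "borel_of_metric m = sigma (mspace m) {U. openin (mtopology_of m) U}"

(* Degenerate normal laws (s = 0) are included. *)
definition normal_law :: "real \<Rightarrow> real \<Rightarrow> real measure" where
  "normal_law m s = (if s = 0 then return borel m
                     else density lborel (\<lambda>x. ennreal (normal_density m s x)))"

definition gaussian_process :: "'w measure \<Rightarrow> 'f set \<Rightarrow> ('w \<Rightarrow> 'f \<Rightarrow> real) \<Rightarrow> bool" where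
  "gaussian_process N F G \<longleftrightarrow>
     (\<forall>f\<in>F. (\<lambda>\<omega>. G \<omega> f) \<in> borel_measurable N) \<and>
     (\<forall>S a. finite S \<and> S \<subseteq> F \<longrightarrow>
        (\<exists>m s. 0 \<le> s \<and> distr N borel (\<lambda>\<omega>. \<Sum>f\<in>S. a f * G \<omega> f) = normal_law m s))"

definition tight_brownian_bridge ::
  "'w measure \<Rightarrow> 'a measure \<Rightarrow> ('a \<Rightarrow> real) set \<Rightarrow> ('w \<Rightarrow> ('a \<Rightarrow> real) \<Rightarrow> real) \<Rightarrow> bool" where
  "tight_brownian_bridge N \<mu> F G \<longleftrightarrow>
     prob_space N \<and>
     G \<in> measurable N (borel_of_metric (linf F)) \<and>
     (\<forall>e>0. \<exists>K. compactin (mtopology_of (linf F)) K \<and>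
              1 - e \<le> measure N {\<omega> \<in> space N. G \<omega> \<in> K}) \<and>
     gaussian_process N F G \<and>
     (\<forall>f\<in>F. prob_space.expectation N (\<lambda>\<omega>. G \<omega> f) = 0) \<and>
     (\<forall>f\<in>F. \<forall>g\<in>F. cov N (\<lambda>\<omega>. G \<omega> f) (\<lambda>\<omega>. G \<omega> g) = cov \<mu> f g) \<and>
     (\<forall>\<omega>\<in>space N. \<forall>e>0. \<exists>\<delta>>0. \<forall>f\<in>F. \<forall>g\<in>F. sd_dist \<mu> f g < \<delta> \<longrightarrow> \<bar>G \<omega> f - G \<omega> g\<bar> < e)"

definition conv_in_distr ::
  "'v measure \<Rightarrow> (nat \<Rightarrow> 'v \<Rightarrow> real) \<Rightarrow> 'w measure \<Rightarrow> ('w \<Rightarrow> real) \<Rightarrow> bool" where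
  "conv_in_distr M Z N Z' \<longleftrightarrow>
     (\<forall>n. Z n \<in> borel_measurable M) \<and> Z' \<in> borel_measurable N \<and>
     weak_conv_m (\<lambda>n. distr M borel (Z n)) (distr N borel Z')"

end

theory Submission
  imports Defs
begin

text \<open>The law of the empirical process is compared with that of a Brownian bridge through coordinates.
On a ball that carries both measures, every smoothed Lipschitz function is a series
\<open>\<Sum>k. b k * \<phi> k x\<close> in fixed functions with \<open>\<bar>\<phi> k x\<bar> \<le> 1\<close> and
\<open>\<bar>b k\<bar> \<le> \<beta> k\<close>, where \<open>\<beta>\<close> is summable (\<open>nuclear_expansion\<close>). The function class thus
becomes a subset of a box of coefficient sequences, which is compact for coordinatewise
convergence, and an integral against a signed measure becomes the pairing \<open>ip b u\<close> of \<open>b\<close> with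
the sequence \<open>u\<close> of integrals of the \<open>\<phi> k\<close>. The summable weights
play the part of an entropy bound: they control the supremum over the whole class.

Kantorovich-Rubinstein duality, proved by reduction to finite sets, turns the smoothed distance
into a supremum over the class (\<open>smooth_wasserstein1_dual\<close>). With \<open>a b\<close> the value of
\<open>\<mu> - \<nu>\<close> at the function with coefficients \<open>b\<close>, with \<open>A\<close> the set of all coefficient sequences of
the class and \<open>m\<close> the supremum of \<open>a\<close> over \<open>A\<close>, the rescaled distances are
\<open>SUP b\<in>A. sqrt n * (a b - m) + ip b (U n \<omega>)\<close>, where \<open>U n\<close> consists of normalized sums of the
\<open>\<phi> k\<close> at the sample points. As \<open>n\<close> grows, only sequences that nearly maximise \<open>a\<close> matter, and the
supremum tends to \<open>SUP b\<in>M. ip b u\<close>, with \<open>M\<close> the maximisers of \<open>a\<close> in the closure of \<open>A\<close>. This is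
Danskin's formula for the directional derivative of a supremum, and compactness makes it uniform
in bounded \<open>u\<close> (\<open>directional_derivative_uniform\<close>).

The limiting functional is continuous in \<open>u\<close>, so it remains to know that the finite dimensional
marginals of \<open>U n\<close> converge, which is the central limit theorem on the line, and that truncating
the coordinates costs little, which follows from their second moments. By the Stone-Weierstrass
theorem, continuous functions of truncated coordinates are uniform limits of trigonometric
polynomials, whose expectations are expressed through characteristic functions
(\<open>sup_functional_limit\<close>).

For the bridge, Gram-Schmidt applied to the \<open>\<phi> k\<close> produces a Gaussian sequence \<open>W\<close> with their
covariances, and the bridge at \<open>f\<close> is the pairing of the coefficients of \<open>f\<close> with \<open>W\<close>. Its paths lie
in a countable union of compact subsets of the space of bounded functions, whence measurability
and tightness, and they are uniformly continuous for the standard deviation at every point of the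
probability space once a null set has been removed (\<open>bridge_path\<close>). Finally, a Cauchy sequence in
the completion has coefficient sequences that accumulate in the box, so the suprema over optimal
potentials in the completion are suprema over \<open>M\<close> (\<open>potentials_image\<close>).\<close>

section \<open>Transport duality on finite sets\<close>

definition sublinear :: "(('i \<Rightarrow> real) \<Rightarrow> real) \<Rightarrow> bool" where
  "sublinear p \<longleftrightarrow> (\<forall>x y. p (\<lambda>i. x i + y i) \<le> p x + p y) \<and>
                   (\<forall>c>0. \<forall>x. p (\<lambda>i. c * x i) = c * p x)"

lemma sublinear_add: "sublinear p \<Longrightarrow> p (\<lambda>i. x i + y i) \<le> p x + p y"
  and sublinear_scale: "sublinear p \<Longrightarrow> c > 0 \<Longrightarrow> p (\<lambda>i. c * x i) = c * p x"
  by (auto simp: sublinear_def)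

lemma sublinear_zero: assumes "sublinear p" shows "p (\<lambda>i. 0) = 0"
  using sublinear_scale[OF assms, of 2 "\<lambda>i. 0"] by simp

lemma sublinear_neg: assumes "sublinear p" shows "0 \<le> p x + p (\<lambda>i. - x i)"
  using sublinear_add[OF assms, of x "\<lambda>i. - x i"] sublinear_zero[OF assms] by simp

text \<open>The infimum of \<open>p (h + t v) - t p v\<close> over \<open>t \<ge> 0\<close> is again sublinear and lies below \<open>p\<close>, but it is
additive on the line through \<open>v\<close>. This is the one-step extension in the Hahn-Banach theorem,
carried out on the functional instead of on a subspace.\<close>

lemma sublinear_linearize:
  assumes p: "sublinear p"
  shows "\<exists>p'. sublinear p' \<and> (\<forall>h. p' h \<le> p h) \<and> p' (\<lambda>i. - v i) \<le> - p v"
proof -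
  (* The lower bound - p (- h) of q h t, which does not depend on t, makes the infimum finite. *)
  define q where "q h t = p (\<lambda>i. h i + t * v i) - t * p v" for h t
  define p' where "p' h = (INF t\<in>{0..}. q h t)" for h
  have tv: "p (\<lambda>i. t * v i) = t * p v" if "t \<ge> 0" for t
    using that sublinear_scale[OF p, of t v] sublinear_zero[OF p] by (cases "t = 0") auto
  have lower: "- p (\<lambda>i. - h i) \<le> q h t" if "t \<ge> 0" for h t
    using sublinear_add[OF p, of "\<lambda>i. h i + t * v i" "\<lambda>i. - h i"] tv[OF that]
    by (simp add: q_def)
  have bdd: "bdd_below (q h ` {0..})" for h
    using lower by (auto intro!: bdd_belowI2)
  have upper: "p' h \<le> q h t" if "t \<ge> 0" for h t
    unfolding p'_def using that by (intro cINF_lower bdd) auto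
  have add: "p' (\<lambda>i. h i + k i) \<le> p' h + p' k" for h k
  proof -
    have "p' (\<lambda>i. h i + k i) \<le> q h s + q k t" if "s \<ge> 0" "t \<ge> 0" for s t
    proof -
      have "p' (\<lambda>i. h i + k i) \<le> q (\<lambda>i. h i + k i) (s + t)"
        using that by (intro upper) auto
      also have "\<dots> \<le> q h s + q k t"
        using sublinear_add[OF p, of "\<lambda>i. h i + s * v i" "\<lambda>i. k i + t * v i"]
        by (simp add: q_def algebra_simps)
      finally show ?thesis .
    qed
    then have "p' (\<lambda>i. h i + k i) - q h s \<le> p' k" if "s \<ge> 0" for s
      unfolding p'_def[of k] using that by (intro cINF_greatest) (auto simp: algebra_simps)
    then have "p' (\<lambda>i. h i + k i) - p' k \<le> p' h"
      unfolding p'_def[of h] by (intro cINF_greatest) (auto simp: algebra_simps)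
    then show ?thesis by simp
  qed
  have scale_le: "p' (\<lambda>i. c * h i) \<le> c * p' h" if "c > 0" for c h
  proof -
    have "p' (\<lambda>i. c * h i) / c \<le> q h t" if "t \<ge> 0" for t
    proof -
      have "p' (\<lambda>i. c * h i) \<le> q (\<lambda>i. c * h i) (c * t)"
        using that \<open>c > 0\<close> by (intro upper) auto
      also have "\<dots> = c * q h t"
        using sublinear_scale[OF p \<open>c > 0\<close>, of "\<lambda>i. h i + t * v i"]
        by (simp add: q_def algebra_simps)
      finally show ?thesis using \<open>c > 0\<close> by (simp add: field_simps)
    qed
    then have "p' (\<lambda>i. c * h i) / c \<le> p' h"
      unfolding p'_def[of h] by (intro cINF_greatest) auto
    then show ?thesis using that by (simp add: field_simps)
  qed
  have scale: "p' (\<lambda>i. c * h i) = c * p' h" if "c > 0" for c h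
  proof (rule antisym[OF scale_le[OF that]])
    have "p' (\<lambda>i. inverse c * (c * h i)) \<le> inverse c * p' (\<lambda>i. c * h i)"
      using that by (intro scale_le) auto
    moreover have "(\<lambda>i. inverse c * (c * h i)) = h" using that by (auto simp: field_simps)
    ultimately have "p' h \<le> inverse c * p' (\<lambda>i. c * h i)" by simp
    then show "c * p' h \<le> p' (\<lambda>i. c * h i)" using that by (simp add: field_simps)
  qed
  have "p' (\<lambda>i. - v i) \<le> - p v"
    using upper[of 1 "\<lambda>i. - v i"] sublinear_zero[OF p] by (simp add: q_def)
  moreover have "p' h \<le> p h" for h
    using upper[of 0 h] by (simp add: q_def)
  ultimately show ?thesis
    using add scale by (intro exI[of _ p']) (auto simp: sublinear_def)
qed

lemma sublinear_linearize_list: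
  assumes "sublinear p"
  shows "\<exists>p'. sublinear p' \<and> (\<forall>h. p' h \<le> p h) \<and> (\<forall>v\<in>set vs. p' v + p' (\<lambda>i. - v i) = 0)"
proof (induction vs)
  case Nil
  then show ?case using assms by auto
next
  case (Cons v vs)
  then obtain p1 where p1: "sublinear p1" "\<And>h. p1 h \<le> p h"
    "\<And>w. w \<in> set vs \<Longrightarrow> p1 w + p1 (\<lambda>i. - w i) = 0" by auto
  obtain p2 where p2: "sublinear p2" "\<And>h. p2 h \<le> p1 h" "p2 (\<lambda>i. - v i) \<le> - p1 v"
    using sublinear_linearize[OF p1(1), of v] by auto
  have "p2 w + p2 (\<lambda>i. - w i) = 0" if "w \<in> set (v # vs)" for w
  proof (rule antisym[OF _ sublinear_neg[OF p2(1)]])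
    show "p2 w + p2 (\<lambda>i. - w i) \<le> 0"
      using that p2(2)[of w] p2(2)[of "\<lambda>i. - w i"] p2(3) p1(3)[of w]
      by auto
  qed
  then show ?case
    using p2 p1 by (intro exI[of _ p2]) (auto intro: order_trans)
qed

text \<open>The first linearisation is along \<open>v\<close> itself, which fixes the value there; the others are along the
coordinate vectors of \<open>I\<close>, after which the functional is linear on vectors supported in \<open>I\<close>.\<close>

lemma finite_Hahn_Banach:
  assumes p: "sublinear p" and I: "finite I"
  obtains l where "\<And>h. (\<Sum>i\<in>I. l i * h i) \<le> p (\<lambda>i. if i \<in> I then h i else 0)"
    and "(\<Sum>i\<in>I. l i * v i) = p (\<lambda>i. if i \<in> I then v i else 0)"
proof -
  define w where "w = (\<lambda>i. if i \<in> I then v i else 0)"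
  define e :: "'a \<Rightarrow> 'a \<Rightarrow> real" where "e i = (\<lambda>j. if j = i then 1 else 0)" for i
  obtain p1 where p1: "sublinear p1" "\<And>h. p1 h \<le> p h" "p1 (\<lambda>i. - w i) \<le> - p w"
    using sublinear_linearize[OF p, of w] by auto
  obtain xs where xs: "set xs = I" using finite_list[OF I] by auto
  obtain p2 where p2: "sublinear p2" "\<And>h. p2 h \<le> p1 h"
    "\<And>v. v \<in> set (map e xs) \<Longrightarrow> p2 v + p2 (\<lambda>i. - v i) = 0"
    using sublinear_linearize_list[OF p1(1), of "map e xs"] by metis
  define l where "l i = p2 (e i)" for i
  have line: "p2 (\<lambda>j. c * e i j) = c * l i" if "i \<in> I" for i c
  proof -
    have neg: "p2 (\<lambda>j. - e i j) = - l i"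
      using p2(3)[of "e i"] that xs by (auto simp: l_def)
    consider "c > 0" | "c = 0" | "c < 0" by linarith
    then show ?thesis
    proof cases
      case 3
      then show ?thesis
        using sublinear_scale[OF p2(1), of "- c" "\<lambda>j. - e i j"] neg by simp
    qed (use sublinear_scale[OF p2(1), of c "e i"] sublinear_zero[OF p2(1)] in \<open>auto simp: l_def\<close>)
  qed
  have lin: "p2 (\<lambda>i. if i \<in> J then h i else 0) = (\<Sum>i\<in>J. l i * h i)" if "J \<subseteq> I" for J h
    using finite_subset[OF that I] that
  proof (induction J rule: finite_induct)
    case empty
    then show ?case using sublinear_zero[OF p2(1)] by simp
  next
    case (insert i J)
    let ?H = "\<lambda>j. if j \<in> J then h j else 0" and ?H' = "\<lambda>j. if j \<in> insert i J then h j else 0"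
    have split: "?H' = (\<lambda>j. ?H j + h i * e i j)"
      using insert by (auto simp: e_def fun_eq_iff)
    have rest: "?H = (\<lambda>j. ?H' j + (- h i) * e i j)"
      using insert by (auto simp: e_def fun_eq_iff)
    have "p2 ?H' \<le> p2 ?H + h i * l i"
      unfolding split using sublinear_add[OF p2(1), of ?H "\<lambda>j. h i * e i j"] line[of i] insert
      by auto
    moreover have "p2 ?H \<le> p2 ?H' - h i * l i"
      using sublinear_add[OF p2(1), of ?H' "\<lambda>j. (- h i) * e i j"] line[of i "- h i"] insert rest
      by simp
    ultimately show ?case using insert by (simp add: mult.commute)
  qed
  show ?thesis
  proof (rule that[of l])
    show "(\<Sum>i\<in>I. l i * h i) \<le> p (\<lambda>i. if i \<in> I then h i else 0)" for h
      using lin[of I h] p1(2) p2(2) order_trans by (metis order_refl)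
    have "p2 (\<lambda>i. - w i) \<le> - p w" using p2(2) p1(3) order_trans by blast
    moreover have "p2 w \<le> p w" using p1(2) p2(2) order_trans by blast
    ultimately have "p2 w = p w" using sublinear_neg[OF p2(1), of w] by linarith
    then show "(\<Sum>i\<in>I. l i * v i) = p (\<lambda>i. if i \<in> I then v i else 0)"
      using lin[of I v] by (simp add: w_def)
  qed
qed

text \<open>Let \<open>p h\<close> be the infimum of \<open>\<Sum>z. f z * a z + g z * b z\<close> over pairs with
\<open>f z + g z' \<ge> h (z, z')\<close>. A linear functional below \<open>p\<close> has nonnegative coefficients with marginals
\<open>a\<close> and \<open>b\<close>, so it is a transport plan; one that touches \<open>p\<close> at minus the distance is optimal.
A pair that is optimal up to \<open>e\<close> yields the Lipschitz function: the infimal convolution of \<open>g\<close> with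
the distance is 1-Lipschitz and lies between \<open>- f\<close> and \<open>g\<close>.\<close>

lemma finite_Kantorovich_Rubinstein:
  fixes Z :: "'a::metric_space set" and a b :: "'a \<Rightarrow> real"
  assumes Z: "finite Z" and a: "\<And>z. z \<in> Z \<Longrightarrow> 0 \<le> a z" "sum a Z = 1"
    and b: "\<And>z. z \<in> Z \<Longrightarrow> 0 \<le> b z" "sum b Z = 1" and e: "e > 0"
  obtains c :: "'a \<Rightarrow> 'a \<Rightarrow> real" and f :: "'a \<Rightarrow> real"
  where "\<And>z z'. z \<in> Z \<Longrightarrow> z' \<in> Z \<Longrightarrow> 0 \<le> c z z'"
    and "\<And>z. z \<in> Z \<Longrightarrow> (\<Sum>z'\<in>Z. c z z') = a z"
    and "\<And>z'. z' \<in> Z \<Longrightarrow> (\<Sum>z\<in>Z. c z z') = b z'"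
    and "1-lipschitz_on UNIV f"
    and "(\<Sum>z\<in>Z. \<Sum>z'\<in>Z. c z z' * dist z z') \<le> (\<Sum>z\<in>Z. f z * (a z - b z)) + e"
proof -
  define A where "A h = {(f, g). \<forall>z\<in>Z. \<forall>z'\<in>Z. h (z, z') \<le> f z + g z'}"
    for h :: "'a \<times> 'a \<Rightarrow> real"
  define J where "J = (\<lambda>(f, g). (\<Sum>z\<in>Z. f z * a z) + (\<Sum>z\<in>Z. g z * b z))"
  define p where "p h = (INF fg\<in>A h. J fg)" for h
  have ne: "A h \<noteq> {}" for h
  proof -
    have "((\<lambda>_. \<Sum>i\<in>Z \<times> Z. \<bar>h i\<bar>), (\<lambda>_. 0)) \<in> A h"
      using Z unfolding A_def
      by (auto intro!: order_trans[OF abs_ge_self member_le_sum[of _ _ "\<lambda>i. \<bar>h i\<bar>"]])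
    then show ?thesis by auto
  qed
  have lower: "(\<Sum>z\<in>Z. \<Sum>z'\<in>Z. h (z, z') * (a z * b z')) \<le> J fg" if "fg \<in> A h" for h fg
  proof -
    obtain f g where fg: "fg = (f, g)" by force
    have "(\<Sum>z\<in>Z. \<Sum>z'\<in>Z. h (z, z') * (a z * b z')) \<le> (\<Sum>z\<in>Z. \<Sum>z'\<in>Z. (f z + g z') * (a z * b z'))"
      using that a b by (intro sum_mono mult_right_mono) (auto simp: A_def fg)
    also have "\<dots> = (\<Sum>z\<in>Z. \<Sum>z'\<in>Z. (f z * a z) * b z') + (\<Sum>z\<in>Z. \<Sum>z'\<in>Z. a z * (g z' * b z'))"
      by (simp add: sum.distrib[symmetric] algebra_simps)
    also have "\<dots> = J fg"
      unfolding sum_distrib_left[symmetric] sum_distrib_right[symmetric] by (simp add: J_def fg a b)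
    finally show ?thesis .
  qed
  have bdd: "bdd_below (J ` A h)" for h
    using lower[of _ h] by (auto intro!: bdd_belowI2)
  have upper: "p h \<le> J fg" if "fg \<in> A h" for h fg
    unfolding p_def using that by (intro cINF_lower bdd)
  have J_add: "J (\<lambda>z. f z + f' z, \<lambda>z. g z + g' z) = J (f, g) + J (f', g')" for f f' g g'
    by (simp add: J_def sum.distrib algebra_simps)
  have J_scale: "J (\<lambda>z. c * f z, \<lambda>z. c * g z) = c * J (f, g)" for c f g
    by (simp add: J_def sum_distrib_left algebra_simps)
  have p_le: "p h \<le> c" if "\<And>fg. fg \<in> A k \<Longrightarrow> p h \<le> x * J fg + d" "x > 0" "x * p k + d = c" for h k x c d
  proof -
    have "(p h - d) / x \<le> p k"
      unfolding p_def[of k] using that(1,2) ne by (intro cINF_greatest) (auto simp: field_simps)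
    then show ?thesis using that(2,3) by (simp add: field_simps)
  qed
  have sub: "sublinear p"
    unfolding sublinear_def
  proof (intro conjI allI impI)
    fix x y :: "'a \<times> 'a \<Rightarrow> real"
    have *: "p (\<lambda>i. x i + y i) \<le> J fg + J fg'" if "fg \<in> A x" "fg' \<in> A y" for fg fg'
    proof -
      obtain f g f' g' where fg: "fg = (f, g)" "fg' = (f', g')" by force
      have "(\<lambda>z. f z + f' z, \<lambda>z. g z + g' z) \<in> A (\<lambda>i. x i + y i)"
        using that by (fastforce simp: A_def fg)
      from upper[OF this] show ?thesis by (simp add: J_add fg)
    qed
    have "p (\<lambda>i. x i + y i) \<le> J fg + p y" if "fg \<in> A x" for fg
      by (rule p_le[where k = y and x = 1 and d = "J fg"]) (use *[OF that] in \<open>simp_all add: add.commute\<close>)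
    note ** = this
    show "p (\<lambda>i. x i + y i) \<le> p x + p y"
      by (rule p_le[where k = x and x = 1 and d = "p y"]) (use ** in \<open>simp_all add: add.commute\<close>)
  next
    have le: "p (\<lambda>i. c * x i) \<le> c * p x" if "c > 0" for c x
    proof (rule p_le[where k = x and x = c and d = 0])
      fix fg assume "fg \<in> A x"
      moreover obtain f g where fg: "fg = (f, g)" by force
      ultimately have "(\<lambda>z. c * f z, \<lambda>z. c * g z) \<in> A (\<lambda>i. c * x i)"
        using that by (auto simp: A_def distrib_left[symmetric])
      from upper[OF this] show "p (\<lambda>i. c * x i) \<le> c * J fg + 0" by (simp add: J_scale fg)
    qed (use that in auto)
    fix c :: real and x :: "'a \<times> 'a \<Rightarrow> real" assume c: "c > 0"
    have "p (\<lambda>i. inverse c * (c * x i)) \<le> inverse c * p (\<lambda>i. c * x i)"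
      using c by (intro le) auto
    moreover have "(\<lambda>i. inverse c * (c * x i)) = x" using c by (auto simp: field_simps)
    ultimately have "p x \<le> inverse c * p (\<lambda>i. c * x i)" by simp
    then show "p (\<lambda>i. c * x i) = c * p x"
      using le[OF c, of x] c by (intro antisym) (auto simp: field_simps)
  qed
  obtain l where l: "\<And>h. (\<Sum>i\<in>Z \<times> Z. l i * h i) \<le> p (\<lambda>i. if i \<in> Z \<times> Z then h i else 0)"
    and lv: "(\<Sum>i\<in>Z \<times> Z. l i * (- dist (fst i) (snd i))) =
      p (\<lambda>i. if i \<in> Z \<times> Z then - dist (fst i) (snd i) else 0)"
    by (rule finite_Hahn_Banach[OF sub finite_cartesian_product[OF Z Z], of "\<lambda>i. - dist (fst i) (snd i)"])
      (rule that)
  have l_le: "(\<Sum>i\<in>Z \<times> Z. l i * h i) \<le> J (f, g)"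
    if "\<And>z z'. z \<in> Z \<Longrightarrow> z' \<in> Z \<Longrightarrow> h (z, z') \<le> f z + g z'" for h f g
  proof (rule order_trans[OF l upper])
    show "(f, g) \<in> A (\<lambda>i. if i \<in> Z \<times> Z then h i else 0)"
      using that by (simp add: A_def)
  qed
  have pos: "0 \<le> l (z, z')" if "z \<in> Z" "z' \<in> Z" for z z'
  proof -
    have "(\<Sum>i\<in>Z \<times> Z. l i * (if i = (z, z') then - 1 else 0)) \<le> J (\<lambda>_. 0, \<lambda>_. 0)"
      by (rule l_le) auto
    then show ?thesis
      using that Z by (simp add: J_def if_distrib[where f = "\<lambda>x. _ * x"] cong: if_cong)
  qed
  have row: "(\<Sum>z'\<in>Z. l (z, z')) = a z" if "z \<in> Z" for z
  proof -
    have eq: "(\<Sum>i\<in>Z \<times> Z. l i * (if fst i = z then s else 0)) = s * (\<Sum>z'\<in>Z. l (z, z'))" for s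
    proof -
      have "(\<Sum>i\<in>Z \<times> Z. l i * (if fst i = z then s else 0)) =
          (\<Sum>y\<in>Z. \<Sum>z'\<in>Z. l (y, z') * (if y = z then s else 0))"
        by (simp add: sum.cartesian_product case_prod_beta)
      also have "\<dots> = (\<Sum>y\<in>Z. if y = z then s * (\<Sum>z'\<in>Z. l (z, z')) else 0)"
        by (intro sum.cong) (auto simp: sum_distrib_left mult.commute)
      finally show ?thesis using that Z by simp
    qed
    have "s * (\<Sum>z'\<in>Z. l (z, z')) \<le> s * a z" for s
    proof -
      have "(\<Sum>i\<in>Z \<times> Z. l i * (if fst i = z then s else 0)) \<le>
          J (\<lambda>y. if y = z then s else 0, \<lambda>_. 0)"
        by (rule l_le) auto
      also have "J (\<lambda>y. if y = z then s else 0, \<lambda>_. 0) = s * a z"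
        using that Z by (simp add: J_def if_distrib[where f = "\<lambda>x. x * _"] cong: if_cong)
      finally show ?thesis by (simp add: eq)
    qed
    from this[of 1] this[of "-1"] show ?thesis by simp
  qed
  have col: "(\<Sum>z\<in>Z. l (z, z')) = b z'" if "z' \<in> Z" for z'
  proof -
    have eq: "(\<Sum>i\<in>Z \<times> Z. l i * (if snd i = z' then s else 0)) = s * (\<Sum>z\<in>Z. l (z, z'))" for s
    proof -
      have "(\<Sum>i\<in>Z \<times> Z. l i * (if snd i = z' then s else 0)) =
          (\<Sum>z\<in>Z. \<Sum>y\<in>Z. l (z, y) * (if y = z' then s else 0))"
        by (simp add: sum.cartesian_product case_prod_beta)
      also have "\<dots> = (\<Sum>z\<in>Z. s * l (z, z'))"
        using that Z by (intro sum.cong)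
          (auto simp: if_distrib[where f = "\<lambda>x. _ * x"] mult.commute cong: if_cong)
      finally show ?thesis by (simp add: sum_distrib_left)
    qed
    have "s * (\<Sum>z\<in>Z. l (z, z')) \<le> s * b z'" for s
    proof -
      have "(\<Sum>i\<in>Z \<times> Z. l i * (if snd i = z' then s else 0)) \<le>
          J (\<lambda>_. 0, \<lambda>y. if y = z' then s else 0)"
        by (rule l_le) auto
      also have "J (\<lambda>_. 0, \<lambda>y. if y = z' then s else 0) = s * b z'"
        using that Z by (simp add: J_def if_distrib[where f = "\<lambda>x. x * _"] cong: if_cong)
      finally show ?thesis by (simp add: eq)
    qed
    from this[of 1] this[of "-1"] show ?thesis by simp
  qed
  define h where "h = (\<lambda>i::'a \<times> 'a. if i \<in> Z \<times> Z then - dist (fst i) (snd i) else 0)"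
  have "p h < p h + e" using e by simp
  then obtain fg where "fg \<in> A h" and Jfg: "J fg < p h + e"
    unfolding p_def[of h] using cINF_less_iff[OF ne bdd] by blast
  moreover obtain f g where fg: "fg = (f, g)" by force
  ultimately have ineq: "- dist z z' \<le> f z + g z'" if "z \<in> Z" "z' \<in> Z" for z z'
    using that unfolding A_def h_def by force
  have Zne: "Z \<noteq> {}" using a by auto
  define F where "F x = (MIN z\<in>Z. dist x z + g z)" for x
  have F_le: "F x \<le> dist x z + g z" if "z \<in> Z" for x z
    unfolding F_def using that Z by (intro Min_le) auto
  have F_ex: "\<exists>z\<in>Z. F x = dist x z + g z" for x
  proof -
    have "F x \<in> (\<lambda>z. dist x z + g z) ` Z"
      unfolding F_def using Z Zne by (intro Min_in) auto
    then show ?thesis by auto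
  qed
  have F_tri: "F x \<le> F y + dist x y" for x y
  proof -
    obtain z where z: "z \<in> Z" "F y = dist y z + g z" using F_ex by blast
    have "F x \<le> dist x z + g z" using F_le[OF z(1)] .
    then show ?thesis using z dist_triangle[of x z y] by simp
  qed
  have lip: "1-lipschitz_on UNIV F"
  proof (rule lipschitz_onI)
    show "dist (F x) (F y) \<le> 1 * dist x y" for x y
      using F_tri[of x y] F_tri[of y x] by (simp add: dist_real_def abs_le_iff dist_commute)
  qed simp
  have F1: "- f z \<le> F z" if "z \<in> Z" for z
    using F_ex[of z] ineq[OF that] by fastforce
  have F2: "F z \<le> g z" if "z \<in> Z" for z
    using F_le[OF that, of z] by simp
  show ?thesis
  proof (rule that[of "\<lambda>z z'. l (z, z')" F])
    have "(\<Sum>z\<in>Z. \<Sum>z'\<in>Z. l (z, z') * dist z z') = - p h"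
      using lv unfolding h_def
      by (simp add: sum.cartesian_product case_prod_beta sum_negf)
    also have "\<dots> \<le> - J fg + e" using Jfg by simp
    also have "- J fg = (\<Sum>z\<in>Z. (- f z) * a z) - (\<Sum>z\<in>Z. g z * b z)"
      by (simp add: J_def fg sum_negf)
    also have "\<dots> \<le> (\<Sum>z\<in>Z. F z * a z) - (\<Sum>z\<in>Z. F z * b z)"
      using a b F1 F2 by (intro diff_mono sum_mono mult_right_mono) auto
    also have "\<dots> = (\<Sum>z\<in>Z. F z * (a z - b z))"
      by (simp add: sum_subtractf algebra_simps)
    finally show "(\<Sum>z\<in>Z. \<Sum>z'\<in>Z. l (z, z') * dist z z') \<le> (\<Sum>z\<in>Z. F z * (a z - b z)) + e"
      by simp
  qed (use pos row col lip in auto)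
qed

text \<open>A finite net rounds measurably: the net points are tried one after the other, so every preimage is
a Boolean combination of balls.\<close>

lemma finite_range_quantizer:
  fixes K :: "'a::euclidean_space set"
  assumes "bounded K" "e > 0"
  obtains q :: "'a \<Rightarrow> 'a" where "q \<in> borel_measurable borel" "finite (range q)"
    "\<And>y. y \<in> K \<Longrightarrow> dist (q y) y \<le> e"
proof -
  have *: "\<exists>q\<in>borel_measurable borel. finite (range q) \<and> (\<forall>y\<in>(\<Union>z\<in>Z. ball z e). dist (q y) y \<le> e)"
    if "finite Z" for Z :: "'a set"
    using that
  proof induction
    case empty
    then show ?case by (intro bexI[of _ "\<lambda>_. 0"]) auto
  next
    case (insert z Z)
    then obtain q where [measurable]: "q \<in> borel_measurable borel" and "finite (range q)"
      "\<forall>y\<in>(\<Union>z\<in>Z. ball z e). dist (q y) y \<le> e" by auto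
    moreover have "range (\<lambda>y. if dist z y < e then z else q y) \<subseteq> insert z (range q)" by auto
    ultimately show ?case
      by (intro bexI[of _ "\<lambda>y. if dist z y < e then z else q y"])
         (auto intro: finite_subset)
  qed
  have "compact (closure K)" using assms by (simp add: compact_closure)
  then obtain Z where "finite Z" "closure K \<subseteq> (\<Union>z\<in>Z. ball z e)"
    using compact_eq_totally_bounded[of "closure K"] assms(2) by auto
  then show ?thesis
    using *[of Z] that closure_subset[of K] by (metis subsetD)
qed

section \<open>Kantorovich-Rubinstein duality for measures of bounded support\<close>

lemma Lip10_D:
  assumes "f \<in> Lip10"
  shows "\<bar>f x - f y\<bar> \<le> dist x y" "\<bar>f x\<bar> \<le> norm x" "f \<in> borel_measurable borel" "continuous_on UNIV f"
proof -
  have l: "1-lipschitz_on UNIV f" and z: "f 0 = 0" using assms by (auto simp: Lip10_def)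
  show *: "\<bar>f x - f y\<bar> \<le> dist x y" for x y
    using lipschitz_onD[OF l, of x y] by (simp add: dist_real_def)
  show "\<bar>f x\<bar> \<le> norm x" using *[of x 0] z by simp
  show "continuous_on UNIV f" by (rule lipschitz_on_continuous_on[OF l])
  then show "f \<in> borel_measurable borel" by (rule borel_measurable_continuous_onI)
qed

lemma zero_in_Lip10: "(\<lambda>_. 0) \<in> Lip10"
  by (auto simp: Lip10_def lipschitz_on_def)

lemma Lip10_integrable:
  fixes f :: "'a::euclidean_space \<Rightarrow> real"
  assumes "prob_space \<alpha>" "sets \<alpha> = sets borel" "AE x in \<alpha>. norm x \<le> R" "f \<in> Lip10"
  shows "integrable \<alpha> f" "\<bar>LINT x|\<alpha>. f x\<bar> \<le> R"
proof -
  interpret \<alpha>: prob_space \<alpha> by fact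
  have [measurable]: "f \<in> borel_measurable \<alpha>"
    using Lip10_D(3)[OF assms(4)] assms(2) by (simp cong: measurable_cong_sets)
  have AE: "AE x in \<alpha>. \<bar>f x\<bar> \<le> R"
    using assms(3) by eventually_elim (use Lip10_D(2)[OF assms(4)] order_trans in blast)
  then show i: "integrable \<alpha> f"
    by (intro \<alpha>.integrable_const_bound[where B = R]) auto
  have "\<bar>LINT x|\<alpha>. f x\<bar> \<le> (LINT x|\<alpha>. \<bar>f x\<bar>)" by (rule integral_abs_bound)
  also have "\<dots> \<le> (LINT x|\<alpha>. R)" using AE i by (intro integral_mono_AE) auto
  finally show "\<bar>LINT x|\<alpha>. f x\<bar> \<le> R" by (simp add: \<alpha>.prob_space)
qed

lemma AE_couplings:
  fixes \<alpha> \<beta> :: "'a::{metric_space, second_countable_topology} measure"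
  assumes "\<pi> \<in> couplings \<alpha> \<beta>" "sets \<alpha> = sets borel" "sets \<beta> = sets borel"
    "AE x in \<alpha>. P x" "AE y in \<beta>. Q y"
  shows "AE z in \<pi>. P (fst z) \<and> Q (snd z)"
proof -
  have [measurable_cong]: "sets \<pi> = sets (borel \<Otimes>\<^sub>M borel)" using assms(1) by (simp add: couplings_def)
  have "AE x in distr \<pi> borel fst. P x" "AE x in distr \<pi> borel snd. Q x"
    using assms by (auto simp: couplings_def)
  then have "AE z in \<pi>. P (fst z)" "AE z in \<pi>. Q (snd z)"
    by (auto dest!: AE_distrD[rotated])
  then show ?thesis by eventually_elim auto
qed

text \<open>For the hard inequality both measures are rounded to a finite net. A plan for the rounded measures
that is optimal up to \<open>e\<close> comes from the finite duality, and it is lifted to a coupling of the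
original measures by making the two points independent given their cells. Rounding moves points by
at most \<open>e\<close>, so it changes the cost and each of the two integrals of a 1-Lipschitz function little.\<close>

theorem Kantorovich_Rubinstein:
  fixes \<alpha> \<beta> :: "'a::euclidean_space measure"
  assumes "prob_space \<alpha>" "prob_space \<beta>" and sets: "sets \<alpha> = sets borel" "sets \<beta> = sets borel"
    and AE: "AE x in \<alpha>. norm x \<le> R" "AE x in \<beta>. norm x \<le> R"
  shows "wasserstein1 \<alpha> \<beta> = ennreal (SUP f\<in>Lip10. (LINT x|\<alpha>. f x) - (LINT x|\<beta>. f x))"
proof (rule antisym)
  interpret \<alpha>: prob_space \<alpha> by fact
  interpret \<beta>: prob_space \<beta> by fact
  interpret \<alpha>\<beta>: pair_prob_space \<alpha> \<beta> ..
  note [measurable_cong] = sets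
  define S where "S = (SUP f\<in>Lip10. (LINT x|\<alpha>. f x) - (LINT x|\<beta>. f x))"
  have int: "integrable \<alpha> f" "integrable \<beta> f" "\<bar>LINT x|\<alpha>. f x\<bar> \<le> R" "\<bar>LINT x|\<beta>. f x\<bar> \<le> R"
    if "f \<in> Lip10" for f
    using Lip10_integrable[of \<alpha> R f] Lip10_integrable[of \<beta> R f] that assms by auto
  have bdd: "bdd_above ((\<lambda>f. (LINT x|\<alpha>. f x) - (LINT x|\<beta>. f x)) ` Lip10)"
  proof (rule bdd_aboveI2)
    fix f :: "'a \<Rightarrow> real" assume "f \<in> Lip10"
    from int(3,4)[OF this] show "(LINT x|\<alpha>. f x) - (LINT x|\<beta>. f x) \<le> R + R" by linarith
  qed
  have S_upper: "(LINT x|\<alpha>. f x) - (LINT x|\<beta>. f x) \<le> S" if "f \<in> Lip10" for f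
    unfolding S_def using that by (intro cSUP_upper bdd)
  have S0: "0 \<le> S" using S_upper[OF zero_in_Lip10] by simp
  show "ennreal (SUP f\<in>Lip10. (LINT x|\<alpha>. f x) - (LINT x|\<beta>. f x)) \<le> wasserstein1 \<alpha> \<beta>"
    unfolding S_def[symmetric] wasserstein1_def
  proof (rule INF_greatest)
    fix \<pi> assume \<pi>: "\<pi> \<in> couplings \<alpha> \<beta>"
    have [measurable_cong]: "sets \<pi> = sets (borel \<Otimes>\<^sub>M borel)" using \<pi> by (simp add: couplings_def)
    have marg: "distr \<pi> borel fst = \<alpha>" "distr \<pi> borel snd = \<beta>" using \<pi> by (auto simp: couplings_def)
    let ?C = "\<integral>\<^sup>+ z. ennreal (dist (fst z) (snd z)) \<partial>\<pi>"
    show "ennreal S \<le> ?C"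
    proof (cases "?C = \<infinity>")
      case False
      have di: "integrable \<pi> (\<lambda>z. dist (fst z) (snd z))"
        using False by (intro integrableI_nonneg) (auto simp: top.not_eq_extremum)
      have "(LINT x|\<alpha>. f x) - (LINT x|\<beta>. f x) \<le> (LINT z|\<pi>. dist (fst z) (snd z))"
        if f: "f \<in> Lip10" for f
      proof -
        have [measurable]: "f \<in> borel_measurable borel" using Lip10_D(3)[OF f] .
        have i1: "integrable \<pi> (\<lambda>z. f (fst z))" "integrable \<pi> (\<lambda>z. f (snd z))"
          using int(1,2)[OF f] unfolding marg[symmetric] by (auto simp: integrable_distr_eq)
        have "(LINT x|\<alpha>. f x) - (LINT x|\<beta>. f x) = (LINT z|\<pi>. f (fst z) - f (snd z))"
          unfolding marg[symmetric] using i1 by (simp add: integral_distr)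
        also have "\<dots> \<le> (LINT z|\<pi>. dist (fst z) (snd z))"
          using i1 di abs_le_D1[OF Lip10_D(1)[OF f]]
          by (intro integral_mono Bochner_Integration.integrable_diff)
        finally show ?thesis .
      qed
      then have "S \<le> (LINT z|\<pi>. dist (fst z) (snd z))"
        unfolding S_def using zero_in_Lip10 by (intro cSUP_least) auto
      then show ?thesis
        using nn_integral_eq_integral[OF di] by (simp add: ennreal_leI)
    qed simp
  qed
  show "wasserstein1 \<alpha> \<beta> \<le> ennreal (SUP f\<in>Lip10. (LINT x|\<alpha>. f x) - (LINT x|\<beta>. f x))"
    unfolding S_def[symmetric]
  proof (rule ennreal_le_epsilon)
    fix e0 :: real assume "e0 > 0"
    define e where "e = e0 / 5"
    have e: "e > 0" using \<open>e0 > 0\<close> by (simp add: e_def)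
    obtain q :: "'a \<Rightarrow> 'a" where q[measurable]: "q \<in> borel_measurable borel" and fin: "finite (range q)"
      and dq: "\<And>y. y \<in> cball 0 R \<Longrightarrow> dist (q y) y \<le> e"
      using finite_range_quantizer[OF bounded_cball e] by metis
    define Z where "Z = range q"
    define A where "A z = q -` {z}" for z
    have [measurable]: "A z \<in> sets borel" for z
      unfolding A_def using measurable_sets[OF q, of "{z}"] by simp
    define a where "a z = measure \<alpha> (A z)" for z
    define b where "b z = measure \<beta> (A z)" for z
    have finZ: "finite Z" using fin by (simp add: Z_def)
    have disj: "disjoint_family_on A Z" by (auto simp: disjoint_family_on_def A_def)
    have un: "(\<Union>z\<in>Z. A z) = UNIV" by (auto simp: A_def Z_def)
    have sa: "sum a Z = 1"
      using \<alpha>.finite_measure_finite_Union[OF finZ _ disj] un \<alpha>.prob_space sets(1)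
      by (auto simp: a_def sets_eq_imp_space_eq[OF sets(1)] image_subset_iff)
    have sb: "sum b Z = 1"
      using \<beta>.finite_measure_finite_Union[OF finZ _ disj] un \<beta>.prob_space sets(2)
      by (auto simp: b_def sets_eq_imp_space_eq[OF sets(2)] image_subset_iff)
    obtain c f where c0: "\<And>z z'. z \<in> Z \<Longrightarrow> z' \<in> Z \<Longrightarrow> 0 \<le> c z z'"
      and ca: "\<And>z. z \<in> Z \<Longrightarrow> (\<Sum>z'\<in>Z. c z z') = a z"
      and cb: "\<And>z'. z' \<in> Z \<Longrightarrow> (\<Sum>z\<in>Z. c z z') = b z'"
      and lip: "1-lipschitz_on UNIV f"
      and cost: "(\<Sum>z\<in>Z. \<Sum>z'\<in>Z. c z z' * dist z z') \<le> (\<Sum>z\<in>Z. f z * (a z - b z)) + e"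
      using finite_Kantorovich_Rubinstein[OF finZ _ sa _ sb e] by (auto simp: a_def b_def)
    define g where "g x = f x - f 0" for x
    have g: "g \<in> Lip10" using lip by (auto simp: Lip10_def lipschitz_on_def g_def dist_real_def)
    have [measurable]: "g \<in> borel_measurable borel" using Lip10_D(3)[OF g] .
    have quant: "\<bar>(\<Sum>z\<in>Z. g z * measure \<gamma> (A z)) - (LINT x|\<gamma>. g x)\<bar> \<le> e"
      if \<gamma>: "prob_space \<gamma>" and s: "sets \<gamma> = sets borel" and A: "AE x in \<gamma>. norm x \<le> R" "integrable \<gamma> g" for \<gamma>
    proof -
      interpret \<gamma>: prob_space \<gamma> by fact
      note [measurable_cong] = s
      have gq: "g (q x) = (\<Sum>z\<in>Z. g z * indicator (A z) x)" for x
      proof -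
        have "(\<Sum>z\<in>Z. g z * indicator (A z) x) = (\<Sum>z\<in>Z. if z = q x then g z else 0)"
          by (intro sum.cong) (auto simp: A_def indicator_def)
        then show ?thesis using finZ by (simp add: Z_def)
      qed
      have i: "integrable \<gamma> (\<lambda>x. g (q x))"
        unfolding gq by (intro Bochner_Integration.integrable_sum integrable_mult_right
            integrable_real_indicator) (auto simp: less_top[symmetric])
      have "(LINT x|\<gamma>. g (q x)) = (\<Sum>z\<in>Z. g z * measure \<gamma> (A z))"
        unfolding gq by (subst Bochner_Integration.integral_sum) (auto simp: less_top[symmetric] s)
      then have "(\<Sum>z\<in>Z. g z * measure \<gamma> (A z)) - (LINT x|\<gamma>. g x) = (LINT x|\<gamma>. g (q x) - g x)"
        using i A by simp
      also have "\<bar>\<dots>\<bar> \<le> (LINT x|\<gamma>. \<bar>g (q x) - g x\<bar>)" by (rule integral_abs_bound)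
      also have "\<dots> \<le> (LINT x|\<gamma>. e)"
      proof (rule integral_mono_AE)
        show "AE x in \<gamma>. \<bar>g (q x) - g x\<bar> \<le> e"
          using A(1)
        proof eventually_elim
          case (elim x)
          then show ?case using Lip10_D(1)[OF g, of "q x" x] dq[of x] by simp
        qed
      qed (use i A in auto)
      finally show ?thesis by (simp add: \<gamma>.prob_space)
    qed
    have "(\<Sum>z\<in>Z. f z * (a z - b z)) = (\<Sum>z\<in>Z. g z * (a z - b z))"
    proof -
      have "(\<Sum>z\<in>Z. f 0 * (a z - b z)) = 0"
        by (simp add: sum_distrib_left[symmetric] sum_subtractf sa sb)
      then show ?thesis by (simp add: g_def left_diff_distrib sum_subtractf)
    qed
    also have "\<dots> = (\<Sum>z\<in>Z. g z * measure \<alpha> (A z)) - (\<Sum>z\<in>Z. g z * measure \<beta> (A z))"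
      by (simp add: a_def b_def right_diff_distrib sum_subtractf)
    also have "\<dots> \<le> S + 2 * e"
      using quant[of \<alpha>] quant[of \<beta>] assms int[OF g] S_upper[OF g] by (auto simp: abs_le_iff)
    finally have cost': "(\<Sum>z\<in>Z. \<Sum>z'\<in>Z. c z z' * dist z z') \<le> S + 3 * e" using cost by simp

    (* The coupling has density w z z' on the product of the cells of z and z'. If one of the two
       cells is null, so is c z z', and the quotient is 0 by convention. *)
    define w where "w z z' = c z z' / (a z * b z')" for z z'
    define r where "r = (\<lambda>u::'a \<times> 'a. \<Sum>z\<in>Z. \<Sum>z'\<in>Z. ennreal (w z z') * indicator (A z \<times> A z') u)"
    have [measurable]: "r \<in> borel_measurable (borel \<Otimes>\<^sub>M borel)"
      unfolding r_def by measurable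
    define \<pi> where "\<pi> = density (\<alpha> \<Otimes>\<^sub>M \<beta>) r"
    have s\<pi>: "sets \<pi> = sets (borel \<Otimes>\<^sub>M borel)"
      by (auto simp: \<pi>_def intro!: sets_pair_measure_cong sets)
    have w0: "0 \<le> w z z'" if "z \<in> Z" "z' \<in> Z" for z z'
      using c0[OF that] by (auto simp: w_def a_def b_def)
    have c_le: "c z z' \<le> a z" "c z z' \<le> b z'" if "z \<in> Z" "z' \<in> Z" for z z'
      using member_le_sum[of z' Z "\<lambda>z'. c z z'"] member_le_sum[of z Z "\<lambda>z. c z z'"] that c0 ca cb finZ
      by auto
    have wab: "w z z' * (a z * b z') = c z z'" if "z \<in> Z" "z' \<in> Z" for z z'
      using c0[OF that] c_le[OF that] by (cases "a z = 0 \<or> b z' = 0") (auto simp: w_def)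
    have box: "(\<integral>\<^sup>+ u. r u * h u \<partial>(\<alpha> \<Otimes>\<^sub>M \<beta>)) = (\<Sum>z\<in>Z. \<Sum>z'\<in>Z. ennreal (w z z') * (\<integral>\<^sup>+ u. indicator (A z \<times> A z') u * h u \<partial>(\<alpha> \<Otimes>\<^sub>M \<beta>)))"
      if [measurable]: "h \<in> borel_measurable (borel \<Otimes>\<^sub>M borel)" for h
      unfolding r_def sum_distrib_right
      by (subst nn_integral_sum; (measurable | intro sum.cong refl))+
        (auto simp: nn_integral_cmult mult.assoc)
    have rect: "(\<integral>\<^sup>+ u. indicator (A z \<times> A z') u * indicator (B \<times> C) u \<partial>(\<alpha> \<Otimes>\<^sub>M \<beta>)) =
        ennreal (measure \<alpha> (A z \<inter> B) * measure \<beta> (A z' \<inter> C))"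
      if [measurable]: "B \<in> sets borel" "C \<in> sets borel" for B C z z'
    proof -
      have "(\<integral>\<^sup>+ u. indicator (A z \<times> A z') u * indicator (B \<times> C) u \<partial>(\<alpha> \<Otimes>\<^sub>M \<beta>)) =
          (\<integral>\<^sup>+ u. indicator ((A z \<inter> B) \<times> (A z' \<inter> C)) u \<partial>(\<alpha> \<Otimes>\<^sub>M \<beta>))"
        by (intro nn_integral_cong) (auto simp: indicator_def)
      also have "\<dots> = emeasure (\<alpha> \<Otimes>\<^sub>M \<beta>) ((A z \<inter> B) \<times> (A z' \<inter> C))"
        by (intro nn_integral_indicator) measurable
      also have "\<dots> = emeasure \<alpha> (A z \<inter> B) * emeasure \<beta> (A z' \<inter> C)"
        by (rule \<beta>.emeasure_pair_measure_Times) measurable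
      finally show ?thesis by (simp add: \<alpha>.emeasure_eq_measure \<beta>.emeasure_eq_measure ennreal_mult)
    qed
    have meas: "emeasure \<pi> (B \<times> C) =
        ennreal (\<Sum>z\<in>Z. \<Sum>z'\<in>Z. w z z' * (measure \<alpha> (A z \<inter> B) * measure \<beta> (A z' \<inter> C)))"
      if [measurable]: "B \<in> sets borel" "C \<in> sets borel" for B C
    proof -
      have "emeasure \<pi> (B \<times> C) = (\<integral>\<^sup>+ u. r u * indicator (B \<times> C) u \<partial>(\<alpha> \<Otimes>\<^sub>M \<beta>))"
        unfolding \<pi>_def by (rule emeasure_density) measurable
      also have "\<dots> = (\<Sum>z\<in>Z. \<Sum>z'\<in>Z. ennreal (w z z' * (measure \<alpha> (A z \<inter> B) * measure \<beta> (A z' \<inter> C))))"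
        using w0 by (subst box) (auto simp: rect ennreal_mult intro!: sum.cong)
      also have "\<dots> = (\<Sum>z\<in>Z. ennreal (\<Sum>z'\<in>Z. w z z' * (measure \<alpha> (A z \<inter> B) * measure \<beta> (A z' \<inter> C))))"
        using w0 by (intro sum.cong refl sum_ennreal) auto
      also have "\<dots> = ennreal (\<Sum>z\<in>Z. \<Sum>z'\<in>Z. w z z' * (measure \<alpha> (A z \<inter> B) * measure \<beta> (A z' \<inter> C)))"
        using w0 by (intro sum_ennreal sum_nonneg) auto
      finally show ?thesis .
    qed
    have split_meas: "measure \<gamma> B = (\<Sum>z\<in>Z. measure \<gamma> (A z \<inter> B))"
      if "prob_space \<gamma>" and s: "sets \<gamma> = sets borel" and [measurable]: "B \<in> sets borel" for \<gamma> B
    proof -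
      interpret \<gamma>: prob_space \<gamma> by fact
      have "(\<Union>z\<in>Z. A z \<inter> B) = B" using un by auto
      moreover have "disjoint_family_on (\<lambda>z. A z \<inter> B) Z"
        using disj by (auto simp: disjoint_family_on_def)
      ultimately show ?thesis
        using \<gamma>.finite_measure_finite_Union[OF finZ, of "\<lambda>z. A z \<inter> B"] s
        by (simp add: image_subset_iff)
    qed
    have \<pi>c: "\<pi> \<in> couplings \<alpha> \<beta>"
      unfolding couplings_def
    proof (intro CollectI conjI)
      show "sets \<pi> = sets (borel \<Otimes>\<^sub>M borel)" by fact
      note [measurable_cong] = s\<pi>
      show "distr \<pi> borel fst = \<alpha>"
      proof (rule measure_eqI)
        fix B assume "B \<in> sets (distr \<pi> borel fst)"
        then have [measurable]: "B \<in> sets borel" by simp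
        have "emeasure (distr \<pi> borel fst) B = emeasure \<pi> (B \<times> UNIV)"
          using sets_eq_imp_space_eq[OF s\<pi>]
          by (auto simp: emeasure_distr space_pair_measure intro!: arg_cong[where f = "emeasure \<pi>"])
        also have "\<dots> = ennreal (\<Sum>z\<in>Z. measure \<alpha> (A z \<inter> B))"
        proof -
          have "(\<Sum>z'\<in>Z. w z z' * (measure \<alpha> (A z \<inter> B) * b z')) = measure \<alpha> (A z \<inter> B)" if z: "z \<in> Z" for z
          proof (cases "a z = 0")
            case True
            have "measure \<alpha> (A z \<inter> B) \<le> a z"
              unfolding a_def by (intro \<alpha>.finite_measure_mono) (auto simp: sets)
            then have "measure \<alpha> (A z \<inter> B) = 0" using True measure_nonneg[of \<alpha> "A z \<inter> B"] by simp
            then show ?thesis by simp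
          next
            case False
            have "(\<Sum>z'\<in>Z. w z z' * (measure \<alpha> (A z \<inter> B) * b z')) =
              (\<Sum>z'\<in>Z. c z z' * (measure \<alpha> (A z \<inter> B) / a z))"
              using False wab[OF z] by (intro sum.cong) (auto simp: field_simps)
            also have "\<dots> = measure \<alpha> (A z \<inter> B)"
              using False by (simp only: sum_distrib_right[symmetric] ca[OF z]) simp
            finally show ?thesis .
          qed
          then show ?thesis by (simp add: meas b_def[symmetric])
        qed
        also have "\<dots> = emeasure \<alpha> B"
          using split_meas[of \<alpha> B] assms by (simp add: \<alpha>.emeasure_eq_measure)
        finally show "emeasure (distr \<pi> borel fst) B = emeasure \<alpha> B" .
      qed (simp add: sets)
      show "distr \<pi> borel snd = \<beta>"
      proof (rule measure_eqI)
        fix C assume "C \<in> sets (distr \<pi> borel snd)"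
        then have [measurable]: "C \<in> sets borel" by simp
        have "emeasure (distr \<pi> borel snd) C = emeasure \<pi> (UNIV \<times> C)"
          using sets_eq_imp_space_eq[OF s\<pi>]
          by (auto simp: emeasure_distr space_pair_measure intro!: arg_cong[where f = "emeasure \<pi>"])
        also have "\<dots> = ennreal (\<Sum>z'\<in>Z. measure \<beta> (A z' \<inter> C))"
        proof -
          have "(\<Sum>z\<in>Z. w z z' * (a z * measure \<beta> (A z' \<inter> C))) = measure \<beta> (A z' \<inter> C)" if z: "z' \<in> Z" for z'
          proof (cases "b z' = 0")
            case True
            have "measure \<beta> (A z' \<inter> C) \<le> b z'"
              unfolding b_def by (intro \<beta>.finite_measure_mono) (auto simp: sets)
            then have "measure \<beta> (A z' \<inter> C) = 0" using True measure_nonneg[of \<beta> "A z' \<inter> C"] by simp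
            then show ?thesis by simp
          next
            case False
            have "(\<Sum>z\<in>Z. w z z' * (a z * measure \<beta> (A z' \<inter> C))) =
              (\<Sum>z\<in>Z. c z z' * (measure \<beta> (A z' \<inter> C) / b z'))"
              using False wab[OF _ z] by (intro sum.cong) (auto simp: field_simps)
            also have "\<dots> = measure \<beta> (A z' \<inter> C)"
              using False by (simp only: sum_distrib_right[symmetric] cb[OF z]) simp
            finally show ?thesis .
          qed
          then have "(\<Sum>z'\<in>Z. \<Sum>z\<in>Z. w z z' * (a z * measure \<beta> (A z' \<inter> C))) =
              (\<Sum>z'\<in>Z. measure \<beta> (A z' \<inter> C))" by simp
          moreover have "(\<Sum>z\<in>Z. \<Sum>z'\<in>Z. w z z' * (a z * measure \<beta> (A z' \<inter> C))) =
              (\<Sum>z'\<in>Z. \<Sum>z\<in>Z. w z z' * (a z * measure \<beta> (A z' \<inter> C)))"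
            by (rule sum.swap)
          ultimately show ?thesis by (simp add: meas a_def[symmetric])
        qed
        also have "\<dots> = emeasure \<beta> C"
          using split_meas[of \<beta> C] assms by (simp add: \<beta>.emeasure_eq_measure)
        finally show "emeasure (distr \<pi> borel snd) C = emeasure \<beta> C" .
      qed (simp add: sets)
    qed
    have "wasserstein1 \<alpha> \<beta> \<le> (\<integral>\<^sup>+ z. ennreal (dist (fst z) (snd z)) \<partial>\<pi>)"
      unfolding wasserstein1_def by (rule INF_lower[OF \<pi>c])
    also have "\<dots> \<le> (\<integral>\<^sup>+ u. ennreal (2 * e + dist (q (fst u)) (q (snd u))) \<partial>\<pi>)"
    proof (rule nn_integral_mono_AE)
      show "AE u in \<pi>. ennreal (dist (fst u) (snd u)) \<le> ennreal (2 * e + dist (q (fst u)) (q (snd u)))"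
        using AE_couplings[OF \<pi>c sets AE]
      proof eventually_elim
        case (elim u)
        then have "dist (q (fst u)) (fst u) \<le> e" "dist (q (snd u)) (snd u) \<le> e"
          using dq by auto
        moreover have "dist (fst u) (snd u) \<le> dist (q (fst u)) (fst u) + dist (q (fst u)) (q (snd u)) + dist (q (snd u)) (snd u)"
          using dist_triangle3[of "fst u" "snd u" "q (fst u)"] dist_triangle[of "q (fst u)" "snd u" "q (snd u)"]
          by linarith
        ultimately show ?case by (intro ennreal_leI) simp
      qed
    qed
    also have "\<dots> = (\<integral>\<^sup>+ u. r u * ennreal (2 * e + dist (q (fst u)) (q (snd u))) \<partial>(\<alpha> \<Otimes>\<^sub>M \<beta>))"
      unfolding \<pi>_def by (rule nn_integral_density) measurable
    also have "\<dots> = (\<Sum>z\<in>Z. \<Sum>z'\<in>Z. ennreal (c z z' * (2 * e + dist z z')))"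
    proof (subst box)
      show "(\<Sum>z\<in>Z. \<Sum>z'\<in>Z. ennreal (w z z') * (\<integral>\<^sup>+ u. indicator (A z \<times> A z') u *
          ennreal (2 * e + dist (q (fst u)) (q (snd u))) \<partial>(\<alpha> \<Otimes>\<^sub>M \<beta>))) =
          (\<Sum>z\<in>Z. \<Sum>z'\<in>Z. ennreal (c z z' * (2 * e + dist z z')))"
      proof (intro sum.cong refl)
        fix z z' assume z: "z \<in> Z" "z' \<in> Z"
        have "(\<integral>\<^sup>+ u. indicator (A z \<times> A z') u * ennreal (2 * e + dist (q (fst u)) (q (snd u))) \<partial>(\<alpha> \<Otimes>\<^sub>M \<beta>)) =
            (\<integral>\<^sup>+ u. ennreal (2 * e + dist z z') * (indicator (A z \<times> A z') u * indicator (UNIV \<times> UNIV) u) \<partial>(\<alpha> \<Otimes>\<^sub>M \<beta>))"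
          by (intro nn_integral_cong) (auto simp: indicator_def A_def)
        also have "\<dots> = ennreal (2 * e + dist z z') * (\<integral>\<^sup>+ u. indicator (A z \<times> A z') u * indicator (UNIV \<times> UNIV) u \<partial>(\<alpha> \<Otimes>\<^sub>M \<beta>))"
          by (intro nn_integral_cmult) measurable
        also have "\<dots> = ennreal (2 * e + dist z z') * ennreal (a z * b z')"
          by (subst rect) (auto simp: a_def b_def)
        finally have X: "(\<integral>\<^sup>+ u. indicator (A z \<times> A z') u * ennreal (2 * e + dist (q (fst u)) (q (snd u))) \<partial>(\<alpha> \<Otimes>\<^sub>M \<beta>)) =
            ennreal (2 * e + dist z z') * ennreal (a z * b z')" .
        have "0 \<le> 2 * e + dist z z'" using e by simp
        then have "ennreal (w z z') * (ennreal (2 * e + dist z z') * ennreal (a z * b z')) =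
            ennreal (w z z' * ((2 * e + dist z z') * (a z * b z')))"
          by (simp only: ennreal_mult'[OF w0[OF z]] ennreal_mult'[of "2 * e + dist z z'"])
        then show "ennreal (w z z') * (\<integral>\<^sup>+ u. indicator (A z \<times> A z') u *
            ennreal (2 * e + dist (q (fst u)) (q (snd u))) \<partial>(\<alpha> \<Otimes>\<^sub>M \<beta>)) = ennreal (c z z' * (2 * e + dist z z'))"
          unfolding X wab[OF z, symmetric] by (simp only: mult_ac)
      qed
    qed measurable
    also have "\<dots> = (\<Sum>z\<in>Z. ennreal (\<Sum>z'\<in>Z. c z z' * (2 * e + dist z z')))"
      using c0 e by (intro sum.cong refl sum_ennreal) auto
    also have "\<dots> = ennreal (\<Sum>z\<in>Z. \<Sum>z'\<in>Z. c z z' * (2 * e + dist z z'))"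
      using c0 e by (intro sum_ennreal sum_nonneg) auto
    also have "(\<Sum>z\<in>Z. \<Sum>z'\<in>Z. c z z' * (2 * e + dist z z')) =
        2 * e * (\<Sum>z\<in>Z. \<Sum>z'\<in>Z. c z z') + (\<Sum>z\<in>Z. \<Sum>z'\<in>Z. c z z' * dist z z')"
      by (simp add: sum.distrib sum_distrib_left algebra_simps)
    also have "(\<Sum>z\<in>Z. \<Sum>z'\<in>Z. c z z') = 1" by (simp add: ca sa)
    also have "ennreal (2 * e * 1 + (\<Sum>z\<in>Z. \<Sum>z'\<in>Z. c z z' * dist z z')) \<le> ennreal (S + e0)"
      using cost' by (intro ennreal_leI) (simp add: e_def)
    also have "\<dots> = ennreal S + ennreal e0" using S0 \<open>e0 > 0\<close> by (simp add: ennreal_plus)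
    finally show "wasserstein1 \<alpha> \<beta> \<le> ennreal S + ennreal e0" .
  qed
qed

section \<open>Pairings of coefficient sequences\<close>

definition box_seq :: "(nat \<Rightarrow> real) \<Rightarrow> (nat \<Rightarrow> real) set" where
  "box_seq \<beta> = {b. \<forall>k. \<bar>b k\<bar> \<le> \<beta> k}"

definition ip :: "(nat \<Rightarrow> real) \<Rightarrow> (nat \<Rightarrow> real) \<Rightarrow> real" where
  "ip b u = (\<Sum>k. b k * u k)"

lemma box_seqD: "b \<in> box_seq \<beta> \<Longrightarrow> \<bar>b k\<bar> \<le> \<beta> k"
  by (simp add: box_seq_def)

text \<open>Tychonoff's theorem. This compactness, for coordinatewise convergence, takes the place of total
boundedness of the function class.\<close>

lemma compact_box_seq: "compact (box_seq \<beta>)"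
proof -
  have "compactin (product_topology (\<lambda>i::nat. euclidean::real topology) UNIV) (PiE UNIV (\<lambda>k. {- \<beta> k..\<beta> k}))"
    by (subst compactin_PiE) auto
  moreover have "PiE UNIV (\<lambda>k. {- \<beta> k..\<beta> k}) = box_seq \<beta>"
    by (auto simp: box_seq_def PiE_def Pi_def abs_le_iff minus_le_iff)
  ultimately show ?thesis by (simp add: euclidean_product_topology)
qed

lemma continuous_on_coordinate: "continuous_on S (\<lambda>u :: nat \<Rightarrow> real. u k)"
  by (rule continuous_on_subset[OF continuous_on_product_coordinates subset_UNIV])

lemma coordinate_tendsto:
  fixes b :: "nat \<Rightarrow> nat \<Rightarrow> real" assumes "b \<longlonglongrightarrow> c" shows "(\<lambda>n. b n k) \<longlonglongrightarrow> c k"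
  using continuous_on_tendsto_compose[OF continuous_on_coordinate[of UNIV k] assms] by simp

lemma closed_box_seq: "closed (box_seq \<beta>)"
  using compact_box_seq compact_imp_closed by blast

lemma continuous_on_suminf_bounded:
  fixes f :: "nat \<Rightarrow> 'a::topological_space \<Rightarrow> real"
  assumes "\<And>k. continuous_on S (f k)" "\<And>k x. x \<in> S \<Longrightarrow> \<bar>f k x\<bar> \<le> M k" "summable M"
  shows "continuous_on S (\<lambda>x. \<Sum>k. f k x)"
proof (rule uniform_limit_theorem[OF _ Weierstrass_m_test[where M = M]])
  show "\<forall>\<^sub>F n in sequentially. continuous_on S (\<lambda>x. \<Sum>i<n. f i x)"
    by (intro always_eventually allI continuous_on_sum assms)
qed (use assms in auto)

lemma summable_ip:
  assumes "b \<in> box_seq \<beta>" "summable (\<lambda>k. \<beta> k * \<bar>u k\<bar>)"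
  shows "summable (\<lambda>k. b k * u k)" "\<bar>ip b u\<bar> \<le> (\<Sum>k. \<beta> k * \<bar>u k\<bar>)"
proof -
  have le: "\<bar>b k * u k\<bar> \<le> \<beta> k * \<bar>u k\<bar>" for k
    using box_seqD[OF assms(1), of k] by (simp add: abs_mult mult_right_mono)
  have s: "summable (\<lambda>k. \<bar>b k * u k\<bar>)"
    by (rule summable_comparison_test[OF _ assms(2)]) (use le in auto)
  then show "summable (\<lambda>k. b k * u k)" by (rule summable_rabs_cancel)
  show "\<bar>ip b u\<bar> \<le> (\<Sum>k. \<beta> k * \<bar>u k\<bar>)"
    unfolding ip_def using summable_rabs[OF s] suminf_le[OF le s assms(2)] by linarith
qed

lemma continuous_on_ip_left:
  assumes "summable (\<lambda>k. \<beta> k * \<bar>w k\<bar>)"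
  shows "continuous_on (box_seq \<beta>) (\<lambda>b. ip b w)"
  unfolding ip_def
proof (rule continuous_on_suminf_bounded[OF _ _ assms])
  show "continuous_on (box_seq \<beta>) (\<lambda>b. b k * w k)" for k
    by (intro continuous_on_mult continuous_on_coordinate continuous_on_const)
  show "\<bar>b k * w k\<bar> \<le> \<beta> k * \<bar>w k\<bar>" if "b \<in> box_seq \<beta>" for b k
    using box_seqD[OF that, of k] by (simp add: abs_mult mult_right_mono)
qed

lemma summable_weighted_diff:
  fixes \<beta> :: "nat \<Rightarrow> real"
  assumes "\<And>k. 0 \<le> \<beta> k" "summable (\<lambda>k. \<beta> k * \<bar>u k\<bar>)" "summable (\<lambda>k. \<beta> k * \<bar>v k\<bar>)"
  shows "summable (\<lambda>k. \<beta> k * \<bar>u k - v k\<bar>)"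
proof (rule summable_comparison_test[OF _ summable_add[OF assms(2,3)]], intro exI allI impI)
  fix k
  have "\<beta> k * \<bar>u k - v k\<bar> \<le> \<beta> k * (\<bar>u k\<bar> + \<bar>v k\<bar>)"
    using assms(1) by (intro mult_left_mono) auto
  then show "norm (\<beta> k * \<bar>u k - v k\<bar>) \<le> \<beta> k * \<bar>u k\<bar> + \<beta> k * \<bar>v k\<bar>"
    using assms(1)[of k] by (simp add: distrib_left)
qed

lemma ip_diff_right:
  assumes "b \<in> box_seq \<beta>" "\<And>k. 0 \<le> \<beta> k"
    "summable (\<lambda>k. \<beta> k * \<bar>u k\<bar>)" "summable (\<lambda>k. \<beta> k * \<bar>v k\<bar>)"
  shows "\<bar>ip b u - ip b v\<bar> \<le> (\<Sum>k. \<beta> k * \<bar>u k - v k\<bar>)"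
proof -
  have "ip b u - ip b v = ip b (\<lambda>k. u k - v k)"
    unfolding ip_def
    by (subst suminf_diff[OF summable_ip(1)[OF assms(1,3)] summable_ip(1)[OF assms(1,4)]])
       (simp add: right_diff_distrib)
  then show ?thesis
    using summable_ip(2)[OF assms(1) summable_weighted_diff[OF assms(2-4)]] by simp
qed

lemma summable_box:
  assumes "summable \<beta>" "u \<in> box_seq (\<lambda>_. \<rho>)" "\<And>k. 0 \<le> \<beta> k"
  shows "summable (\<lambda>k. \<beta> k * \<bar>u k\<bar>)"
proof (rule summable_comparison_test[OF _ summable_mult2[OF assms(1), of \<rho>]], intro exI allI impI)
  show "norm (\<beta> k * \<bar>u k\<bar>) \<le> \<beta> k * \<rho>" for k
    using box_seqD[OF assms(2), of k] assms(3)[of k] by (simp add: abs_mult mult_left_mono)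
qed

lemma continuous_on_ip:
  assumes "summable \<beta>" "\<And>k. 0 \<le> \<beta> k"
  shows "continuous_on (box_seq \<beta> \<times> box_seq (\<lambda>_. \<rho>)) (\<lambda>x. ip (fst x) (snd x))"
  unfolding ip_def
proof (rule continuous_on_suminf_bounded[OF _ _ summable_mult2[OF assms(1), of \<rho>]])
  show "continuous_on (box_seq \<beta> \<times> box_seq (\<lambda>_. \<rho>)) (\<lambda>x. fst x k * snd x k)" for k
    by (intro continuous_intros continuous_on_product_then_coordinatewise)
  show "\<bar>fst x k * snd x k\<bar> \<le> \<beta> k * \<rho>" if "x \<in> box_seq \<beta> \<times> box_seq (\<lambda>_. \<rho>)" for k x
    using that assms(2)[of k] by (auto simp: abs_mult box_seq_def intro!: mult_mono)
qed

lemma SUP_diff_le: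
  fixes f g :: "'a \<Rightarrow> real"
  assumes "A \<noteq> {}" "bdd_above (f ` A)" "bdd_above (g ` A)" "\<And>b. b \<in> A \<Longrightarrow> \<bar>f b - g b\<bar> \<le> d"
  shows "\<bar>(SUP b\<in>A. f b) - (SUP b\<in>A. g b)\<bar> \<le> d"
proof -
  have "f b \<le> (SUP b\<in>A. g b) + d" "g b \<le> (SUP b\<in>A. f b) + d" if "b \<in> A" for b
    using assms(4)[OF that] cSUP_upper[OF that assms(2)] cSUP_upper[OF that assms(3)] by linarith+
  then have "(SUP b\<in>A. f b) \<le> (SUP b\<in>A. g b) + d" "(SUP b\<in>A. g b) \<le> (SUP b\<in>A. f b) + d"
    using assms(1) by (auto intro!: cSUP_least)
  then show ?thesis by linarith
qed

lemma bdd_above_ip: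
  assumes "A \<subseteq> box_seq \<beta>" "summable (\<lambda>k. \<beta> k * \<bar>u k\<bar>)"
  shows "bdd_above ((\<lambda>b. ip b u) ` A)"
  using summable_ip(2)[OF _ assms(2)] assms(1) abs_le_D1 by (intro bdd_aboveI2) blast

lemma SUP_ip_diff:
  assumes "M \<subseteq> box_seq \<beta>" "M \<noteq> {}" "\<And>k. 0 \<le> \<beta> k"
    "summable (\<lambda>k. \<beta> k * \<bar>u k\<bar>)" "summable (\<lambda>k. \<beta> k * \<bar>v k\<bar>)"
  shows "\<bar>(SUP b\<in>M. ip b u) - (SUP b\<in>M. ip b v)\<bar> \<le> (\<Sum>k. \<beta> k * \<bar>u k - v k\<bar>)"
  using assms(1) by (intro SUP_diff_le bdd_above_ip[of _ \<beta>] ip_diff_right assms) auto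

text \<open>A supremum of pairings changes by at most the weighted \<open>\<ell>\<^sup>1\<close> distance of its arguments, and on a cube
that distance is continuous for coordinatewise convergence because the weights are summable.\<close>

lemma continuous_on_SUP_ip:
  assumes M: "M \<subseteq> box_seq \<beta>" "M \<noteq> {}" and \<beta>: "\<And>k. 0 \<le> \<beta> k" "summable \<beta>"
  shows "continuous_on (box_seq (\<lambda>_. \<rho>)) (\<lambda>u. SUP b\<in>M. ip b u)"
  unfolding continuous_on_def
proof (intro ballI)
  fix u :: "nat \<Rightarrow> real" assume u: "u \<in> box_seq (\<lambda>_. \<rho>)"
  let ?d = "\<lambda>v. \<Sum>k. \<beta> k * \<bar>v k - u k\<bar>"
  have "continuous_on (box_seq (\<lambda>_. \<rho>)) ?d"
  proof (rule continuous_on_suminf_bounded)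
    show "continuous_on (box_seq (\<lambda>_. \<rho>)) (\<lambda>x. \<beta> k * \<bar>x k - u k\<bar>)" for k
      by (intro continuous_intros continuous_on_product_then_coordinatewise)
    show "\<bar>\<beta> k * \<bar>x k - u k\<bar>\<bar> \<le> \<beta> k * (2 * \<rho>)" if "x \<in> box_seq (\<lambda>_. \<rho>)" for k x
    proof -
      have "\<bar>x k - u k\<bar> \<le> 2 * \<rho>" using box_seqD[OF that, of k] box_seqD[OF u, of k] by linarith
      then show ?thesis using \<beta>(1)[of k] by (simp add: abs_mult mult_left_mono)
    qed
    show "summable (\<lambda>k. \<beta> k * (2 * \<rho>))" by (intro summable_mult2 \<beta>)
  qed
  then have "(?d \<longlongrightarrow> ?d u) (at u within box_seq (\<lambda>_. \<rho>))"
    using u by (auto simp: continuous_on_def)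
  then have d0: "(?d \<longlongrightarrow> 0) (at u within box_seq (\<lambda>_. \<rho>))" by simp
  have "((\<lambda>v. (SUP b\<in>M. ip b v) - (SUP b\<in>M. ip b u)) \<longlongrightarrow> 0) (at u within box_seq (\<lambda>_. \<rho>))"
  proof (rule Lim_null_comparison[OF _ d0])
    show "\<forall>\<^sub>F v in at u within box_seq (\<lambda>_. \<rho>). norm ((SUP b\<in>M. ip b v) - (SUP b\<in>M. ip b u)) \<le> ?d v"
      unfolding eventually_at_filter real_norm_def
      by (intro always_eventually allI impI SUP_ip_diff M \<beta> summable_box[OF \<beta>(2) _ \<beta>(1), where \<rho> = \<rho>] u)
  qed
  then show "((\<lambda>v. SUP b\<in>M. ip b v) \<longlongrightarrow> (SUP b\<in>M. ip b u)) (at u within box_seq (\<lambda>_. \<rho>))"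
    by (simp add: LIM_zero_iff)
qed

section \<open>Weak convergence through trigonometric polynomials\<close>

text \<open>The phase \<open>\<theta>\<close> makes the set contain sines along with cosines, and it makes the product formula for
cosines stay inside the set.\<close>

inductive_set trig_poly :: "((nat \<Rightarrow> real) \<Rightarrow> real) set" where
  base: "(\<lambda>u. c * cos ((\<Sum>k<K. t k * u k) + \<theta>)) \<in> trig_poly"
| add: "f \<in> trig_poly \<Longrightarrow> g \<in> trig_poly \<Longrightarrow> (\<lambda>u. f u + g u) \<in> trig_poly"

lemma trig_poly_mult_base:
  "(\<lambda>u. (c * cos ((\<Sum>k<K. t k * u k) + \<theta>)) * (d * cos ((\<Sum>k<L. s k * u k) + \<eta>))) \<in> trig_poly"
proof -
  define t' where "t' k = (if k < K then t k else 0)" for k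
  define s' where "s' k = (if k < L then s k else 0)" for k
  have t': "(\<Sum>k<K. t k * u k) = (\<Sum>k<max K L. t' k * u k)" for u
    by (rule sum.mono_neutral_cong_left) (auto simp: t'_def)
  have s': "(\<Sum>k<L. s k * u k) = (\<Sum>k<max K L. s' k * u k)" for u
    by (rule sum.mono_neutral_cong_left) (auto simp: s'_def)
  have "(c * cos ((\<Sum>k<K. t k * u k) + \<theta>)) * (d * cos ((\<Sum>k<L. s k * u k) + \<eta>)) =
      (c * d / 2) * cos ((\<Sum>k<max K L. (t' k - s' k) * u k) + (\<theta> - \<eta>)) +
      (c * d / 2) * cos ((\<Sum>k<max K L. (t' k + s' k) * u k) + (\<theta> + \<eta>))" for u
  proof -
    let ?x = "(\<Sum>k<max K L. t' k * u k) + \<theta>" and ?y = "(\<Sum>k<max K L. s' k * u k) + \<eta>"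
    have e: "(\<Sum>k<max K L. (t' k - s' k) * u k) + (\<theta> - \<eta>) = ?x - ?y"
      "(\<Sum>k<max K L. (t' k + s' k) * u k) + (\<theta> + \<eta>) = ?x + ?y"
      by (simp_all add: left_diff_distrib distrib_right sum_subtractf sum.distrib)
    have "cos x * cos y = cos (x - y) / 2 + cos (x + y) / 2" for x y :: real
      by (simp add: cos_diff cos_add field_simps)
    note prod = this[of ?x ?y]
    have "(c * cos ?x) * (d * cos ?y) = c * d * (cos ?x * cos ?y)" by (simp only: mult_ac)
    then show ?thesis unfolding e t' s' prod by (simp add: distrib_left)
  qed
  then show ?thesis by (simp only: trig_poly.add[OF trig_poly.base trig_poly.base])
qed

lemma trig_poly_mult:
  assumes "f \<in> trig_poly" "g \<in> trig_poly"
  shows "(\<lambda>u. f u * g u) \<in> trig_poly"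
  using assms
proof (induction f)
  case (base c t K \<theta>)
  from base.prems show ?case
  proof (induction g)
    case (base d s L \<eta>)
    show ?case by (rule trig_poly_mult_base)
  next
    case (add f g)
    then show ?case using trig_poly.add by (simp add: distrib_left)
  qed
next
  case (add f1 f2)
  then show ?case using trig_poly.add by (simp add: distrib_right)
qed

lemma trig_poly_const: "(\<lambda>_. c) \<in> trig_poly"
  using trig_poly.base[where c = c and K = 0 and t = "\<lambda>_. 0" and \<theta> = 0] by simp

lemma trig_poly_sin: "(\<lambda>u. sin (u k)) \<in> trig_poly"
proof -
  have "(\<lambda>u. sin (u k)) = (\<lambda>u. 1 * cos ((\<Sum>j<Suc k. (if j = k then 1 else 0) * u j) + (- pi / 2)))"
    by (auto simp: fun_eq_iff cos_diff if_distrib[where f = "\<lambda>x. x * _"] cong: if_cong)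
  then show ?thesis by (simp only: trig_poly.base)
qed

text \<open>Stone-Weierstrass on the compact cube \<open>[-1, 1]\<^sup>\<nat>\<close>. The functions on the cube that become
trigonometric polynomials after substituting sines for the coordinates form an algebra, and it
separates points. The substitution makes the approximation uniform on the whole sequence space.\<close>

lemma trig_poly_dense:
  assumes "continuous_on (box_seq (\<lambda>_. 1)) h" "e > 0"
  obtains g where "g \<in> trig_poly" "\<And>u. \<bar>h (\<lambda>k. sin (u k)) - g u\<bar> < e"
proof -
  let ?S = "box_seq (\<lambda>_. 1)"
  define R where "R = {f. continuous_on ?S f \<and> (\<lambda>u. f (\<lambda>k. sin (u k))) \<in> trig_poly}"
  interpret function_ring_on R ?S
  proof
    show "compact ?S" by (rule compact_box_seq)
    fix x y :: "nat \<Rightarrow> real" assume "x \<noteq> y"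
    then obtain k where "x k \<noteq> y k" by auto
    moreover have "(\<lambda>u. u k) \<in> R"
      by (simp add: R_def trig_poly_sin continuous_on_coordinate)
    ultimately show "\<exists>f\<in>R. f x \<noteq> f y" by (intro bexI[of _ "\<lambda>u. u k"]) simp_all
  next
    fix f g assume "f \<in> R" "g \<in> R"
    then show "(\<lambda>x. f x + g x) \<in> R" "(\<lambda>x. f x * g x) \<in> R"
      by (simp_all add: R_def trig_poly.add trig_poly_mult continuous_on_add continuous_on_mult)
  qed (simp_all add: R_def trig_poly_const)
  obtain f where f: "f \<in> R" "\<And>x. x \<in> ?S \<Longrightarrow> \<bar>h x - f x\<bar> < e"
    using Stone_Weierstrass_basic[OF assms] by auto
  show ?thesis
  proof (rule that)
    show "(\<lambda>u. f (\<lambda>k. sin (u k))) \<in> trig_poly" using f by (simp add: R_def)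
    show "\<bar>h (\<lambda>k. sin (u k)) - f (\<lambda>k. sin (u k))\<bar> < e" for u
      by (rule f(2)) (auto simp: box_seq_def)
  qed
qed

lemma (in prob_space) expectation_cos_char:
  assumes [measurable]: "Y \<in> borel_measurable M"
  shows "expectation (\<lambda>\<omega>. cos (Y \<omega> + \<theta>)) = Re (cis \<theta> * char (distr M borel Y) 1)"
proof -
  have i: "integrable M (\<lambda>\<omega>. cis (Y \<omega>))"
    unfolding cis_conv_exp by (intro integrable_const_bound[where B = 1]) auto
  have "char (distr M borel Y) 1 = (LINT \<omega>|M. cis (Y \<omega>))"
    unfolding char_def by (subst integral_distr) (auto simp: cis_conv_exp)
  then have "cis \<theta> * char (distr M borel Y) 1 = (LINT \<omega>|M. cis \<theta> * cis (Y \<omega>))"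
    by simp
  also have "Re \<dots> = (LINT \<omega>|M. Re (cis \<theta> * cis (Y \<omega>)))"
    using i by (subst integral_Re) auto
  finally show ?thesis by (simp add: cis_mult add.commute)
qed

lemma trig_poly_continuous_bounded:
  assumes "g \<in> trig_poly"
  shows "continuous_on UNIV g" "\<exists>B. \<forall>u. \<bar>g u\<bar> \<le> B"
proof -
  show "continuous_on UNIV g"
    using assms
  proof induction
    case (base c t K \<theta>)
    show ?case
      by (intro continuous_on_mult continuous_on_add continuous_on_cos continuous_on_sum
          continuous_on_const continuous_on_coordinate)
  qed (rule continuous_on_add)
  show "\<exists>B. \<forall>u. \<bar>g u\<bar> \<le> B"
    using assms
  proof induction
    case (base c t K \<theta>)
    have "\<bar>c * cos ((\<Sum>k<K. t k * u k) + \<theta>)\<bar> \<le> \<bar>c\<bar>" for u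
      by (simp add: abs_mult mult_left_le)
    then show ?case by blast
  next
    case (add f g)
    then obtain B C where "\<forall>u. \<bar>f u\<bar> \<le> B" "\<forall>u. \<bar>g u\<bar> \<le> C" by blast
    then have "\<bar>f u + g u\<bar> \<le> B + C" for u
      by (meson abs_triangle_ineq order_trans add_mono)
    then show ?case by blast
  qed
qed

lemma borel_measurable_seqI:
  assumes "\<And>k. (\<lambda>\<omega>. U \<omega> k) \<in> borel_measurable P"
  shows "U \<in> measurable P (borel :: (nat \<Rightarrow> real) measure)"
  using assms by (rule measurable_coordinatewise_then_product)

text \<open>By Levy's theorem this is convergence in distribution of all finite dimensional marginals. The
argument 1 suffices because the coefficients can be rescaled.\<close>

definition fdd_conv :: "'w measure \<Rightarrow> (nat \<Rightarrow> 'w \<Rightarrow> nat \<Rightarrow> real) \<Rightarrow> 'v measure \<Rightarrow> ('v \<Rightarrow> nat \<Rightarrow> real) \<Rightarrow> bool" where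
  "fdd_conv P U N V \<longleftrightarrow>
     (\<forall>K t. (\<lambda>n. char (distr P borel (\<lambda>\<omega>. \<Sum>k<K. t k * U n \<omega> k)) 1)
        \<longlonglongrightarrow> char (distr N borel (\<lambda>\<omega>. \<Sum>k<K. t k * V \<omega> k)) 1)"

lemma fdd_conv_scale:
  assumes "fdd_conv P U N V"
  shows "fdd_conv P (\<lambda>n \<omega> k. U n \<omega> k / \<rho>) N (\<lambda>\<omega> k. V \<omega> k / \<rho>)"
  unfolding fdd_conv_def
proof (intro allI)
  fix K and t :: "nat \<Rightarrow> real"
  show "(\<lambda>n. char (distr P borel (\<lambda>\<omega>. \<Sum>k<K. t k * (U n \<omega> k / \<rho>))) 1)
        \<longlonglongrightarrow> char (distr N borel (\<lambda>\<omega>. \<Sum>k<K. t k * (V \<omega> k / \<rho>))) 1"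
    using assms[unfolded fdd_conv_def, rule_format, of "\<lambda>k. t k / \<rho>" K] by simp
qed

lemma fdd_conv_trig_poly:
  assumes "prob_space P" "prob_space N"
    and U: "\<And>n k. (\<lambda>\<omega>. U n \<omega> k) \<in> borel_measurable P" and V: "\<And>k. (\<lambda>\<omega>. V \<omega> k) \<in> borel_measurable N"
    and conv: "fdd_conv P U N V" and g: "g \<in> trig_poly"
  shows "(\<lambda>n. LINT \<omega>|P. g (U n \<omega>)) \<longlonglongrightarrow> (LINT \<omega>|N. g (V \<omega>))"
proof -
  interpret P: prob_space P by fact
  interpret N: prob_space N by fact
  note [measurable] = U V borel_measurable_seqI[of "U _", OF U] borel_measurable_seqI[OF V]
  have meas: "g \<in> borel_measurable borel" if "g \<in> trig_poly" for g :: "(nat \<Rightarrow> real) \<Rightarrow> real"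
    using trig_poly_continuous_bounded(1)[OF that] by (rule borel_measurable_continuous_onI)
  have int: "integrable P (\<lambda>\<omega>. g (U n \<omega>))" "integrable N (\<lambda>\<omega>. g (V \<omega>))"
    if "g \<in> trig_poly" for g n
  proof -
    note [measurable] = meas[OF that]
    from trig_poly_continuous_bounded(2)[OF that] obtain B where "\<forall>u. \<bar>g u\<bar> \<le> B" by blast
    then show "integrable P (\<lambda>\<omega>. g (U n \<omega>))" "integrable N (\<lambda>\<omega>. g (V \<omega>))"
      by (auto intro!: P.integrable_const_bound[where B = B] N.integrable_const_bound[where B = B])
  qed
  show ?thesis
    using g
  proof induction
    case (base c t K \<theta>)
    have "(\<lambda>n. c * Re (cis \<theta> * char (distr P borel (\<lambda>\<omega>. \<Sum>k<K. t k * U n \<omega> k)) 1))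
        \<longlonglongrightarrow> c * Re (cis \<theta> * char (distr N borel (\<lambda>\<omega>. \<Sum>k<K. t k * V \<omega> k)) 1)"
      using conv[unfolded fdd_conv_def, rule_format, of t K]
      by (intro tendsto_intros)
    then show ?case
      using P.expectation_cos_char[of "\<lambda>\<omega>. \<Sum>k<K. t k * U n \<omega> k" \<theta> for n]
        N.expectation_cos_char[of "\<lambda>\<omega>. \<Sum>k<K. t k * V \<omega> k" \<theta>] by simp
  next
    case (add f g)
    then show ?case by (simp add: int tendsto_add)
  qed
qed

lemma fdd_conv_continuous_sin:
  fixes h :: "(nat \<Rightarrow> real) \<Rightarrow> real"
  assumes "prob_space P" "prob_space N"
    and U: "\<And>n k. (\<lambda>\<omega>. U n \<omega> k) \<in> borel_measurable P" and V: "\<And>k. (\<lambda>\<omega>. V \<omega> k) \<in> borel_measurable N"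
    and conv: "fdd_conv P U N V" and h: "continuous_on (box_seq (\<lambda>_. 1)) h"
  shows "(\<lambda>\<omega>. h (\<lambda>k. sin (U n \<omega> k))) \<in> borel_measurable P"
    and "(\<lambda>\<omega>. h (\<lambda>k. sin (V \<omega> k))) \<in> borel_measurable N"
    and "(\<lambda>n. LINT \<omega>|P. h (\<lambda>k. sin (U n \<omega> k))) \<longlonglongrightarrow> (LINT \<omega>|N. h (\<lambda>k. sin (V \<omega> k)))"
proof -
  interpret P: prob_space P by fact
  interpret N: prob_space N by fact
  note [measurable] = U V borel_measurable_seqI[of "U _", OF U] borel_measurable_seqI[OF V]
  have "continuous_on UNIV (\<lambda>u. h (\<lambda>k. sin (u k)))"
    by (rule continuous_on_compose2[OF h])
       (auto simp: box_seq_def intro!: continuous_intros continuous_on_coordinatewise_then_product)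
  then have [measurable]: "(\<lambda>u. h (\<lambda>k. sin (u k))) \<in> borel_measurable borel"
    by (rule borel_measurable_continuous_onI)
  show m1: "(\<lambda>\<omega>. h (\<lambda>k. sin (U n \<omega> k))) \<in> borel_measurable P" for n
    using measurable_compose[of "U n" P borel "\<lambda>u. h (\<lambda>k. sin (u k))"] by simp
  show m2: "(\<lambda>\<omega>. h (\<lambda>k. sin (V \<omega> k))) \<in> borel_measurable N"
    using measurable_compose[of V N borel "\<lambda>u. h (\<lambda>k. sin (u k))"] by simp
  show "(\<lambda>n. LINT \<omega>|P. h (\<lambda>k. sin (U n \<omega> k))) \<longlonglongrightarrow> (LINT \<omega>|N. h (\<lambda>k. sin (V \<omega> k)))"
  proof (rule LIMSEQ_I)
    fix e :: real assume "e > 0"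
    then obtain g where g: "g \<in> trig_poly" "\<And>u. \<bar>h (\<lambda>k. sin (u k)) - g u\<bar> < e / 4"
      using trig_poly_dense[OF h, of "e / 4"] by (metis divide_pos_pos zero_less_numeral)
    obtain B where B: "\<And>u. \<bar>g u\<bar> \<le> B" using trig_poly_continuous_bounded(2)[OF g(1)] by blast
    have [measurable]: "g \<in> borel_measurable borel"
      using trig_poly_continuous_bounded(1)[OF g(1)] by (rule borel_measurable_continuous_onI)
    have hB: "\<bar>h (\<lambda>k. sin (u k))\<bar> \<le> B + e / 4" for u using g(2)[of u] B[of u] by linarith
    have close: "\<bar>(LINT \<omega>|Q. h (\<lambda>k. sin (W \<omega> k))) - (LINT \<omega>|Q. g (W \<omega>))\<bar> \<le> e / 4"
      if "prob_space Q" and [measurable]: "W \<in> measurable Q borel" "(\<lambda>\<omega>. h (\<lambda>k. sin (W \<omega> k))) \<in> borel_measurable Q"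
      for Q :: "'z measure" and W
    proof -
      interpret Q: prob_space Q by fact
      have i: "integrable Q (\<lambda>\<omega>. h (\<lambda>k. sin (W \<omega> k)))" "integrable Q (\<lambda>\<omega>. g (W \<omega>))"
        by (intro Q.integrable_const_bound[where B = "B + e / 4"]; use hB in simp)
           (intro Q.integrable_const_bound[where B = B]; use B in simp)
      have "\<bar>(LINT \<omega>|Q. h (\<lambda>k. sin (W \<omega> k))) - (LINT \<omega>|Q. g (W \<omega>))\<bar> =
          \<bar>LINT \<omega>|Q. h (\<lambda>k. sin (W \<omega> k)) - g (W \<omega>)\<bar>" using i by simp
      also have "\<dots> \<le> (LINT \<omega>|Q. \<bar>h (\<lambda>k. sin (W \<omega> k)) - g (W \<omega>)\<bar>)" by (rule integral_abs_bound)
      also have "\<dots> \<le> (LINT \<omega>|Q. e / 4)"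
        using i g(2) by (intro integral_mono) (auto intro: less_imp_le)
      finally show ?thesis by (simp add: Q.prob_space)
    qed
    from LIMSEQ_D[OF fdd_conv_trig_poly[OF assms(1-5) g(1)], of "e / 4"] \<open>e > 0\<close>
    obtain n0 where n0: "\<And>n. n \<ge> n0 \<Longrightarrow> \<bar>(LINT \<omega>|P. g (U n \<omega>)) - (LINT \<omega>|N. g (V \<omega>))\<bar> < e / 4"
      by auto
    have "\<bar>(LINT \<omega>|P. h (\<lambda>k. sin (U n \<omega> k))) - (LINT \<omega>|N. h (\<lambda>k. sin (V \<omega> k)))\<bar> < e" if "n \<ge> n0" for n
      using n0[OF that] close[OF assms(1) borel_measurable_seqI[of "U n", OF U] m1]
        close[OF assms(2) borel_measurable_seqI[of V, OF V] m2] \<open>e > 0\<close> by linarith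
    then show "\<exists>no. \<forall>n\<ge>no. norm ((LINT \<omega>|P. h (\<lambda>k. sin (U n \<omega> k))) - (LINT \<omega>|N. h (\<lambda>k. sin (V \<omega> k)))) < e"
      by auto
  qed
qed

section \<open>Directional derivatives of suprema\<close>

lemma abs_le_square: "\<bar>u\<bar> \<le> 1 + u\<^sup>2" for u :: real
  using zero_le_power2[of "\<bar>u\<bar> - 1/2"] by (simp add: power2_diff) (simp add: power2_eq_square)

lemma abs_sin_diff_le: "\<bar>x - sin x\<bar> \<le> x\<^sup>2" for x :: real
proof -
  have *: "\<bar>x - sin x\<bar> \<le> x\<^sup>2" if "0 \<le> x" for x :: real
  proof -
    have "cmod (iexp x - (\<Sum>k\<le>1. (\<i> * x) ^ k / fact k)) \<le> \<bar>x\<bar> ^ Suc 1 / fact (Suc 1)"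
      by (rule iexp_approx1)
    then have "cmod (iexp x - (1 + \<i> * x)) \<le> x\<^sup>2 / 2" by (simp add: power2_eq_square)
    moreover have "\<bar>Im (iexp x - (1 + \<i> * x))\<bar> \<le> cmod (iexp x - (1 + \<i> * x))" by (rule abs_Im_le_cmod)
    moreover have "Im (iexp x - (1 + \<i> * x)) = sin x - x" by (simp add: Im_exp)
    ultimately show ?thesis using zero_le_power2[of x] by linarith
  qed
  show ?thesis
    using *[of x] *[of "- x"] by (cases "0 \<le> x") (auto simp: abs_minus_commute)
qed

text \<open>A truncation to \<open>[-\<rho>, \<rho>]\<close> by means of the sine, so that continuous functions of truncated
sequences are within the reach of trigonometric polynomials.\<close>

definition clip :: "real \<Rightarrow> (nat \<Rightarrow> real) \<Rightarrow> nat \<Rightarrow> real" where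
  "clip \<rho> u k = \<rho> * sin (u k / \<rho>)"

lemma clip_in_box: "\<rho> > 0 \<Longrightarrow> clip \<rho> u \<in> box_seq (\<lambda>_. \<rho>)"
  by (auto simp: clip_def box_seq_def abs_mult mult_le_cancel_left1)

lemma clip_diff: assumes "\<rho> > 0" shows "\<bar>u k - clip \<rho> u k\<bar> \<le> (u k)\<^sup>2 / \<rho>"
proof -
  have "\<bar>u k - clip \<rho> u k\<bar> = \<rho> * \<bar>u k / \<rho> - sin (u k / \<rho>)\<bar>"
  proof -
    have "u k - clip \<rho> u k = \<rho> * (u k / \<rho> - sin (u k / \<rho>))"
      using assms by (simp add: clip_def right_diff_distrib)
    then show ?thesis using assms by (simp add: abs_mult)
  qed
  also have "\<dots> \<le> \<rho> * (u k / \<rho>)\<^sup>2" using assms by (intro mult_left_mono abs_sin_diff_le) auto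
  also have "\<dots> = (u k)\<^sup>2 / \<rho>" using assms by (simp add: power2_eq_square)
  finally show ?thesis .
qed

text \<open>Tonelli's theorem for the weighted sum of squares. Summability of the absolute values follows since
\<open>\<bar>u\<bar> \<le> 1 + u\<^sup>2\<close> and the weights are summable.\<close>

lemma weighted_squares:
  fixes U :: "'w \<Rightarrow> nat \<Rightarrow> real"
  assumes "prob_space P" and [measurable]: "\<And>k. (\<lambda>\<omega>. U \<omega> k) \<in> borel_measurable P"
    and \<beta>: "\<And>k. 0 \<le> \<beta> k" "summable \<beta>"
    and sq: "\<And>k. integrable P (\<lambda>\<omega>. (U \<omega> k)\<^sup>2)" "\<And>k. (LINT \<omega>|P. (U \<omega> k)\<^sup>2) \<le> C"
  shows "AE \<omega> in P. summable (\<lambda>k. \<beta> k * (U \<omega> k)\<^sup>2)"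
    and "AE \<omega> in P. summable (\<lambda>k. \<beta> k * \<bar>U \<omega> k\<bar>)"
    and "integrable P (\<lambda>\<omega>. (\<Sum>k. \<beta> k * (U \<omega> k)\<^sup>2))"
    and "(LINT \<omega>|P. (\<Sum>k. \<beta> k * (U \<omega> k)\<^sup>2)) \<le> C * (\<Sum>k. \<beta> k)"
proof -
  interpret P: prob_space P by fact
  have i: "integrable P (\<lambda>\<omega>. \<beta> k * (U \<omega> k)\<^sup>2)" for k using sq by simp
  have s: "summable (\<lambda>k. \<beta> k * C)" using \<beta> by (intro summable_mult2)
  have s2: "summable (\<lambda>k. LINT \<omega>|P. \<beta> k * (U \<omega> k)\<^sup>2)"
    by (rule summable_comparison_test[OF _ s])
       (use \<beta> sq in \<open>auto simp: abs_mult intro!: mult_left_mono\<close>)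
  have "(\<integral>\<^sup>+\<omega>. (\<Sum>k. ennreal (\<beta> k * (U \<omega> k)\<^sup>2)) \<partial>P) = (\<Sum>k. \<integral>\<^sup>+\<omega>. ennreal (\<beta> k * (U \<omega> k)\<^sup>2) \<partial>P)"
    by (rule nn_integral_suminf) measurable
  also have "\<dots> = (\<Sum>k. ennreal (LINT \<omega>|P. \<beta> k * (U \<omega> k)\<^sup>2))"
    using \<beta> by (subst nn_integral_eq_integral[OF i]) auto
  also have "\<dots> = ennreal (\<Sum>k. LINT \<omega>|P. \<beta> k * (U \<omega> k)\<^sup>2)"
    using \<beta> s2 by (intro suminf_ennreal2) auto
  finally have "(\<integral>\<^sup>+\<omega>. (\<Sum>k. ennreal (\<beta> k * (U \<omega> k)\<^sup>2)) \<partial>P) \<noteq> \<infinity>" by simp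
  then have "AE \<omega> in P. (\<Sum>k. ennreal (\<beta> k * (U \<omega> k)\<^sup>2)) \<noteq> \<infinity>"
    by (intro nn_integral_noteq_infinite) measurable
  then show AE: "AE \<omega> in P. summable (\<lambda>k. \<beta> k * (U \<omega> k)\<^sup>2)"
    by eventually_elim (use \<beta> in \<open>auto intro!: summable_suminf_not_top\<close>)
  then show "AE \<omega> in P. summable (\<lambda>k. \<beta> k * \<bar>U \<omega> k\<bar>)"
  proof eventually_elim
    case (elim \<omega>)
    have "\<beta> k * \<bar>U \<omega> k\<bar> \<le> \<beta> k + \<beta> k * (U \<omega> k)\<^sup>2" for k
      using mult_left_mono[OF abs_le_square[of "U \<omega> k"] \<beta>(1)[of k]] by (simp add: distrib_left)
    then show ?case
      using \<beta> by (intro summable_comparison_test[OF _ summable_add[OF \<beta>(2) elim]]) (auto simp: abs_mult)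
  qed
  have abs: "norm (\<beta> k * (U \<omega> k)\<^sup>2) = \<beta> k * (U \<omega> k)\<^sup>2" for k \<omega> using \<beta> by simp
  show "integrable P (\<lambda>\<omega>. (\<Sum>k. \<beta> k * (U \<omega> k)\<^sup>2))"
    by (rule integrable_suminf[OF i]) (use AE s2 in \<open>simp_all only: abs\<close>)
  have "(LINT \<omega>|P. (\<Sum>k. \<beta> k * (U \<omega> k)\<^sup>2)) = (\<Sum>k. LINT \<omega>|P. \<beta> k * (U \<omega> k)\<^sup>2)"
    by (rule integral_suminf[OF i]) (use AE s2 in \<open>simp_all only: abs\<close>)
  also have "\<dots> \<le> (\<Sum>k. \<beta> k * C)"
    using \<beta> sq by (intro suminf_le s s2) (auto intro!: mult_left_mono)
  also have "\<dots> = C * (\<Sum>k. \<beta> k)" using suminf_mult2[OF \<beta>(2), of C] by (simp add: mult.commute)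
  finally show "(LINT \<omega>|P. (\<Sum>k. \<beta> k * (U \<omega> k)\<^sup>2)) \<le> C * (\<Sum>k. \<beta> k)" .
qed

lemma cts_step_lipschitz:
  assumes "x < y" shows "\<bar>cts_step x y s - cts_step x y t\<bar> \<le> \<bar>s - t\<bar> / (y - x)"
  using assms by (auto simp: cts_step_def divide_simps abs_if)

lemma cts_step_bound: "x < y \<Longrightarrow> \<bar>cts_step x y s\<bar> \<le> 1"
  by (auto simp: cts_step_def divide_simps)

lemma maximizers_nonempty:
  fixes a :: "(nat \<Rightarrow> real) \<Rightarrow> real"
  assumes A: "A \<subseteq> box_seq \<beta>" "A \<noteq> {}" and a: "continuous_on (box_seq \<beta>) a"
  shows "closure A \<subseteq> box_seq \<beta>" "bdd_above (a ` closure A)" "\<And>b. b \<in> closure A \<Longrightarrow> a b \<le> (SUP b\<in>A. a b)"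
    "\<exists>b\<in>closure A. a b = (SUP b\<in>A. a b)" "compact (closure A)"
proof -
  show cl: "closure A \<subseteq> box_seq \<beta>" using A closed_box_seq closure_minimal by blast
  show comp: "compact (closure A)"
    using compact_Int_closed[OF compact_box_seq closed_closure, of \<beta> A] cl by (simp add: Int_absorb1)
  have ca: "continuous_on (closure A) a" using continuous_on_subset[OF a cl] .
  then have "compact (a ` closure A)" using comp compact_continuous_image by blast
  then show bdd: "bdd_above (a ` closure A)" by (rule bounded_imp_bdd_above[OF compact_imp_bounded])
  have bddA: "bdd_above (a ` A)" using bdd bdd_above_mono closure_subset image_mono by metis
  have sub: "a ` closure A \<subseteq> {..(SUP b\<in>A. a b)}"
    using image_closure_subset[OF ca closed_atMost[of "SUP b\<in>A. a b"]] cSUP_upper[OF _ bddA] by auto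
  then show le: "\<And>b. b \<in> closure A \<Longrightarrow> a b \<le> (SUP b\<in>A. a b)" by auto
  obtain b where b: "b \<in> closure A" "\<And>c. c \<in> closure A \<Longrightarrow> a c \<le> a b"
    using continuous_attains_sup[OF comp _ ca] A by auto
  then have "(SUP b\<in>A. a b) \<le> a b" using A closure_subset by (intro cSUP_least) blast+
  then show "\<exists>b\<in>closure A. a b = (SUP b\<in>A. a b)" using b le by fastforce
qed

text \<open>Danskin's formula, with step size \<open>1 / sqrt n\<close> and uniform in directions from a cube. The supremum
over \<open>A\<close> always dominates the supremum over the maximisers \<open>M\<close>. If it exceeded it by \<open>e\<close> for
arbitrarily large \<open>n\<close>, witnesses \<open>b\<close> and directions \<open>u\<close> would accumulate by compactness. The pairings
are bounded, so \<open>sqrt n * (m - a b)\<close> is bounded and the limit of the witnesses is a maximiser; but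
then the pairings converge to a value that the supremum over \<open>M\<close> dominates.\<close>

lemma directional_derivative_uniform:
  fixes a :: "(nat \<Rightarrow> real) \<Rightarrow> real"
  assumes A: "A \<subseteq> box_seq \<beta>" "A \<noteq> {}" and a: "continuous_on (box_seq \<beta>) a"
    and \<beta>: "\<And>k. 0 \<le> \<beta> k" "summable \<beta>"
    and m: "m = (SUP b\<in>A. a b)" and M: "M = {b \<in> closure A. a b = m}" and e: "e > 0"
  shows "\<exists>n0. \<forall>n\<ge>n0. \<forall>u\<in>box_seq (\<lambda>_. \<rho>).
     \<bar>(SUP b\<in>A. sqrt (real n) * (a b - m) + ip b u) - (SUP b\<in>M. ip b u)\<bar> \<le> e"
proof (rule ccontr)
  let ?B = "box_seq (\<lambda>_::nat. \<rho>)"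
  define \<Psi> where "\<Psi> u = (SUP b\<in>M. ip b u)" for u
  define \<Psi>n where "\<Psi>n n u = (SUP b\<in>A. sqrt (real n) * (a b - m) + ip b u)" for n u
  note mx = maximizers_nonempty[OF A a, folded m]
  have Msub: "M \<subseteq> box_seq \<beta>" "M \<noteq> {}" using mx(1,4) M by auto
  have bound: "\<bar>ip b u\<bar> \<le> (\<Sum>k. \<beta> k) * \<rho>" if "b \<in> box_seq \<beta>" "u \<in> ?B" for b u
  proof -
    have s: "summable (\<lambda>k. \<beta> k * \<bar>u k\<bar>)" using summable_box[OF \<beta>(2) that(2) \<beta>(1)] .
    have "(\<Sum>k. \<beta> k * \<bar>u k\<bar>) \<le> (\<Sum>k. \<beta> k * \<rho>)"
      using box_seqD[OF that(2)] \<beta> by (intro suminf_le s summable_mult2 mult_left_mono) auto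
    then show ?thesis using summable_ip(2)[OF that(1) s] suminf_mult2[OF \<beta>(2), of \<rho>] by linarith
  qed
  have bddM: "bdd_above ((\<lambda>b. ip b u) ` M)" if "u \<in> ?B" for u
    by (rule bdd_above_ip[OF Msub(1) summable_box[OF \<beta>(2) that \<beta>(1)]])
  have le_m: "a b \<le> m" if "b \<in> A" for b using mx(3) that closure_subset by blast
  have bddA: "bdd_above ((\<lambda>b. sqrt (real n) * (a b - m) + ip b u) ` A)" if "u \<in> ?B" for u n
  proof (rule bdd_aboveI2)
    fix b assume b: "b \<in> A"
    have "sqrt (real n) * (a b - m) \<le> 0" using le_m[OF b] by (simp add: mult_nonneg_nonpos)
    then show "sqrt (real n) * (a b - m) + ip b u \<le> (\<Sum>k. \<beta> k) * \<rho>"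
      using bound[of b u] b A that by auto
  qed
  have lower: "\<Psi> u \<le> \<Psi>n n u" if u: "u \<in> ?B" for u n
    unfolding \<Psi>_def
  proof (rule cSUP_least[OF Msub(2)])
    fix b assume b: "b \<in> M"
    let ?f = "\<lambda>c. sqrt (real n) * (a c - m) + ip c u"
    have "continuous_on (closure A) ?f"
    proof (intro continuous_intros)
      show "continuous_on (closure A) a" using continuous_on_subset[OF a mx(1)] .
      show "continuous_on (closure A) (\<lambda>c. ip c u)"
        by (rule continuous_on_subset[OF continuous_on_ip_left[OF summable_box[OF \<beta>(2) u \<beta>(1)]] mx(1)])
    qed
    then have "?f ` closure A \<subseteq> {..\<Psi>n n u}"
      by (intro image_closure_subset) (auto simp: \<Psi>n_def intro!: cSUP_upper bddA[OF u])
    moreover have "b \<in> closure A" "a b = m" using b M by auto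
    ultimately show "ip b u \<le> \<Psi>n n u" by force
  qed
  assume "\<not> ?thesis"
  then have "\<exists>n\<ge>N. \<exists>u\<in>?B. \<bar>\<Psi>n n u - \<Psi> u\<bar> > e" for N
    unfolding \<Psi>_def[symmetric] \<Psi>n_def[symmetric] by (meson not_le)
  then have "\<exists>n u. n \<ge> N \<and> u \<in> ?B \<and> \<Psi>n n u > \<Psi> u + e" for N
    using lower by (smt (verit))
  then have "\<exists>n u b. n \<ge> N \<and> u \<in> ?B \<and> b \<in> A \<and> sqrt (real n) * (a b - m) + ip b u > \<Psi> u + e" for N
    unfolding \<Psi>n_def using less_cSUP_iff[OF A(2) bddA] by meson
  then obtain n u b where n: "\<And>N. n N \<ge> N" and u: "\<And>N. u N \<in> ?B" and bA: "\<And>N. b N \<in> A"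
    and big: "\<And>N. sqrt (real (n N)) * (a (b N) - m) + ip (b N) (u N) > \<Psi> (u N) + e"
    by metis
  have "compact (closure A \<times> ?B)" by (intro compact_Times mx(5) compact_box_seq)
  then have "seq_compact (closure A \<times> ?B)" by (simp add: compact_eq_seq_compact_metric)
  then obtain l r where l: "l \<in> closure A \<times> ?B" and r: "strict_mono r"
    and lim: "((\<lambda>N. (b N, u N)) \<circ> r) \<longlonglongrightarrow> l"
    using u bA closure_subset unfolding seq_compact_def by (smt (verit) SigmaI subsetD)
  define b' u' where "b' = fst l" and "u' = snd l"
  have b': "b' \<in> closure A" and u': "u' \<in> ?B" using l by (auto simp: b'_def u'_def)
  have limb: "(\<lambda>j. b (r j)) \<longlonglongrightarrow> b'" and limu: "(\<lambda>j. u (r j)) \<longlonglongrightarrow> u'"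
    using tendsto_fst[OF lim] tendsto_snd[OF lim] by (auto simp: b'_def u'_def o_def)
  have bc: "b (r j) \<in> closure A" for j using bA closure_subset by blast
  have lima: "(\<lambda>j. a (b (r j))) \<longlonglongrightarrow> a b'"
    using continuous_on_tendsto_compose[OF continuous_on_subset[OF a mx(1)] limb b'] bc by auto
  have limip: "(\<lambda>j. ip (b (r j)) (u (r j))) \<longlonglongrightarrow> ip b' u'"
  proof -
    have "(\<lambda>j. ip (fst (b (r j), u (r j))) (snd (b (r j), u (r j)))) \<longlonglongrightarrow> ip (fst l) (snd l)"
    proof (rule continuous_on_tendsto_compose[OF continuous_on_ip[OF \<beta>(2,1), of \<rho>]])
      show "(\<lambda>j. (b (r j), u (r j))) \<longlonglongrightarrow> l" using lim by (simp add: o_def)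
      show "l \<in> box_seq \<beta> \<times> ?B" using l mx(1) by auto
      show "\<forall>\<^sub>F j in sequentially. (b (r j), u (r j)) \<in> box_seq \<beta> \<times> ?B"
        using bc u mx(1) by (intro always_eventually allI) auto
    qed
    then show ?thesis by (simp add: b'_def u'_def)
  qed
  have lim\<Psi>: "(\<lambda>j. \<Psi> (u (r j))) \<longlonglongrightarrow> \<Psi> u'"
    using continuous_on_tendsto_compose[OF continuous_on_SUP_ip[OF Msub \<beta>] limu u'] u
    by (auto simp: \<Psi>_def)
  (* By the choice of b, the maximality defect times sqrt n is at most the difference of two
     bounded pairings. *)
  have a_ge: "m - a (b (r j)) \<le> (2 * ((\<Sum>k. \<beta> k) * \<rho>)) * inverse (sqrt (real j))" if "j > 0" for j
  proof -
    let ?n = "n (r j)"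
    have nj: "?n \<ge> j" using n[of "r j"] seq_suble[OF r, of j] by linarith
    have "\<Psi> (u (r j)) \<ge> - ((\<Sum>k. \<beta> k) * \<rho>)"
    proof -
      obtain c where c: "c \<in> M" using Msub(2) by auto
      have "ip c (u (r j)) \<le> \<Psi> (u (r j))" unfolding \<Psi>_def by (rule cSUP_upper[OF c bddM[OF u]])
      then show ?thesis using bound[of c "u (r j)"] c Msub(1) u by fastforce
    qed
    moreover have "ip (b (r j)) (u (r j)) \<le> (\<Sum>k. \<beta> k) * \<rho>"
      using bound[of "b (r j)" "u (r j)"] bA A u by fastforce
    ultimately have "sqrt (real ?n) * (m - a (b (r j))) \<le> 2 * ((\<Sum>k. \<beta> k) * \<rho>)"
      using big[of "r j"] e by (simp add: algebra_simps)
    moreover have "sqrt (real j) * (m - a (b (r j))) \<le> sqrt (real ?n) * (m - a (b (r j)))"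
      using nj le_m[OF bA] by (intro mult_right_mono) auto
    ultimately show ?thesis using that by (simp add: field_simps)
  qed
  have "m - a b' \<le> 0"
  proof (rule LIMSEQ_le[OF tendsto_diff[OF tendsto_const lima]])
    show "(\<lambda>j. (2 * ((\<Sum>k. \<beta> k) * \<rho>)) * inverse (sqrt (real j))) \<longlonglongrightarrow> 0"
      by (intro tendsto_mult_right_zero tendsto_inverse_0_at_top
          filterlim_compose[OF sqrt_at_top filterlim_real_sequentially])
    show "\<exists>N. \<forall>j\<ge>N. m - a (b (r j)) \<le> (2 * ((\<Sum>k. \<beta> k) * \<rho>)) * inverse (sqrt (real j))"
      using a_ge by (intro exI[of _ 1]) auto
  qed
  then have "b' \<in> M" using mx(3)[OF b'] b' M by auto
  then have "ip b' u' \<le> \<Psi> u'" unfolding \<Psi>_def by (intro cSUP_upper bddM[OF u'])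
  moreover have "\<Psi> u' + e \<le> ip b' u'"
  proof (rule LIMSEQ_le[OF tendsto_add[OF lim\<Psi> tendsto_const] limip], intro exI allI impI)
    fix j :: nat
    have "sqrt (real (n (r j))) * (a (b (r j)) - m) \<le> 0"
      using le_m[OF bA] by (simp add: mult_nonneg_nonpos)
    then show "\<Psi> (u (r j)) + e \<le> ip (b (r j)) (u (r j))" using big[of "r j"] by linarith
  qed
  ultimately show False using e by simp
qed

text \<open>With the coordinates truncated at \<open>\<rho>\<close>, Danskin's formula replaces the supremum over \<open>A\<close> by the
continuous functional \<open>SUP b\<in>M. ip b u\<close>, whose expectations converge by convergence of the marginals.
By the second moments, truncation changes both suprema by at most \<open>C * (\<Sum>k. \<beta> k) / \<rho>\<close> in mean,
uniformly in \<open>n\<close>. The test functions are piecewise linear steps, so that these errors pass through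
their Lipschitz constant.\<close>

theorem sup_functional_limit:
  fixes U :: "nat \<Rightarrow> 'w \<Rightarrow> nat \<Rightarrow> real" and V :: "'v \<Rightarrow> nat \<Rightarrow> real" and a :: "(nat \<Rightarrow> real) \<Rightarrow> real"
  assumes P: "prob_space P" and N: "prob_space N"
    and U: "\<And>n k. (\<lambda>\<omega>. U n \<omega> k) \<in> borel_measurable P" and V: "\<And>k. (\<lambda>\<omega>. V \<omega> k) \<in> borel_measurable N"
    and U2: "\<And>n k. integrable P (\<lambda>\<omega>. (U n \<omega> k)\<^sup>2)" "\<And>n k. (LINT \<omega>|P. (U n \<omega> k)\<^sup>2) \<le> C"
    and V2: "\<And>k. integrable N (\<lambda>\<omega>. (V \<omega> k)\<^sup>2)" "\<And>k. (LINT \<omega>|N. (V \<omega> k)\<^sup>2) \<le> C"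
    and conv: "fdd_conv P U N V"
    and \<beta>: "\<And>k. 0 \<le> \<beta> k" "summable \<beta>"
    and A: "A \<subseteq> box_seq \<beta>" "A \<noteq> {}" and a: "continuous_on (box_seq \<beta>) a"
    and m: "m = (SUP b\<in>A. a b)" and M: "M = {b \<in> closure A. a b = m}"
    and Z: "\<And>n. Z n \<in> borel_measurable P"
      "\<And>n. n \<ge> 1 \<Longrightarrow> AE \<omega> in P. Z n \<omega> = (SUP b\<in>A. sqrt (real n) * (a b - m) + ip b (U n \<omega>))"
    and Z': "Z' \<in> borel_measurable N" "AE \<omega> in N. Z' \<omega> = (SUP b\<in>M. ip b (V \<omega>))"
  shows "conv_in_distr P Z N Z'"
proof -
  interpret P: prob_space P by fact
  interpret N: prob_space N by fact
  note [measurable] = U V Z Z'(1)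
  define \<Psi> where "\<Psi> u = (SUP b\<in>M. ip b u)" for u
  define \<Psi>n where "\<Psi>n n u = (SUP b\<in>A. sqrt (real n) * (a b - m) + ip b u)" for n u
  note mx = maximizers_nonempty[OF A a, folded m]
  have Msub: "M \<subseteq> box_seq \<beta>" "M \<noteq> {}" using mx(1,4) M by auto
  have le_m: "a b \<le> m" if "b \<in> A" for b using mx(3) that closure_subset by blast
  have bddA: "bdd_above ((\<lambda>b. sqrt (real n) * (a b - m) + ip b u) ` A)"
    if s: "summable (\<lambda>k. \<beta> k * \<bar>u k\<bar>)" for u n
  proof (rule bdd_aboveI2)
    fix b assume b: "b \<in> A"
    have "sqrt (real n) * (a b - m) \<le> 0" using le_m[OF b] by (simp add: mult_nonneg_nonpos)
    then show "sqrt (real n) * (a b - m) + ip b u \<le> (\<Sum>k. \<beta> k * \<bar>u k\<bar>)"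
      using summable_ip(2)[OF _ s, of b] b A by auto
  qed
  have clip_sum: "(\<Sum>k. \<beta> k * \<bar>u k - clip \<rho> u k\<bar>) \<le> (\<Sum>k. \<beta> k * (u k)\<^sup>2) / \<rho>"
    if "\<rho> > 0" and s: "summable (\<lambda>k. \<beta> k * \<bar>u k\<bar>)" "summable (\<lambda>k. \<beta> k * (u k)\<^sup>2)" for \<rho> u
  proof -
    have "summable (\<lambda>k. \<beta> k * \<bar>clip \<rho> u k\<bar>)"
      by (rule summable_box[OF \<beta>(2) clip_in_box[OF \<open>\<rho> > 0\<close>] \<beta>(1)])
    note d = summable_weighted_diff[OF \<beta>(1) s(1) this]
    have "(\<Sum>k. \<beta> k * \<bar>u k - clip \<rho> u k\<bar>) \<le> (\<Sum>k. (\<beta> k * (u k)\<^sup>2) / \<rho>)"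
    proof (rule suminf_le[OF _ d summable_divide[OF s(2)]])
      show "\<beta> k * \<bar>u k - clip \<rho> u k\<bar> \<le> \<beta> k * (u k)\<^sup>2 / \<rho>" for k
        using mult_left_mono[OF clip_diff[OF \<open>\<rho> > 0\<close>, of u k] \<beta>(1)[of k]] by simp
    qed
    then show ?thesis using suminf_divide[OF s(2), of \<rho>] by simp
  qed
  have dn: "\<bar>\<Psi>n n u - \<Psi>n n (clip \<rho> u)\<bar> \<le> (\<Sum>k. \<beta> k * (u k)\<^sup>2) / \<rho>"
    and d: "\<bar>\<Psi> u - \<Psi> (clip \<rho> u)\<bar> \<le> (\<Sum>k. \<beta> k * (u k)\<^sup>2) / \<rho>"
    if \<rho>: "\<rho> > 0" and s: "summable (\<lambda>k. \<beta> k * \<bar>u k\<bar>)" "summable (\<lambda>k. \<beta> k * (u k)\<^sup>2)" for n \<rho> u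
  proof -
    have s': "summable (\<lambda>k. \<beta> k * \<bar>clip \<rho> u k\<bar>)"
      by (rule summable_box[OF \<beta>(2) clip_in_box[OF \<rho>] \<beta>(1)])
    have "\<bar>\<Psi>n n u - \<Psi>n n (clip \<rho> u)\<bar> \<le> (\<Sum>k. \<beta> k * \<bar>u k - clip \<rho> u k\<bar>)"
      unfolding \<Psi>n_def
    proof (rule SUP_diff_le[OF A(2) bddA[OF s(1)] bddA[OF s']])
      fix b assume "b \<in> A"
      then have "\<bar>ip b u - ip b (clip \<rho> u)\<bar> \<le> (\<Sum>k. \<beta> k * \<bar>u k - clip \<rho> u k\<bar>)"
        using A by (intro ip_diff_right[OF _ \<beta>(1) s(1) s']) auto
      then show "\<bar>sqrt (real n) * (a b - m) + ip b u - (sqrt (real n) * (a b - m) + ip b (clip \<rho> u))\<bar>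
          \<le> (\<Sum>k. \<beta> k * \<bar>u k - clip \<rho> u k\<bar>)" by simp
    qed
    then show "\<bar>\<Psi>n n u - \<Psi>n n (clip \<rho> u)\<bar> \<le> (\<Sum>k. \<beta> k * (u k)\<^sup>2) / \<rho>"
      using clip_sum[OF \<rho> s] by linarith
    show "\<bar>\<Psi> u - \<Psi> (clip \<rho> u)\<bar> \<le> (\<Sum>k. \<beta> k * (u k)\<^sup>2) / \<rho>"
      using SUP_ip_diff[OF Msub \<beta>(1) s(1) s'] clip_sum[OF \<rho> s] unfolding \<Psi>_def by linarith
  qed
  have rd: "real_distribution (distr P borel (Z n))" "real_distribution (distr N borel Z')" for n
    by (auto intro!: P.real_distribution_distr N.real_distribution_distr)
  have "weak_conv_m (\<lambda>n. distr P borel (Z n)) (distr N borel Z')"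
  proof (rule integral_cts_step_conv_imp_weak_conv[OF rd])
    fix x y :: real assume xy: "x < y"
    define g where "g = cts_step x y"
    define L where "L = 1 / (y - x)"
    have L: "L > 0" using xy by (simp add: L_def)
    have lip: "\<bar>g s - g t\<bar> \<le> L * \<bar>s - t\<bar>" for s t
      using cts_step_lipschitz[OF xy, of s t] by (simp add: g_def L_def)
    have g1: "\<bar>g s\<bar> \<le> 1" for s using cts_step_bound[OF xy] by (simp add: g_def)
    have gc: "continuous_on UNIV g"
      unfolding g_def by (rule uniformly_continuous_imp_continuous[OF cts_step_uniformly_continuous[OF xy]])
    have [measurable]: "g \<in> borel_measurable borel" by (rule borel_measurable_continuous_onI[OF gc])
    have compare: "\<bar>(LINT \<omega>|Q. g (Y \<omega>)) - (LINT \<omega>|Q. g (\<Psi> (clip \<rho> (W \<omega>))))\<bar>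
        \<le> L * (C * (\<Sum>k. \<beta> k) / \<rho> + \<delta>)"
      if Q: "prob_space Q" and [measurable]: "Y \<in> borel_measurable Q" "\<And>k. (\<lambda>\<omega>. W \<omega> k) \<in> borel_measurable Q"
        "(\<lambda>\<omega>. g (\<Psi> (clip \<rho> (W \<omega>)))) \<in> borel_measurable Q"
        and W2: "\<And>k. integrable Q (\<lambda>\<omega>. (W \<omega> k)\<^sup>2)" "\<And>k. (LINT \<omega>|Q. (W \<omega> k)\<^sup>2) \<le> C"
        and \<rho>: "\<rho> > 0"
        and close: "AE \<omega> in Q. summable (\<lambda>k. \<beta> k * \<bar>W \<omega> k\<bar>) \<longrightarrow> summable (\<lambda>k. \<beta> k * (W \<omega> k)\<^sup>2) \<longrightarrow>
          \<bar>Y \<omega> - \<Psi> (clip \<rho> (W \<omega>))\<bar> \<le> (\<Sum>k. \<beta> k * (W \<omega> k)\<^sup>2) / \<rho> + \<delta>"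
      for Q :: "'z measure" and Y W \<rho> \<delta>
    proof -
      interpret Q: prob_space Q by fact
      note ws = weighted_squares[where U = W and C = C, OF Q that(3) \<beta> W2]
      have i: "integrable Q (\<lambda>\<omega>. g (Y \<omega>))" "integrable Q (\<lambda>\<omega>. g (\<Psi> (clip \<rho> (W \<omega>))))"
        by (intro Q.integrable_const_bound[where B = 1]; use g1 in simp)+
      have i2: "integrable Q (\<lambda>\<omega>. L * ((\<Sum>k. \<beta> k * (W \<omega> k)\<^sup>2) / \<rho> + \<delta>))"
        using ws(3) by (intro integrable_mult_right Bochner_Integration.integrable_add integrable_divide) auto
      have "\<bar>(LINT \<omega>|Q. g (Y \<omega>)) - (LINT \<omega>|Q. g (\<Psi> (clip \<rho> (W \<omega>))))\<bar> =
          \<bar>LINT \<omega>|Q. g (Y \<omega>) - g (\<Psi> (clip \<rho> (W \<omega>)))\<bar>" using i by simp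
      also have "\<dots> \<le> (LINT \<omega>|Q. \<bar>g (Y \<omega>) - g (\<Psi> (clip \<rho> (W \<omega>)))\<bar>)" by (rule integral_abs_bound)
      also have "\<dots> \<le> (LINT \<omega>|Q. L * ((\<Sum>k. \<beta> k * (W \<omega> k)\<^sup>2) / \<rho> + \<delta>))"
      proof (rule integral_mono_AE[OF _ i2])
        show "AE \<omega> in Q. \<bar>g (Y \<omega>) - g (\<Psi> (clip \<rho> (W \<omega>)))\<bar> \<le> L * ((\<Sum>k. \<beta> k * (W \<omega> k)\<^sup>2) / \<rho> + \<delta>)"
          using ws(1,2) close
        proof eventually_elim
          case (elim \<omega>)
          then show ?case
            using lip[of "Y \<omega>" "\<Psi> (clip \<rho> (W \<omega>))"] L by (meson mult_left_mono order_trans less_imp_le)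
        qed
      qed (use i in simp)
      also have "\<dots> = L * ((LINT \<omega>|Q. (\<Sum>k. \<beta> k * (W \<omega> k)\<^sup>2)) / \<rho> + \<delta>)"
        using ws(3) by (simp add: Q.prob_space)
      also have "\<dots> \<le> L * (C * (\<Sum>k. \<beta> k) / \<rho> + \<delta>)"
        using L \<rho> ws(4) by (intro mult_left_mono add_right_mono divide_right_mono) auto
      finally show ?thesis .
    qed
    have "(\<lambda>n. LINT \<omega>|P. g (Z n \<omega>)) \<longlonglongrightarrow> (LINT \<omega>|N. g (Z' \<omega>))"
    proof (rule LIMSEQ_I)
      fix e :: real assume e: "e > 0"
      define \<delta> where "\<delta> = e / (8 * L)"
      have \<delta>: "\<delta> > 0" using e L by (simp add: \<delta>_def)
      have "0 \<le> (LINT \<omega>|N. (V \<omega> 0)\<^sup>2)" by (rule integral_nonneg_AE) simp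
      then have C: "0 \<le> C" using V2(2)[of 0] by linarith
      (* Large enough for the truncation error C * (\<Sum>k. \<beta> k) / \<rho> to be at most \<delta>. *)
      define \<rho> where "\<rho> = C * (\<Sum>k. \<beta> k) / \<delta> + 1"
      have \<rho>: "\<rho> > 0" using C \<delta> suminf_nonneg[OF \<beta>(2,1)] by (simp add: \<rho>_def add_nonneg_pos)
      have \<rho>\<delta>: "C * (\<Sum>k. \<beta> k) / \<rho> \<le> \<delta>"
        using \<rho> \<delta> unfolding \<rho>_def by (simp add: field_simps)
      define h where "h s = g (\<Psi> (\<lambda>k. \<rho> * s k))" for s
      have h: "continuous_on (box_seq (\<lambda>_. 1)) h"
        unfolding h_def
      proof (rule continuous_on_compose2[OF gc continuous_on_compose2[OF continuous_on_SUP_ip[OF Msub \<beta>, of \<rho>, folded \<Psi>_def]]])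
        show "continuous_on (box_seq (\<lambda>_. 1)) (\<lambda>s k. \<rho> * s k)"
          by (intro continuous_on_coordinatewise_then_product continuous_on_mult continuous_on_const continuous_on_coordinate)
        show "(\<lambda>s k. \<rho> * s k) ` box_seq (\<lambda>_. 1) \<subseteq> box_seq (\<lambda>_. \<rho>)"
          using \<rho> by (auto simp: box_seq_def abs_mult mult_left_le)
      qed simp
      have hclip: "h (\<lambda>k. sin (u k / \<rho>)) = g (\<Psi> (clip \<rho> u))" for u
        by (simp add: h_def clip_def[abs_def])
      have mU: "(\<lambda>\<omega>. U n \<omega> k / \<rho>) \<in> borel_measurable P" for n k by measurable
      have mV: "(\<lambda>\<omega>. V \<omega> k / \<rho>) \<in> borel_measurable N" for k by measurable
      note sinconv = fdd_conv_continuous_sin[OF P N mU mV fdd_conv_scale[OF conv] h, unfolded hclip]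
      obtain n1 where n1: "\<And>n. n \<ge> n1 \<Longrightarrow> \<bar>(LINT \<omega>|P. g (\<Psi> (clip \<rho> (U n \<omega>)))) - (LINT \<omega>|N. g (\<Psi> (clip \<rho> (V \<omega>))))\<bar> < e / 4"
        using LIMSEQ_D[OF sinconv(3), of "e / 4"] e by auto
      obtain n0 where n0: "\<And>n u. n \<ge> n0 \<Longrightarrow> u \<in> box_seq (\<lambda>_. \<rho>) \<Longrightarrow> \<bar>\<Psi>n n u - \<Psi> u\<bar> \<le> \<delta>"
        using directional_derivative_uniform[OF A a \<beta> m M \<delta>, of \<rho>] unfolding \<Psi>_def \<Psi>n_def by blast
      have LN: "\<bar>(LINT \<omega>|N. g (Z' \<omega>)) - (LINT \<omega>|N. g (\<Psi> (clip \<rho> (V \<omega>))))\<bar> \<le> L * (C * (\<Sum>k. \<beta> k) / \<rho> + 0)"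
      proof (rule compare[OF N Z'(1) V sinconv(2) V2 \<rho>])
        show "AE \<omega> in N. summable (\<lambda>k. \<beta> k * \<bar>V \<omega> k\<bar>) \<longrightarrow> summable (\<lambda>k. \<beta> k * (V \<omega> k)\<^sup>2) \<longrightarrow>
          \<bar>Z' \<omega> - \<Psi> (clip \<rho> (V \<omega>))\<bar> \<le> (\<Sum>k. \<beta> k * (V \<omega> k)\<^sup>2) / \<rho> + 0"
          using Z'(2) by eventually_elim (use d[OF \<rho>] in \<open>simp add: \<Psi>_def\<close>)
      qed
      have LP: "\<bar>(LINT \<omega>|P. g (Z n \<omega>)) - (LINT \<omega>|P. g (\<Psi> (clip \<rho> (U n \<omega>))))\<bar> \<le> L * (C * (\<Sum>k. \<beta> k) / \<rho> + \<delta>)"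
        if n: "n \<ge> max 1 n0" for n
      proof (rule compare[OF P Z(1) U sinconv(1) U2 \<rho>])
        have "n \<ge> 1" using n by simp
        show "AE \<omega> in P. summable (\<lambda>k. \<beta> k * \<bar>U n \<omega> k\<bar>) \<longrightarrow> summable (\<lambda>k. \<beta> k * (U n \<omega> k)\<^sup>2) \<longrightarrow>
          \<bar>Z n \<omega> - \<Psi> (clip \<rho> (U n \<omega>))\<bar> \<le> (\<Sum>k. \<beta> k * (U n \<omega> k)\<^sup>2) / \<rho> + \<delta>"
          using Z(2)[OF \<open>n \<ge> 1\<close>]
        proof eventually_elim
          case (elim \<omega>)
          have "\<bar>\<Psi>n n (clip \<rho> (U n \<omega>)) - \<Psi> (clip \<rho> (U n \<omega>))\<bar> \<le> \<delta>"
            using n by (intro n0 clip_in_box \<rho>) auto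
          moreover have "Z n \<omega> = \<Psi>n n (U n \<omega>)" using elim by (simp add: \<Psi>n_def)
          ultimately show ?case using dn[OF \<rho>, of "U n \<omega>" n] by (intro impI) linarith
        qed
      qed
      have L\<delta>: "L * \<delta> = e / 8" using L by (simp add: \<delta>_def)
      have "\<bar>(LINT \<omega>|P. g (Z n \<omega>)) - (LINT \<omega>|N. g (Z' \<omega>))\<bar> < e" if n: "n \<ge> max (max 1 n0) n1" for n
      proof -
        have "L * (C * (\<Sum>k. \<beta> k) / \<rho> + \<delta>) \<le> L * (\<delta> + \<delta>)" "L * (C * (\<Sum>k. \<beta> k) / \<rho> + 0) \<le> L * \<delta>"
          using L \<rho>\<delta> by (intro mult_left_mono; simp)+
        moreover have "L * (\<delta> + \<delta>) = L * \<delta> + L * \<delta>" by (rule distrib_left)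
        ultimately show ?thesis using LP[of n] LN n1[of n] n L\<delta> e by linarith
      qed
      then show "\<exists>no. \<forall>n\<ge>no. norm ((LINT \<omega>|P. g (Z n \<omega>)) - (LINT \<omega>|N. g (Z' \<omega>))) < e"
        unfolding real_norm_def by blast
    qed
    then show "(\<lambda>n. integral\<^sup>L (distr P borel (Z n)) (cts_step x y)) \<longlonglongrightarrow> integral\<^sup>L (distr N borel Z') (cts_step x y)"
      unfolding g_def[symmetric] by (simp add: integral_distr)
  qed
  then show ?thesis unfolding conv_in_distr_def by simp
qed

section \<open>Gaussian variables\<close>

text \<open>The centred normal law of variance \<open>v\<close>, which may be 0. In this form sums of independent variables
and limits are immediate.\<close>

definition has_gauss :: "'w measure \<Rightarrow> ('w \<Rightarrow> real) \<Rightarrow> real \<Rightarrow> bool" where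
  "has_gauss N Y v \<longleftrightarrow> Y \<in> borel_measurable N \<and> 0 \<le> v \<and>
     (\<forall>t. char (distr N borel Y) t = complex_of_real (exp (- (t\<^sup>2 * v) / 2)))"

lemma char_distr_scale:
  assumes [measurable]: "Y \<in> borel_measurable N"
  shows "char (distr N borel (\<lambda>\<omega>. c * Y \<omega>)) t = char (distr N borel Y) (c * t)"
  unfolding char_def by (subst (1 2) integral_distr) (simp_all add: mult_ac)

lemma normal_law_eq_distr:
  assumes "0 \<le> s" shows "normal_law 0 s = distr std_normal_distribution borel (\<lambda>x. s * x)"
proof -
  interpret S: prob_space std_normal_distribution using prob_space_normal_density by simp
  show ?thesis
  proof (cases "s = 0")
    case True
    have "distr std_normal_distribution borel (\<lambda>x. 0 :: real) = return borel 0"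
      by (rule S.distr_const) simp
    then show ?thesis using True by (simp add: normal_law_def)
  next
    case False
    have "distributed std_normal_distribution lborel (\<lambda>x. x) (\<lambda>x. ennreal (std_normal_density x))"
      unfolding distributed_def by (auto simp: distr_id2)
    from S.normal_density_affine[OF this, of s 0] False assms
    have "distributed std_normal_distribution lborel (\<lambda>x. s * x) (\<lambda>x. ennreal (normal_density 0 s x))"
      by simp
    then have "distr std_normal_distribution lborel (\<lambda>x. s * x) = normal_law 0 s"
      using False by (simp add: normal_law_def distributed_distr_eq_density)
    then show ?thesis by (metis distr_cong sets_lborel)
  qed
qed

lemma has_gauss_law:
  assumes "prob_space N" "has_gauss N Y v"
  shows "distr N borel Y = normal_law 0 (sqrt v)"
proof (rule Levy_uniqueness)
  interpret N: prob_space N by fact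
  interpret S: prob_space std_normal_distribution using prob_space_normal_density by simp
  have v: "0 \<le> v" and [measurable]: "Y \<in> borel_measurable N" using assms(2) by (auto simp: has_gauss_def)
  note eq = normal_law_eq_distr[OF real_sqrt_ge_zero[OF v]]
  show "real_distribution (distr N borel Y)" by (rule N.real_distribution_distr) simp
  show "real_distribution (normal_law 0 (sqrt v))" unfolding eq by (rule S.real_distribution_distr) simp
  have "char (normal_law 0 (sqrt v)) t = char std_normal_distribution (sqrt v * t)" for t
    unfolding eq by (subst char_distr_scale) (simp_all add: distr_id2)
  then show "char (distr N borel Y) = char (normal_law 0 (sqrt v))"
    using assms(2) v by (auto simp: has_gauss_def char_std_normal_distribution power_mult_distrib mult.commute)
qed

lemma has_gauss_moments:
  assumes "prob_space N" "has_gauss N Y v"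
  shows "integrable N Y" "(LINT \<omega>|N. Y \<omega>) = 0" "integrable N (\<lambda>\<omega>. (Y \<omega>)\<^sup>2)" "(LINT \<omega>|N. (Y \<omega>)\<^sup>2) = v"
proof -
  have v: "0 \<le> v" and [measurable]: "Y \<in> borel_measurable N" using assms(2) by (auto simp: has_gauss_def)
  have law: "distr N borel Y = distr std_normal_distribution borel (\<lambda>x. sqrt v * x)"
    unfolding has_gauss_law[OF assms] by (rule normal_law_eq_distr) (use v in simp)
  have i1: "integrable std_normal_distribution (\<lambda>x. x)" and i2: "integrable std_normal_distribution (\<lambda>x. x\<^sup>2)"
    using integrable_std_normal_distribution_moment[of 1] integrable_std_normal_distribution_moment[of 2] by simp_all
  have m1: "(LINT x|std_normal_distribution. x) = 0"
    using integral_std_normal_distribution_moment_odd[of 1] by simp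
  have m2: "(LINT x|std_normal_distribution. x\<^sup>2) = 1"
    using std_normal_distribution_even_moments(1)[of 1] by (simp add: fact_numeral)
  let ?S = std_normal_distribution and ?f = "\<lambda>x. sqrt v * x"
  have [measurable]: "?f \<in> borel_measurable ?S" by simp
  have transfer: "integrable N (\<lambda>\<omega>. g (Y \<omega>)) \<longleftrightarrow> integrable ?S (\<lambda>x. g (?f x))"
    "(LINT \<omega>|N. g (Y \<omega>)) = (LINT x|?S. g (?f x))" if [measurable]: "g \<in> borel_measurable borel"
    for g :: "real \<Rightarrow> real"
  proof -
    have "integrable N (\<lambda>\<omega>. g (Y \<omega>)) \<longleftrightarrow> integrable (distr N borel Y) g"
      by (rule integrable_distr_eq[symmetric]) measurable
    also have "\<dots> \<longleftrightarrow> integrable ?S (\<lambda>x. g (?f x))"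
      unfolding law by (rule integrable_distr_eq) measurable
    finally show "integrable N (\<lambda>\<omega>. g (Y \<omega>)) \<longleftrightarrow> integrable ?S (\<lambda>x. g (?f x))" .
    have "(LINT \<omega>|N. g (Y \<omega>)) = (LINT x|distr N borel Y. g x)"
      by (rule integral_distr[symmetric]) measurable
    also have "\<dots> = (LINT x|?S. g (?f x))" unfolding law by (rule integral_distr) measurable
    finally show "(LINT \<omega>|N. g (Y \<omega>)) = (LINT x|?S. g (?f x))" .
  qed
  have sq: "(sqrt v * x)\<^sup>2 = v * x\<^sup>2" for x using v by (simp add: power_mult_distrib)
  show "integrable N Y" "(LINT \<omega>|N. Y \<omega>) = 0"
    using transfer[of "\<lambda>x. x"] integrable_mult_right[OF i1, of "sqrt v"] m1 by simp_all
  show "integrable N (\<lambda>\<omega>. (Y \<omega>)\<^sup>2)" "(LINT \<omega>|N. (Y \<omega>)\<^sup>2) = v"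
    using transfer[of "\<lambda>x. x\<^sup>2"] integrable_mult_right[OF i2, of v] m2 by (simp_all only: sq) simp_all
qed

text \<open>Characteristic functions converge along almost surely convergent sequences by dominated convergence.\<close>

lemma has_gauss_limit:
  assumes "prob_space N" "\<And>n. has_gauss N (Y n) (v n)" "v \<longlonglongrightarrow> w"
    and [measurable]: "Z \<in> borel_measurable N" and lim: "AE \<omega> in N. (\<lambda>n. Y n \<omega>) \<longlonglongrightarrow> Z \<omega>"
  shows "has_gauss N Z w"
  unfolding has_gauss_def
proof (intro conjI allI)
  interpret N: prob_space N by fact
  have [measurable]: "Y n \<in> borel_measurable N" for n using assms(2)[of n] by (simp add: has_gauss_def)
  show "0 \<le> w" using assms(2,3) by (intro LIMSEQ_le_const[OF assms(3)]) (auto simp: has_gauss_def)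
  fix t
  have "(\<lambda>n. LINT \<omega>|N. iexp (t * Y n \<omega>)) \<longlonglongrightarrow> (LINT \<omega>|N. iexp (t * Z \<omega>))"
  proof (rule integral_dominated_convergence[where w = "\<lambda>_. 1"])
    show "AE \<omega> in N. (\<lambda>n. iexp (t * Y n \<omega>)) \<longlonglongrightarrow> iexp (t * Z \<omega>)"
      using lim by eventually_elim (intro tendsto_intros)
  qed (simp_all del: of_real_mult)
  then have "(\<lambda>n. char (distr N borel (Y n)) t) \<longlonglongrightarrow> char (distr N borel Z) t"
    unfolding char_def by (subst (1 2) integral_distr) simp_all
  moreover have "(\<lambda>n. char (distr N borel (Y n)) t) \<longlonglongrightarrow> complex_of_real (exp (- (t\<^sup>2 * w) / 2))"
  proof -
    have "char (distr N borel (Y n)) t = complex_of_real (exp (- (t\<^sup>2 * v n) / 2))" for n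
      using assms(2)[of n] by (simp add: has_gauss_def)
    then show ?thesis using assms(3) by (simp only:) (intro tendsto_intros; simp)
  qed
  ultimately show "char (distr N borel Z) t = complex_of_real (exp (- (t\<^sup>2 * w) / 2))"
    by (rule LIMSEQ_unique)
qed (fact assms(4))

lemma iid_gauss_sequence:
  defines "Q \<equiv> PiM (UNIV :: nat set) (\<lambda>_. std_normal_distribution)"
  shows "prob_space Q" "\<And>l. (\<lambda>\<omega>. \<omega> l) \<in> borel_measurable Q"
    "\<And>K c. has_gauss Q (\<lambda>\<omega>. \<Sum>l<K. c l * \<omega> l) (\<Sum>l<K. (c l)\<^sup>2)"
proof -
  interpret S: prob_space std_normal_distribution using prob_space_normal_density by simp
  interpret product_prob_space "\<lambda>_. std_normal_distribution" "UNIV :: nat set" ..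
  show "prob_space Q" unfolding Q_def by (rule prob_space_PiM) (rule S.prob_space_axioms)
  then interpret Q: prob_space Q .
  show [measurable]: "(\<lambda>\<omega>. \<omega> l) \<in> borel_measurable Q" for l
    unfolding Q_def using measurable_component_singleton[of l UNIV "\<lambda>_. std_normal_distribution"] by simp
  have marg: "distr Q borel (\<lambda>\<omega>. \<omega> l) = std_normal_distribution" for l
    using PiM_component[of l] unfolding Q_def by (metis UNIV_I distr_cong sets_density sets_lborel)
  have "distr Q (\<Pi>\<^sub>M i\<in>UNIV. borel) (\<lambda>x. \<lambda>i\<in>UNIV. x i) = distr Q Q (\<lambda>x. x)"
    by (rule distr_cong) (auto simp: Q_def intro!: sets_PiM_cong)
  then have ind: "Q.indep_vars (\<lambda>_. borel) (\<lambda>l \<omega>. \<omega> l) (UNIV :: nat set)"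
    by (subst Q.indep_vars_iff_distr_eq_PiM) (auto simp: marg distr_id2, simp add: Q_def)
  show "has_gauss Q (\<lambda>\<omega>. \<Sum>l<K. c l * \<omega> l) (\<Sum>l<K. (c l)\<^sup>2)" for K c
    unfolding has_gauss_def
  proof (intro conjI allI)
    fix t
    have "Q.indep_vars (\<lambda>_. borel) (\<lambda>l \<omega>. c l * \<omega> l) {..<K}"
      by (rule Q.indep_vars_compose2[where X = "\<lambda>l \<omega>. \<omega> l" and M' = "\<lambda>_. borel"])
         (auto intro: Q.indep_vars_subset[OF ind])
    then have "char (distr Q borel (\<lambda>\<omega>. \<Sum>l<K. c l * \<omega> l)) t =
        (\<Prod>l<K. char (distr Q borel (\<lambda>\<omega>. c l * \<omega> l)) t)"
      by (rule Q.char_distr_sum)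
    also have "\<dots> = (\<Prod>l<K. complex_of_real (exp (- ((c l)\<^sup>2 * t\<^sup>2) / 2)))"
      by (simp add: char_distr_scale marg char_std_normal_distribution power_mult_distrib)
    also have "\<dots> = complex_of_real (exp (\<Sum>l<K. - ((c l)\<^sup>2 * t\<^sup>2) / 2))"
      by (simp add: exp_sum)
    also have "(\<Sum>l<K. - ((c l)\<^sup>2 * t\<^sup>2) / 2) = - (t\<^sup>2 * (\<Sum>l<K. (c l)\<^sup>2)) / 2"
      by (simp add: sum_distrib_left sum_divide_distrib sum_negf mult.commute)
    finally show "char (distr Q borel (\<lambda>\<omega>. \<Sum>l<K. c l * \<omega> l)) t =
      complex_of_real (exp (- (t\<^sup>2 * (\<Sum>l<K. (c l)\<^sup>2)) / 2))" .
  qed (auto intro: sum_nonneg)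
qed

section \<open>Gaussian sequences with prescribed covariance\<close>

definition bdd_meas :: "'a measure \<Rightarrow> ('a \<Rightarrow> real) \<Rightarrow> bool" where
  "bdd_meas M f \<longleftrightarrow> f \<in> borel_measurable M \<and> (\<exists>B. \<forall>x. \<bar>f x\<bar> \<le> B)"

lemma bdd_meas_add: assumes "bdd_meas M f" "bdd_meas M g" shows "bdd_meas M (\<lambda>x. f x + g x)"
proof -
  obtain B C where "\<And>x. \<bar>f x\<bar> \<le> B" "\<And>x. \<bar>g x\<bar> \<le> C" using assms by (auto simp: bdd_meas_def)
  then have "\<bar>f x + g x\<bar> \<le> B + C" for x by (meson abs_triangle_ineq order_trans add_mono)
  then show ?thesis using assms by (auto simp: bdd_meas_def)
qed

lemma bdd_meas_mult: assumes "bdd_meas M f" "bdd_meas M g" shows "bdd_meas M (\<lambda>x. f x * g x)"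
proof -
  obtain B C where "\<And>x. \<bar>f x\<bar> \<le> B" "\<And>x. \<bar>g x\<bar> \<le> C" using assms by (auto simp: bdd_meas_def)
  then have "\<bar>f x * g x\<bar> \<le> B * C" for x
    unfolding abs_mult by (meson abs_ge_zero mult_mono order_trans)
  then show ?thesis using assms by (auto simp: bdd_meas_def)
qed

lemma bdd_meas_const: "bdd_meas M (\<lambda>_. c)"
  by (auto simp: bdd_meas_def)

lemma bdd_meas_diff: assumes "bdd_meas M f" "bdd_meas M g" shows "bdd_meas M (\<lambda>x. f x - g x)"
  using bdd_meas_add[OF assms(1) bdd_meas_mult[OF bdd_meas_const[of M "-1"] assms(2)]] by simp

lemma bdd_meas_sum: "(\<And>i. i \<in> I \<Longrightarrow> bdd_meas M (f i)) \<Longrightarrow> bdd_meas M (\<lambda>x. \<Sum>i\<in>I. f i x)"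
  by (induction I rule: infinite_finite_induct) (auto simp: bdd_meas_const bdd_meas_add)

lemma bdd_meas_integrable: assumes "prob_space M" "bdd_meas M f" shows "integrable M f"
proof -
  interpret prob_space M by fact
  obtain B where "\<And>x. \<bar>f x\<bar> \<le> B" using assms(2) by (auto simp: bdd_meas_def)
  then show ?thesis using assms(2) by (intro integrable_const_bound[where B = B]) (auto simp: bdd_meas_def)
qed

text \<open>Gram-Schmidt on the centred functions: \<open>\<psi> l i\<close> is \<open>\<phi> i\<close> minus its mean and minus its projections on
the first \<open>l\<close> orthogonal directions. Removing direction \<open>l\<close> subtracts \<open>L i l * L j l\<close> from all inner
products, so the covariance matrix is \<open>L\<close> times its transpose, with \<open>L\<close> lower triangular. If the
direction vanishes, the convention \<open>x / 0 = 0\<close> gives \<open>L i l = 0\<close> and nothing is removed.\<close>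

lemma variance_factorization:
  assumes M: "prob_space M" and \<phi>: "\<And>k. bdd_meas M (\<phi> k)"
  obtains L :: "nat \<Rightarrow> nat \<Rightarrow> real" where
    "\<And>K t. prob_space.variance M (\<lambda>x. \<Sum>k<K. t k * \<phi> k x) = (\<Sum>l<K. (\<Sum>i<K. t i * L i l)\<^sup>2)"
    "\<And>i l. i < l \<Longrightarrow> L i l = 0"
proof -
  interpret prob_space M by fact
  note bm = bdd_meas_diff bdd_meas_mult bdd_meas_const bdd_meas_add bdd_meas_sum
  note int = bdd_meas_integrable[OF M]
  define inn where "inn f g = (LINT x|M. f x * g x)" for f g :: "'a \<Rightarrow> real"
  define \<psi> where "\<psi> = rec_nat (\<lambda>i x. \<phi> i x - expectation (\<phi> i))
    (\<lambda>l p i x. p i x - inn (p i) (p l) / inn (p l) (p l) * p l x)"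
  have \<psi>0: "\<psi> 0 i = (\<lambda>x. \<phi> i x - expectation (\<phi> i))" for i by (simp add: \<psi>_def)
  have \<psi>S: "\<psi> (Suc l) i = (\<lambda>x. \<psi> l i x - inn (\<psi> l i) (\<psi> l l) / inn (\<psi> l l) (\<psi> l l) * \<psi> l l x)" for l i
    by (simp add: \<psi>_def)
  have \<psi>bm: "bdd_meas M (\<psi> l i)" for l i
  proof (induction l arbitrary: i)
    case 0 show ?case unfolding \<psi>0 by (intro bm \<phi>)
  next
    case (Suc l) show ?case unfolding \<psi>S by (intro bm Suc.IH)
  qed
  define L where "L i l = inn (\<psi> l i) (\<psi> l l) / sqrt (inn (\<psi> l l) (\<psi> l l))" for i l
  have nn: "0 \<le> inn f f" for f unfolding inn_def by (intro integral_nonneg_AE) simp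
  have sym: "inn f g = inn g f" for f g by (simp add: inn_def mult.commute)
  have step: "inn (\<psi> (Suc l) i) (\<psi> (Suc l) j) = inn (\<psi> l i) (\<psi> l j) - L i l * L j l" for l i j
  proof -
    let ?n = "inn (\<psi> l l) (\<psi> l l)"
    define c where "c i = inn (\<psi> l i) (\<psi> l l) / ?n" for i
    have \<psi>c: "\<psi> (Suc l) i x = \<psi> l i x - c i * \<psi> l l x" for i x by (simp add: \<psi>S c_def)
    have "inn (\<psi> (Suc l) i) (\<psi> (Suc l) j) = (LINT x|M. \<psi> l i x * \<psi> l j x - c j * (\<psi> l i x * \<psi> l l x)
        - c i * (\<psi> l j x * \<psi> l l x) + c i * c j * (\<psi> l l x * \<psi> l l x))"
      unfolding inn_def[of "\<psi> (Suc l) i"] \<psi>c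
      by (intro Bochner_Integration.integral_cong refl) (simp add: algebra_simps)
    also have "\<dots> = inn (\<psi> l i) (\<psi> l j) - c j * inn (\<psi> l i) (\<psi> l l) - c i * inn (\<psi> l j) (\<psi> l l) + c i * c j * ?n"
      using int[OF bdd_meas_mult[OF \<psi>bm \<psi>bm]] unfolding inn_def by simp
    also have "\<dots> = inn (\<psi> l i) (\<psi> l j) - inn (\<psi> l i) (\<psi> l l) * inn (\<psi> l j) (\<psi> l l) / ?n"
      unfolding c_def by (cases "?n = 0") (simp_all add: field_simps)
    also have "inn (\<psi> l i) (\<psi> l l) * inn (\<psi> l j) (\<psi> l l) / ?n = L i l * L j l"
      unfolding L_def using nn[of "\<psi> l l"] by simp
    finally show ?thesis .
  qed
  have null: "inn f g = 0" if "inn g g = 0" "bdd_meas M f" "bdd_meas M g" for f g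
  proof -
    have "AE x in M. g x * g x = 0"
      using that(1) int[OF bdd_meas_mult[OF that(3,3)]] unfolding inn_def
      by (subst (asm) integral_nonneg_eq_0_iff_AE) auto
    then have "AE x in M. f x * g x = 0" by eventually_elim auto
    then show ?thesis unfolding inn_def by (rule integral_eq_zero_AE)
  qed
  have diag0: "inn (\<psi> (Suc l) l) (\<psi> (Suc l) l) = 0" for l
    unfolding step L_def using nn[of "\<psi> l l"] by (cases "inn (\<psi> l l) (\<psi> l l) = 0") simp_all
  (* After direction i has been removed, nothing of \<phi> i is left, and the diagonal entries
     never increase. *)
  have zero: "inn (\<psi> m i) (\<psi> m i) = 0" if "i < m" for m i
    using that
  proof (induction m)
    case (Suc m)
    then show ?case
    proof (cases "i = m")
      case False
      then have "inn (\<psi> m i) (\<psi> m i) = 0" using Suc by auto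
      moreover have "inn (\<psi> (Suc m) i) (\<psi> (Suc m) i) \<le> inn (\<psi> m i) (\<psi> m i)" unfolding step by simp
      ultimately show ?thesis using nn[of "\<psi> (Suc m) i"] by simp
    qed (use diag0 in simp)
  qed simp
  have tele: "inn (\<psi> 0 i) (\<psi> 0 j) = (\<Sum>l<m. L i l * L j l) + inn (\<psi> m i) (\<psi> m j)" for m i j
    by (induction m) (simp_all add: step)
  show ?thesis
  proof (rule that[of L])
    show "L i l = 0" if "i < l" for i l
    proof -
      have "inn (\<psi> l l) (\<psi> l i) = 0" by (rule null[OF zero[OF that] \<psi>bm \<psi>bm])
      then show ?thesis by (simp add: L_def sym)
    qed
    fix K and t :: "nat \<Rightarrow> real"
    have E: "expectation (\<lambda>x. \<Sum>k<K. t k * \<phi> k x) = (\<Sum>k<K. t k * expectation (\<phi> k))"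
      using int[OF \<phi>] by simp
    have "variance (\<lambda>x. \<Sum>k<K. t k * \<phi> k x) = (LINT x|M. (\<Sum>i<K. \<Sum>j<K. t i * t j * (\<psi> 0 i x * \<psi> 0 j x)))"
    proof (intro Bochner_Integration.integral_cong refl)
      fix x
      have "(\<Sum>k<K. t k * \<phi> k x) - (\<Sum>k<K. t k * expectation (\<phi> k)) = (\<Sum>k<K. t k * \<psi> 0 k x)"
        by (simp add: \<psi>0 sum_subtractf right_diff_distrib)
      then show "((\<Sum>k<K. t k * \<phi> k x) - expectation (\<lambda>x. \<Sum>k<K. t k * \<phi> k x))\<^sup>2 =
          (\<Sum>i<K. \<Sum>j<K. t i * t j * (\<psi> 0 i x * \<psi> 0 j x))"
        unfolding E power2_eq_square by (simp add: sum_product mult_ac)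
    qed
    also have "\<dots> = (\<Sum>i<K. \<Sum>j<K. t i * t j * inn (\<psi> 0 i) (\<psi> 0 j))"
      using int[OF bdd_meas_mult[OF \<psi>bm \<psi>bm]] unfolding inn_def by simp
    also have "\<dots> = (\<Sum>i<K. \<Sum>j<K. \<Sum>l<K. (t i * L i l) * (t j * L j l))"
    proof (intro sum.cong refl)
      fix i j assume "i \<in> {..<K}" "j \<in> {..<K}"
      then have "inn (\<psi> K i) (\<psi> K j) = 0" using null[OF zero \<psi>bm \<psi>bm, of j K] by simp
      then show "t i * t j * inn (\<psi> 0 i) (\<psi> 0 j) = (\<Sum>l<K. (t i * L i l) * (t j * L j l))"
        by (simp add: tele[of i j K] sum_distrib_left mult_ac)
    qed
    also have "\<dots> = (\<Sum>i<K. \<Sum>l<K. \<Sum>j<K. (t i * L i l) * (t j * L j l))"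
      by (intro sum.cong refl sum.swap)
    also have "\<dots> = (\<Sum>l<K. \<Sum>i<K. \<Sum>j<K. (t i * L i l) * (t j * L j l))"
      by (rule sum.swap)
    also have "\<dots> = (\<Sum>l<K. (\<Sum>i<K. t i * L i l)\<^sup>2)"
      by (simp add: power2_eq_square sum_product)
    finally show "variance (\<lambda>x. \<Sum>k<K. t k * \<phi> k x) = (\<Sum>l<K. (\<Sum>i<K. t i * L i l)\<^sup>2)" .
  qed
qed

text \<open>A centred Gaussian sequence with the covariances of the \<open>\<phi> k\<close> under \<open>M\<close>, in the form given by the
Cramer-Wold device.\<close>

definition gauss_coords :: "'w measure \<Rightarrow> 'a measure \<Rightarrow> (nat \<Rightarrow> 'a \<Rightarrow> real) \<Rightarrow> ('w \<Rightarrow> nat \<Rightarrow> real) \<Rightarrow> bool" where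
  "gauss_coords N M \<phi> W \<longleftrightarrow>
     (\<forall>K t. has_gauss N (\<lambda>\<omega>. \<Sum>k<K. t k * W \<omega> k) (prob_space.variance M (\<lambda>x. \<Sum>k<K. t k * \<phi> k x)))"

text \<open>The lower triangular factor is applied to independent standard normal variables. Triangularity makes
each coordinate a finite sum.\<close>

lemma gauss_coords_exists:
  assumes M: "prob_space M" and \<phi>: "\<And>k. bdd_meas M (\<phi> k)"
  obtains Q :: "(nat \<Rightarrow> real) measure" and W where "prob_space Q" "gauss_coords Q M \<phi> W"
proof -
  obtain L where L: "\<And>K t. prob_space.variance M (\<lambda>x. \<Sum>k<K. t k * \<phi> k x) = (\<Sum>l<K. (\<Sum>i<K. t i * L i l)\<^sup>2)"
    "\<And>i l. i < l \<Longrightarrow> L i l = 0"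
    by (rule variance_factorization[OF M \<phi>]) (rule that)
  define Q where "Q = PiM (UNIV :: nat set) (\<lambda>_. std_normal_distribution)"
  note iid = iid_gauss_sequence[folded Q_def]
  define W where "W \<omega> i = (\<Sum>l<Suc i. L i l * \<omega> l)" for \<omega> :: "nat \<Rightarrow> real" and i
  have W: "W \<omega> i = (\<Sum>l<K. L i l * \<omega> l)" if "i < K" for \<omega> i K
    unfolding W_def using that L(2) by (intro sum.mono_neutral_left) auto
  have "(\<Sum>k<K. t k * W \<omega> k) = (\<Sum>l<K. (\<Sum>i<K. t i * L i l) * \<omega> l)" for K t \<omega>
  proof -
    have "(\<Sum>k<K. t k * W \<omega> k) = (\<Sum>k<K. \<Sum>l<K. t k * L k l * \<omega> l)"
      by (intro sum.cong refl) (simp add: W[of _ K] sum_distrib_left mult_ac)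
    also have "\<dots> = (\<Sum>l<K. \<Sum>k<K. t k * L k l * \<omega> l)" by (rule sum.swap)
    finally show ?thesis by (simp add: sum_distrib_right)
  qed
  then have "gauss_coords Q M \<phi> W" using iid(3) unfolding gauss_coords_def L(1) by simp
  then show ?thesis using that iid(1) by blast
qed

lemma gauss_coords_measurable:
  assumes "gauss_coords N M \<phi> W" shows "(\<lambda>\<omega>. W \<omega> k) \<in> borel_measurable N"
proof -
  have "has_gauss N (\<lambda>\<omega>. \<Sum>j<Suc k. (if j = k then 1 else 0) * W \<omega> j)
      (prob_space.variance M (\<lambda>x. \<Sum>j<Suc k. (if j = k then 1 else 0) * \<phi> j x))"
    using assms[unfolded gauss_coords_def, rule_format, of "\<lambda>j. if j = k then 1 else 0" "Suc k"] .
  then show ?thesis by (simp add: has_gauss_def if_distrib[where f = "\<lambda>x. x * _"] cong: if_cong)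
qed

section \<open>Series in a fixed sequence of bounded functions\<close>

lemma variance_cong_AE:
  fixes f g :: "'a \<Rightarrow> real"
  assumes "prob_space M" "f \<in> borel_measurable M" "g \<in> borel_measurable M" "AE x in M. f x = g x"
  shows "prob_space.variance M f = prob_space.variance M g"
proof -
  interpret prob_space M by fact
  note [measurable] = assms(2,3)
  have "expectation f = expectation g" by (intro integral_cong_AE assms(4)) measurable
  then have "AE x in M. (f x - expectation f)\<^sup>2 = (g x - expectation g)\<^sup>2"
    using assms(4) by auto
  then show ?thesis by (intro integral_cong_AE) measurable
qed

lemma has_gauss_cong_AE:
  assumes "has_gauss N Y v" "Y' \<in> borel_measurable N" "AE \<omega> in N. Y \<omega> = Y' \<omega>"
  shows "has_gauss N Y' v"
proof -
  have "distr N borel Y = distr N borel Y'"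
    using assms by (intro distr_cong_AE) (auto simp: has_gauss_def)
  then show ?thesis using assms by (simp add: has_gauss_def)
qed

lemma ip_add: "summable (\<lambda>k. b k * u k) \<Longrightarrow> summable (\<lambda>k. c k * u k) \<Longrightarrow> ip (\<lambda>k. b k + c k) u = ip b u + ip c u"
  by (simp add: ip_def suminf_add distrib_right)

lemma ip_diff: "summable (\<lambda>k. b k * u k) \<Longrightarrow> summable (\<lambda>k. c k * u k) \<Longrightarrow> ip (\<lambda>k. b k - c k) u = ip b u - ip c u"
  by (simp add: ip_def suminf_diff left_diff_distrib)

lemma ip_truncate: "ip (\<lambda>k. if k < n then b k else 0) u = (\<Sum>k<n. b k * u k)"
proof -
  have "ip (\<lambda>k. if k < n then b k else 0) u = (\<Sum>k<n. (if k < n then b k else 0) * u k)"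
    unfolding ip_def by (rule suminf_finite) auto
  then show ?thesis by simp
qed

lemma truncate_in_box: "b \<in> box_seq \<beta> \<Longrightarrow> (\<lambda>k. if k < n then b k else 0) \<in> box_seq \<beta>"
  by (fastforce simp: box_seq_def intro: order_trans[OF abs_ge_zero])

lemma tendsto_coordinatewise:
  fixes b :: "nat \<Rightarrow> nat \<Rightarrow> real"
  assumes "\<And>k. (\<lambda>n. b n k) \<longlonglongrightarrow> c k" shows "b \<longlonglongrightarrow> c"
proof -
  have "limitin (product_topology (\<lambda>_::nat. euclidean :: real topology) UNIV) b c sequentially"
    using assms by (subst limitin_componentwise) auto
  then show ?thesis by (simp add: euclidean_product_topology)
qed

lemma truncate_tendsto: "(\<lambda>n k. if k < n then b k else 0 :: real) \<longlonglongrightarrow> b"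
proof (rule tendsto_coordinatewise)
  show "(\<lambda>n. if k < n then b k else 0) \<longlonglongrightarrow> b k" for k
    by (rule tendsto_eventually) (auto simp: eventually_sequentially intro!: exI[of _ "Suc k"])
qed

locale expansion = prob_space M for M :: "'a measure" +
  fixes \<phi> :: "nat \<Rightarrow> 'a \<Rightarrow> real" and \<beta> :: "nat \<Rightarrow> real"
  assumes meas_\<phi>[measurable]: "\<And>k. \<phi> k \<in> borel_measurable M"
    and bound_\<phi>: "\<And>k x. \<bar>\<phi> k x\<bar> \<le> 1"
    and pos_\<beta>: "\<And>k. 0 < \<beta> k" and sum_\<beta>: "summable \<beta>"
begin

definition series :: "(nat \<Rightarrow> real) \<Rightarrow> 'a \<Rightarrow> real" where
  "series b x = ip b (\<lambda>k. \<phi> k x)"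

definition V :: "(nat \<Rightarrow> real) \<Rightarrow> real" where
  "V b = variance (series b)"

lemma \<beta>_nonneg: "0 \<le> \<beta> k" using pos_\<beta>[of k] by simp

lemma \<phi>_box: "(\<lambda>k. \<phi> k x) \<in> box_seq (\<lambda>_. 1)" by (simp add: box_seq_def bound_\<phi>)

lemma summable_\<phi>: "summable (\<lambda>k. \<beta> k * \<bar>\<phi> k x\<bar>)"
  by (rule summable_box[OF sum_\<beta> \<phi>_box \<beta>_nonneg])

lemma bdd_\<phi>: "bdd_meas M (\<phi> k)"
  using bound_\<phi> meas_\<phi> by (auto simp: bdd_meas_def)

lemma abs_expectation_\<phi>: "\<bar>expectation (\<phi> k)\<bar> \<le> 1"
proof -
  note bm = bdd_\<phi>[of k]
  have "\<bar>expectation (\<phi> k)\<bar> \<le> (LINT y|M. \<bar>\<phi> k y\<bar>)" by (rule integral_abs_bound)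
  also have "\<dots> \<le> (LINT y|M. 1)" using bdd_meas_integrable[OF prob_space_axioms bm] bound_\<phi> by (intro integral_mono) auto
  finally show ?thesis by (simp add: prob_space)
qed

lemma series_summable_bounded: assumes "b \<in> box_seq (\<lambda>k. c * \<beta> k)" shows "summable (\<lambda>k. b k * \<phi> k x)" "\<bar>series b x\<bar> \<le> c * (\<Sum>k. \<beta> k)"
proof -
  have "0 \<le> c" using box_seqD[OF assms, of 0] pos_\<beta>[of 0] by (smt (verit) mult_neg_pos abs_ge_zero)
  have s: "summable (\<lambda>k. (c * \<beta> k) * \<bar>\<phi> k x\<bar>)"
    using summable_mult[OF summable_\<phi>, of c] by (simp add: mult.assoc)
  show "summable (\<lambda>k. b k * \<phi> k x)" using summable_ip(1)[OF assms s] .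
  have "(\<Sum>k. (c * \<beta> k) * \<bar>\<phi> k x\<bar>) \<le> (\<Sum>k. c * \<beta> k)"
    using \<open>0 \<le> c\<close> \<beta>_nonneg bound_\<phi> by (intro suminf_le s summable_mult sum_\<beta>) (auto intro!: mult_left_le)
  then show "\<bar>series b x\<bar> \<le> c * (\<Sum>k. \<beta> k)"
    using summable_ip(2)[OF assms s] suminf_mult[OF sum_\<beta>, of c] by (simp add: series_def)
qed

lemma series_measurable[measurable]: "series b \<in> borel_measurable M"
  unfolding series_def ip_def by measurable

lemma bdd_series: "b \<in> box_seq (\<lambda>k. c * \<beta> k) \<Longrightarrow> bdd_meas M (series b)"
  using series_summable_bounded(2) by (auto simp: bdd_meas_def)

lemma box_one: "b \<in> box_seq \<beta> \<Longrightarrow> b \<in> box_seq (\<lambda>k. 1 * \<beta> k)" by simp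

lemma box_sub: "b \<in> box_seq \<beta> \<Longrightarrow> b' \<in> box_seq \<beta> \<Longrightarrow> (\<lambda>k. b k - b' k) \<in> box_seq (\<lambda>k. 2 * \<beta> k)"
  unfolding box_seq_def by (smt (verit) mem_Collect_eq)

lemma series_diff: "b \<in> box_seq \<beta> \<Longrightarrow> b' \<in> box_seq \<beta> \<Longrightarrow> series (\<lambda>k. b k - b' k) x = series b x - series b' x"
  unfolding series_def by (intro ip_diff series_summable_bounded(1)[of _ 1]) auto

text \<open>Coordinatewise convergence is enough: the series converge pointwise and are uniformly bounded, so
dominated convergence applies to their first two moments.\<close>

lemma V_tendsto:
  assumes "\<And>n. b n \<in> box_seq (\<lambda>k. c * \<beta> k)" "b \<longlonglongrightarrow> b'" "b' \<in> box_seq (\<lambda>k. c * \<beta> k)"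
  shows "(\<lambda>n. V (b n)) \<longlonglongrightarrow> V b'"
proof -
  have c: "0 \<le> c" using box_seqD[OF assms(3), of 0] pos_\<beta>[of 0] by (smt (verit) mult_neg_pos abs_ge_zero)
  have pt: "(\<lambda>n. series (b n) x) \<longlonglongrightarrow> series b' x" for x
  proof -
    have "(\<lambda>n. ip (fst (b n, \<lambda>k. \<phi> k x)) (snd (b n, \<lambda>k. \<phi> k x))) \<longlonglongrightarrow>
        ip (fst (b', \<lambda>k. \<phi> k x)) (snd (b', \<lambda>k. \<phi> k x))"
    proof (rule continuous_on_tendsto_compose[OF continuous_on_ip[of "\<lambda>k. c * \<beta> k" 1]])
      show "(\<lambda>n. (b n, \<lambda>k. \<phi> k x)) \<longlonglongrightarrow> (b', \<lambda>k. \<phi> k x)" by (intro tendsto_intros assms)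
    qed (use assms c \<beta>_nonneg \<phi>_box in \<open>auto intro!: summable_mult sum_\<beta>\<close>)
    then show ?thesis by (simp add: series_def)
  qed
  let ?B = "c * (\<Sum>k. \<beta> k)"
  have int: "integrable M (series b)" "integrable M (\<lambda>x. (series b x)\<^sup>2)" if "b \<in> box_seq (\<lambda>k. c * \<beta> k)" for b
    using bdd_meas_integrable[OF prob_space_axioms] bdd_series[OF that] bdd_meas_mult
    by (auto simp: power2_eq_square)
  have V_eq: "V b = (LINT x|M. (series b x)\<^sup>2) - (expectation (series b))\<^sup>2" if "b \<in> box_seq (\<lambda>k. c * \<beta> k)" for b
    unfolding V_def by (rule variance_eq[OF int[OF that]])
  have "(\<lambda>n. expectation (series (b n))) \<longlonglongrightarrow> expectation (series b')"
    by (rule integral_dominated_convergence[where w = "\<lambda>_. ?B"]) (use pt series_summable_bounded(2) assms in auto)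
  moreover have "(\<lambda>n. expectation (\<lambda>x. (series (b n) x)\<^sup>2)) \<longlonglongrightarrow> expectation (\<lambda>x. (series b' x)\<^sup>2)"
  proof (rule integral_dominated_convergence[where w = "\<lambda>_. ?B\<^sup>2"])
    show "AE x in M. (\<lambda>n. (series (b n) x)\<^sup>2) \<longlonglongrightarrow> (series b' x)\<^sup>2" by (intro AE_I2 tendsto_power pt)
    show "AE x in M. norm ((series (b n) x)\<^sup>2) \<le> ?B\<^sup>2" for n
      using power_mono[OF series_summable_bounded(2)[OF assms(1)[of n]] abs_ge_zero, of _ 2] by (intro AE_I2) simp
  qed auto
  ultimately show ?thesis
    unfolding V_eq[OF assms(1)] V_eq[OF assms(3)] by (intro tendsto_intros)
qed

lemma V_nonneg: "0 \<le> V b"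
  unfolding V_def by (intro integral_nonneg_AE) simp

text \<open>Partial sums are Gaussian by assumption, with the variance of the truncated series, and both
converge.\<close>

lemma gauss_ip:
  assumes N: "prob_space N" and W: "gauss_coords N M \<phi> W" and b: "b \<in> box_seq (\<lambda>k. c * \<beta> k)"
    and s: "AE \<omega> in N. summable (\<lambda>k. \<beta> k * \<bar>W \<omega> k\<bar>)"
  shows "has_gauss N (\<lambda>\<omega>. ip b (W \<omega>)) (V b)"
proof (rule has_gauss_limit[OF N])
  note [measurable] = gauss_coords_measurable[OF W]
  show "(\<lambda>\<omega>. ip b (W \<omega>)) \<in> borel_measurable N" unfolding ip_def by measurable
  let ?b = "\<lambda>n k. if k < n then b k else 0"
  show "has_gauss N (\<lambda>\<omega>. \<Sum>k<n. b k * W \<omega> k) (V (?b n))" for n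
    using W unfolding gauss_coords_def V_def series_def[abs_def] ip_truncate by simp
  show "(\<lambda>n. V (?b n)) \<longlonglongrightarrow> V b"
    by (rule V_tendsto[OF truncate_in_box[OF b] truncate_tendsto b])
  show "AE \<omega> in N. (\<lambda>n. \<Sum>k<n. b k * W \<omega> k) \<longlonglongrightarrow> ip b (W \<omega>)"
    using s
  proof eventually_elim
    case (elim \<omega>)
    have "summable (\<lambda>k. (c * \<beta> k) * \<bar>W \<omega> k\<bar>)" using summable_mult[OF elim, of c] by (simp add: mult.assoc)
    then show ?case unfolding ip_def by (intro summable_LIMSEQ summable_ip(1)[OF b])
  qed
qed

lemma V_unit: "V (\<lambda>j. if j = k then 1 else 0) \<le> 1"
proof -
  have eq: "series (\<lambda>j. if j = k then 1 else 0) = \<phi> k"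
  proof
    fix x
    have "series (\<lambda>j. if j = k then 1 else 0) x = (\<Sum>j\<in>{k}. (if j = k then 1 else 0) * \<phi> j x)"
      unfolding series_def ip_def by (rule suminf_finite) auto
    then show "series (\<lambda>j. if j = k then 1 else 0) x = \<phi> k x" by simp
  qed
  note bm = bdd_\<phi>[of k]
  note i = bdd_meas_integrable[OF prob_space_axioms bm]
    bdd_meas_integrable[OF prob_space_axioms bdd_meas_mult[OF bm bm], folded power2_eq_square]
  have "variance (\<phi> k) \<le> expectation (\<lambda>x. (\<phi> k x)\<^sup>2)" by (simp add: variance_eq[OF i])
  also have "\<dots> \<le> expectation (\<lambda>x. 1)"
    using i(2) bound_\<phi> by (intro integral_mono) (auto simp: abs_square_le_1)
  finally show ?thesis by (simp add: V_def eq prob_space)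
qed

lemma gauss_coords_second_moment:
  assumes N: "prob_space N" and W: "gauss_coords N M \<phi> W"
  shows "integrable N (\<lambda>\<omega>. (W \<omega> k)\<^sup>2)" "(LINT \<omega>|N. (W \<omega> k)\<^sup>2) \<le> 1"
proof -
  let ?e = "\<lambda>j. if j = k then 1 else 0 :: real"
  have "has_gauss N (\<lambda>\<omega>. \<Sum>j<Suc k. ?e j * W \<omega> j) (variance (\<lambda>x. \<Sum>j<Suc k. ?e j * \<phi> j x))"
    by (rule W[unfolded gauss_coords_def, rule_format])
  moreover have "(\<lambda>x. \<Sum>j<Suc k. ?e j * \<phi> j x) = series ?e"
  proof
    fix x show "(\<Sum>j<Suc k. ?e j * \<phi> j x) = series ?e x"
      unfolding series_def ip_def by (rule suminf_finite[symmetric]) auto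
  qed
  moreover have "(\<lambda>\<omega>. \<Sum>j<Suc k. ?e j * W \<omega> j) = (\<lambda>\<omega>. W \<omega> k)"
    by (simp add: fun_eq_iff if_distrib[where f = "\<lambda>x. x * _"] cong: if_cong)
  ultimately have "has_gauss N (\<lambda>\<omega>. W \<omega> k) (V ?e)" by (simp add: V_def)
  from has_gauss_moments[OF N this] V_unit[of k]
  show "integrable N (\<lambda>\<omega>. (W \<omega> k)\<^sup>2)" "(LINT \<omega>|N. (W \<omega> k)\<^sup>2) \<le> 1" by auto
qed

text \<open>Two properties that hold for almost every value of a Gaussian sequence, but that a bridge must have
everywhere on its probability space: weighted summability, and equal pairings with coefficient
sequences whose functions have standard deviation distance zero.\<close>

definition regular :: "(nat \<Rightarrow> real) \<Rightarrow> (nat \<Rightarrow> real) \<Rightarrow> bool" where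
  "regular \<gamma> w \<longleftrightarrow> summable (\<lambda>k. \<gamma> k * \<bar>w k\<bar>) \<and>
     (\<forall>b\<in>box_seq \<beta>. \<forall>b'\<in>box_seq \<beta>. V (\<lambda>k. b k - b' k) = 0 \<longrightarrow> ip b w = ip b' w)"

text \<open>The second clause of \<open>regular\<close> asks for uncountably many identities, each of which holds almost
surely because the difference is Gaussian of variance zero. Those for a countable dense set of pairs
hold simultaneously and extend to all pairs by continuity. On the remaining null set the sequence is
replaced by 0, which is regular.\<close>

lemma regular_coords_exist:
  assumes \<gamma>: "\<And>k. \<beta> k \<le> \<gamma> k" "summable \<gamma>"
  obtains Q :: "(nat \<Rightarrow> real) measure" and W where "prob_space Q" "gauss_coords Q M \<phi> W" "\<And>\<omega>. regular \<gamma> (W \<omega>)"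
proof -
  note bdd_\<phi>
  then obtain Q :: "(nat \<Rightarrow> real) measure" and W where Q: "prob_space Q" and W: "gauss_coords Q M \<phi> W"
    by (rule gauss_coords_exists[OF prob_space_axioms]) (rule that)
  interpret Q: prob_space Q by fact
  note [measurable] = gauss_coords_measurable[OF W]
  have \<gamma>0: "0 \<le> \<gamma> k" for k using \<gamma>(1)[of k] \<beta>_nonneg[of k] by simp
  have AE1: "AE \<omega> in Q. summable (\<lambda>k. \<gamma> k * \<bar>W \<omega> k\<bar>)"
    by (rule weighted_squares(2)[where C = 1 and U = W]) (use Q \<gamma> \<gamma>0 gauss_coords_second_moment[OF Q W] in auto)
  have le: "summable (\<lambda>k. \<beta> k * \<bar>w k\<bar>)" if "summable (\<lambda>k. \<gamma> k * \<bar>w k\<bar>)" for w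
    by (rule summable_comparison_test[OF _ that]) (use \<gamma> \<beta>_nonneg in \<open>auto intro!: mult_right_mono exI\<close>)
  have AE2: "AE \<omega> in Q. summable (\<lambda>k. \<beta> k * \<bar>W \<omega> k\<bar>)" using AE1 by eventually_elim (rule le)
  define E where "E = {(b, b'). b \<in> box_seq \<beta> \<and> b' \<in> box_seq \<beta> \<and> V (\<lambda>k. b k - b' k) = 0}"
  obtain D where D: "countable D" "D \<subseteq> E" "E \<subseteq> closure D" by (rule separable)
  have "AE \<omega> in Q. ip (fst p) (W \<omega>) = ip (snd p) (W \<omega>)" if "p \<in> D" for p
  proof -
    have p: "fst p \<in> box_seq \<beta>" "snd p \<in> box_seq \<beta>" "V (\<lambda>k. fst p k - snd p k) = 0"
      using that D(2) by (auto simp: E_def)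
    have g: "has_gauss Q (\<lambda>\<omega>. ip (\<lambda>k. fst p k - snd p k) (W \<omega>)) 0"
      using gauss_ip[OF Q W box_sub[OF p(1,2)] AE2] p(3) by simp
    then have [measurable]: "(\<lambda>\<omega>. ip (\<lambda>k. fst p k - snd p k) (W \<omega>)) \<in> borel_measurable Q"
      by (simp add: has_gauss_def)
    have "AE \<omega> in Q. (ip (\<lambda>k. fst p k - snd p k) (W \<omega>))\<^sup>2 = 0"
      using has_gauss_moments(3,4)[OF Q g] by (subst (asm) integral_nonneg_eq_0_iff_AE) auto
    then show ?thesis
      using AE2
    proof eventually_elim
      case (elim \<omega>)
      then show ?case
        using ip_diff[OF summable_ip(1)[OF p(1) elim(2)] summable_ip(1)[OF p(2) elim(2)]] by simp
    qed
  qed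
  then have AE3: "AE \<omega> in Q. \<forall>p\<in>D. ip (fst p) (W \<omega>) = ip (snd p) (W \<omega>)"
    by (subst AE_ball_countable[OF D(1)]) blast
  have good: "AE \<omega> in Q. regular \<gamma> (W \<omega>)"
    using AE1 AE3
  proof eventually_elim
    case (elim \<omega>)
    note s = le[OF elim(1)]
    let ?f = "\<lambda>p. ip (fst p) (W \<omega>) - ip (snd p) (W \<omega>)"
    have cb: "continuous_on (box_seq \<beta>) (\<lambda>b. ip b (W \<omega>))"
      by (rule continuous_on_ip_left[OF s])
    have "continuous_on (box_seq \<beta> \<times> box_seq \<beta>) (\<lambda>p. ip (fst p) (W \<omega>))"
      by (rule continuous_on_compose2[OF cb continuous_on_fst[OF continuous_on_id]]) auto
    moreover have "continuous_on (box_seq \<beta> \<times> box_seq \<beta>) (\<lambda>p. ip (snd p) (W \<omega>))"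
      by (rule continuous_on_compose2[OF cb continuous_on_snd[OF continuous_on_id]]) auto
    ultimately have c: "continuous_on (box_seq \<beta> \<times> box_seq \<beta>) ?f" by (rule continuous_on_diff)
    have "closure D \<subseteq> box_seq \<beta> \<times> box_seq \<beta>"
      using D(2) by (intro closure_minimal closed_Times closed_box_seq) (auto simp: E_def)
    then have c': "continuous_on (closure D) ?f" by (rule continuous_on_subset[OF c])
    have "?f p = 0" if "p \<in> closure D" for p
      by (rule continuous_constant_on_closure[OF c' _ that]) (use elim(2) in auto)
    then have "?f p = 0" if "p \<in> E" for p using D(3) that by blast
    then show ?case using elim(1) by (auto simp: regular_def E_def)
  qed
  then obtain B where B: "B \<in> null_sets Q" "{\<omega> \<in> space Q. \<not> regular \<gamma> (W \<omega>)} \<subseteq> B"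
    by (auto simp: eventually_ae_filter)
  define W' where "W' \<omega> = (if \<omega> \<in> space Q - B then W \<omega> else (\<lambda>_. 0))" for \<omega>
  have [measurable]: "B \<in> sets Q" using B by auto
  have W'm: "(\<lambda>\<omega>. W' \<omega> k) \<in> borel_measurable Q" for k
  proof -
    have "(\<lambda>\<omega>. if \<omega> \<in> space Q - B then W \<omega> k else 0) \<in> borel_measurable Q" by measurable
    then show ?thesis by (simp add: W'_def if_distrib[where f = "\<lambda>w. w k"] cong: if_cong)
  qed
  note [measurable] = W'm
  have AEW: "AE \<omega> in Q. W \<omega> = W' \<omega>"
    using AE_not_in[OF B(1)] AE_space by eventually_elim (auto simp: W'_def)
  have "has_gauss Q (\<lambda>\<omega>. \<Sum>k<K. t k * W' \<omega> k) (variance (\<lambda>x. \<Sum>k<K. t k * \<phi> k x))" for K t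
  proof (rule has_gauss_cong_AE)
    show "has_gauss Q (\<lambda>\<omega>. \<Sum>k<K. t k * W \<omega> k) (variance (\<lambda>x. \<Sum>k<K. t k * \<phi> k x))"
      using W by (simp add: gauss_coords_def)
    show "AE \<omega> in Q. (\<Sum>k<K. t k * W \<omega> k) = (\<Sum>k<K. t k * W' \<omega> k)"
      using AEW by eventually_elim simp
  qed measurable
  then have "gauss_coords Q M \<phi> W'" by (simp add: gauss_coords_def)
  moreover have "regular \<gamma> (W' \<omega>)" for \<omega>
    using B(2) by (cases "\<omega> \<in> space Q - B") (auto simp: W'_def regular_def ip_def)
  ultimately show ?thesis using that Q by blast
qed

end

section \<open>Brownian bridges from Gaussian coordinates\<close>

text \<open>A ball of a weighted \<open>\<ell>\<^sup>1\<close> space. Stating the bound for partial sums makes it visibly closed for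
coordinatewise convergence and includes summability.\<close>

definition sum_ball :: "(nat \<Rightarrow> real) \<Rightarrow> real \<Rightarrow> (nat \<Rightarrow> real) set" where
  "sum_ball \<gamma> R = {w. \<forall>n. (\<Sum>k<n. \<gamma> k * \<bar>w k\<bar>) \<le> R}"

lemma sum_ball_summable:
  assumes "w \<in> sum_ball \<gamma> R" "\<And>k. 0 \<le> \<gamma> k"
  shows "summable (\<lambda>k. \<gamma> k * \<bar>w k\<bar>)" "(\<Sum>k. \<gamma> k * \<bar>w k\<bar>) \<le> R"
proof -
  show s: "summable (\<lambda>k. \<gamma> k * \<bar>w k\<bar>)"
    by (rule summableI_nonneg_bounded) (use assms in \<open>auto simp: sum_ball_def\<close>)
  show "(\<Sum>k. \<gamma> k * \<bar>w k\<bar>) \<le> R"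
    by (rule suminf_le_const[OF s]) (use assms in \<open>auto simp: sum_ball_def\<close>)
qed

lemma sum_ballI:
  assumes "summable (\<lambda>k. \<gamma> k * \<bar>w k\<bar>)" "(\<Sum>k. \<gamma> k * \<bar>w k\<bar>) \<le> R" "\<And>k. 0 \<le> \<gamma> k"
  shows "w \<in> sum_ball \<gamma> R"
  unfolding sum_ball_def
proof (intro CollectI allI)
  fix n
  have "(\<Sum>k<n. \<gamma> k * \<bar>w k\<bar>) \<le> (\<Sum>k. \<gamma> k * \<bar>w k\<bar>)"
    by (rule sum_le_suminf[OF assms(1)]) (simp_all add: assms(3))
  then show "(\<Sum>k<n. \<gamma> k * \<bar>w k\<bar>) \<le> R" using assms(2) by linarith
qed

lemma compact_sum_ball:
  assumes "\<And>k. 0 < \<gamma> k" shows "compact (sum_ball \<gamma> R)"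
proof -
  have "closed {w. (\<Sum>k<n. \<gamma> k * \<bar>w k\<bar>) \<le> R}" for n
    by (intro closed_Collect_le continuous_on_sum continuous_on_mult continuous_on_rabs
        continuous_on_const continuous_on_coordinate)
  then have "closed (\<Inter>n. {w. (\<Sum>k<n. \<gamma> k * \<bar>w k\<bar>) \<le> R})" by blast
  moreover have "(\<Inter>n. {w. (\<Sum>k<n. \<gamma> k * \<bar>w k\<bar>) \<le> R}) = sum_ball \<gamma> R" by (auto simp: sum_ball_def)
  ultimately have cl: "closed (sum_ball \<gamma> R)" by simp
  have "sum_ball \<gamma> R \<subseteq> box_seq (\<lambda>k. R / \<gamma> k)"
  proof
    fix w assume w: "w \<in> sum_ball \<gamma> R"
    have "\<gamma> k * \<bar>w k\<bar> \<le> R" for k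
    proof -
      have "(\<Sum>j\<in>{k}. \<gamma> j * \<bar>w j\<bar>) \<le> (\<Sum>j<Suc k. \<gamma> j * \<bar>w j\<bar>)"
        by (intro sum_mono2) (auto simp: less_imp_le[OF assms])
      moreover have "(\<Sum>j<Suc k. \<gamma> j * \<bar>w j\<bar>) \<le> R" using w unfolding sum_ball_def by blast
      ultimately show ?thesis by simp
    qed
    then show "w \<in> box_seq (\<lambda>k. R / \<gamma> k)" using assms by (simp add: box_seq_def field_simps)
  qed
  then show ?thesis
    using compact_Int_closed[OF compact_box_seq cl] by (metis Int_absorb1)
qed

text \<open>Polarisation reduces covariances to variances, for which series have a formula.\<close>

lemma cov_polarization:
  fixes f g :: "'a \<Rightarrow> real"
  assumes M: "prob_space M" and "bdd_meas M f" "bdd_meas M g"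
  shows "cov M f g = (prob_space.variance M (\<lambda>x. f x + g x) - prob_space.variance M f - prob_space.variance M g) / 2"
proof -
  interpret prob_space M by fact
  note int = bdd_meas_integrable[OF M]
  let ?f = "\<lambda>x. f x - expectation f" and ?g = "\<lambda>x. g x - expectation g"
  have bm: "bdd_meas M ?f" "bdd_meas M ?g" using assms by (auto intro: bdd_meas_diff bdd_meas_const)
  have "variance (\<lambda>x. f x + g x) = (LINT x|M. ?f x * ?f x + ?g x * ?g x + 2 * (?f x * ?g x))"
    using int[OF assms(2)] int[OF assms(3)]
    by (intro Bochner_Integration.integral_cong refl) (simp add: power2_eq_square algebra_simps)
  also have "\<dots> = variance f + variance g + 2 * cov M f g"
    unfolding cov_def using int[OF bdd_meas_mult[OF bm(1) bm(1)]] int[OF bdd_meas_mult[OF bm(2) bm(2)]]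
      int[OF bdd_meas_mult[OF bm]] by (simp add: power2_eq_square)
  finally show ?thesis by simp
qed

text \<open>The series represents \<open>f\<close> only almost everywhere: a Lipschitz function on the whole space can be
unbounded, while every such series is bounded.\<close>

locale class_expansion = expansion M \<phi> \<beta> for M :: "'a measure" and \<phi> \<beta> +
  fixes F :: "('a \<Rightarrow> real) set" and coef :: "('a \<Rightarrow> real) \<Rightarrow> nat \<Rightarrow> real"
  assumes F_ne: "F \<noteq> {}"
    and coef_box: "\<And>f. f \<in> F \<Longrightarrow> coef f \<in> box_seq \<beta>"
    and F_meas: "\<And>f. f \<in> F \<Longrightarrow> f \<in> borel_measurable M"
    and repr: "\<And>f. f \<in> F \<Longrightarrow> AE x in M. f x = series (coef f) x"
begin

text \<open>The restriction to \<open>F\<close> is there because points of \<open>linf F\<close> are extensional functions.\<close>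

definition path :: "(nat \<Rightarrow> real) \<Rightarrow> ('a \<Rightarrow> real) \<Rightarrow> real" where
  "path w = restrict (\<lambda>f. ip (coef f) w) F"

lemma path_in_linf:
  assumes "summable (\<lambda>k. \<beta> k * \<bar>w k\<bar>)" shows "path w \<in> mspace (linf F)"
proof -
  let ?B = "\<Sum>k. \<beta> k * \<bar>w k\<bar>"
  have "dist (ip (coef f) w) (ip (coef g) w) \<le> 2 * ?B" if "f \<in> F" "g \<in> F" for f g
    using summable_ip(2)[OF coef_box[OF that(1)] assms] summable_ip(2)[OF coef_box[OF that(2)] assms]
    by (simp add: dist_real_def)
  then have "Met_TC.mbounded (path w ` F)"
    unfolding Met_TC.mbounded_alt by (auto simp: path_def)
  then show ?thesis by (simp add: linf_def Met_TC.fspace_def path_def)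
qed

lemma mdist_path:
  assumes "summable (\<lambda>k. \<beta> k * \<bar>w k\<bar>)" "summable (\<lambda>k. \<beta> k * \<bar>v k\<bar>)"
  shows "mdist (linf F) (path w) (path v) \<le> (\<Sum>k. \<beta> k * \<bar>w k - v k\<bar>)"
  using path_in_linf[OF assms(1)] path_in_linf[OF assms(2)] unfolding linf_def
  by (subst funspace_mdist_le[OF _ _ F_ne])
     (auto simp: path_def dist_real_def intro!: ip_diff_right[OF coef_box \<beta>_nonneg assms])

lemma sd_dist_series:
  assumes "f \<in> F" "g \<in> F" shows "sd_dist M f g = sqrt (V (\<lambda>k. coef f k - coef g k))"
proof -
  note [measurable] = F_meas[OF assms(1)] F_meas[OF assms(2)]
  have "AE x in M. f x - g x = series (\<lambda>k. coef f k - coef g k) x"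
    using repr[OF assms(1)] repr[OF assms(2)]
    by eventually_elim (simp add: series_diff[OF coef_box[OF assms(1)] coef_box[OF assms(2)]])
  then have "variance (\<lambda>x. f x - g x) = variance (series (\<lambda>k. coef f k - coef g k))"
    by (intro variance_cong_AE prob_space_axioms) measurable
  then show ?thesis by (simp add: sd_dist_def V_def)
qed

lemma cov_series:
  assumes "f \<in> F" "g \<in> F"
  shows "cov M f g = (V (\<lambda>k. coef f k + coef g k) - V (coef f) - V (coef g)) / 2"
proof -
  note [measurable] = F_meas[OF assms(1)] F_meas[OF assms(2)]
  note box = coef_box[OF assms(1)] coef_box[OF assms(2)]
  have E: "expectation f = expectation (series (coef f))" "expectation g = expectation (series (coef g))"
    using repr[OF assms(1)] repr[OF assms(2)] by (intro integral_cong_AE; measurable)+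
  have "cov M f g = cov M (series (coef f)) (series (coef g))"
    unfolding cov_def E using repr[OF assms(1)] repr[OF assms(2)] by (intro integral_cong_AE) (measurable, auto)
  also have "\<dots> = (variance (\<lambda>x. series (coef f) x + series (coef g) x) - V (coef f) - V (coef g)) / 2"
    unfolding V_def using box by (intro cov_polarization prob_space_axioms bdd_series[OF box_one])
  also have "(\<lambda>x. series (coef f) x + series (coef g) x) = series (\<lambda>k. coef f k + coef g k)"
    unfolding series_def using series_summable_bounded(1)[OF box_one[OF box(1)]] series_summable_bounded(1)[OF box_one[OF box(2)]]
    by (simp add: ip_add)
  finally show ?thesis by (simp add: V_def)
qed

end

text \<open>The weights \<open>\<gamma>\<close> are larger than \<open>\<beta>\<close> by a factor that tends to infinity, at the rate recorded by
\<open>\<epsilon>\<close>. Summability of \<open>W\<close> against \<open>\<gamma>\<close> puts \<open>W\<close> into sets that are compact for the distance with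
weights \<open>\<beta>\<close>, which in turn bounds the uniform distance of paths.\<close>

locale bridge = class_expansion M \<phi> \<beta> F coef for M :: "'a measure" and \<phi> \<beta> F coef +
  fixes N :: "'w measure" and W :: "'w \<Rightarrow> nat \<Rightarrow> real" and \<gamma> \<epsilon> :: "nat \<Rightarrow> real"
  assumes N: "prob_space N" and W: "gauss_coords N M \<phi> W" and reg: "\<And>\<omega>. regular \<gamma> (W \<omega>)"
    and \<gamma>_ge: "\<And>k. \<beta> k \<le> \<gamma> k" and \<epsilon>: "\<And>n k. n \<le> k \<Longrightarrow> \<beta> k \<le> \<epsilon> n * \<gamma> k" "\<epsilon> \<longlonglongrightarrow> 0"
begin

lemma \<gamma>_pos: "0 < \<gamma> k" using \<gamma>_ge[of k] pos_\<beta>[of k] by simp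

lemma \<epsilon>_pos: "0 < \<epsilon> n"
proof -
  have "0 < \<epsilon> n * \<gamma> n" using \<epsilon>(1)[of n n] pos_\<beta>[of n] by simp
  then show ?thesis using \<gamma>_pos[of n] by (simp add: zero_less_mult_iff)
qed

lemma summable_\<gamma>_\<beta>: "summable (\<lambda>k. \<gamma> k * \<bar>w k\<bar>) \<Longrightarrow> summable (\<lambda>k. \<beta> k * \<bar>w k\<bar>)"
  by (rule summable_comparison_test) (use \<gamma>_ge \<beta>_nonneg in \<open>auto simp: abs_mult intro!: mult_right_mono exI[of _ 0]\<close>)

lemma W_summable: "summable (\<lambda>k. \<gamma> k * \<bar>W \<omega> k\<bar>)" "summable (\<lambda>k. \<beta> k * \<bar>W \<omega> k\<bar>)"
  using reg[of \<omega>] by (auto simp: regular_def intro: summable_\<gamma>_\<beta>)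

lemma W_meas: "(\<lambda>\<omega>. W \<omega> k) \<in> borel_measurable N" by (rule gauss_coords_measurable[OF W])

text \<open>Within a ball for the weights \<open>\<gamma>\<close>, the tail of the \<open>\<beta>\<close>-weighted distance from index \<open>n\<close> on is at most
\<open>\<epsilon> n * (2 * R)\<close>. Hence coordinatewise convergence implies convergence in this distance.\<close>

lemma dist_continuous:
  assumes w: "w \<in> sum_ball \<gamma> R"
  shows "continuous_on (sum_ball \<gamma> R) (\<lambda>v. \<Sum>k. \<beta> k * \<bar>v k - w k\<bar>)"
proof (rule uniform_limit_theorem)
  have \<gamma>0: "0 \<le> \<gamma> k" for k using \<gamma>_pos[of k] by simp
  show "\<forall>\<^sub>F n in sequentially. continuous_on (sum_ball \<gamma> R) (\<lambda>v. \<Sum>k<n. \<beta> k * \<bar>v k - w k\<bar>)"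
    by (intro always_eventually allI continuous_on_sum continuous_on_mult continuous_on_rabs continuous_on_diff
        continuous_on_const continuous_on_coordinate)
  show "uniform_limit (sum_ball \<gamma> R) (\<lambda>n v. \<Sum>k<n. \<beta> k * \<bar>v k - w k\<bar>) (\<lambda>v. \<Sum>k. \<beta> k * \<bar>v k - w k\<bar>) sequentially"
    unfolding uniform_limit_iff
  proof (intro allI impI)
    fix e :: real assume e: "e > 0"
    have "(\<lambda>n. \<epsilon> n * (2 * R)) \<longlonglongrightarrow> 0 * (2 * R)" by (intro tendsto_intros \<epsilon>(2))
    then have "\<forall>\<^sub>F n in sequentially. \<epsilon> n * (2 * R) < e" using e by (simp add: order_tendsto_iff)
    then show "\<forall>\<^sub>F n in sequentially. \<forall>v\<in>sum_ball \<gamma> R. dist (\<Sum>k<n. \<beta> k * \<bar>v k - w k\<bar>) (\<Sum>k. \<beta> k * \<bar>v k - w k\<bar>) < e"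
    proof eventually_elim
      case (elim n)
      show ?case
      proof
        fix v assume v: "v \<in> sum_ball \<gamma> R"
        note sv = sum_ball_summable[OF v \<gamma>0] and sw = sum_ball_summable[OF w \<gamma>0]
        have sb: "summable (\<lambda>k. \<beta> k * \<bar>v k - w k\<bar>)"
          by (rule summable_weighted_diff[OF \<beta>_nonneg summable_\<gamma>_\<beta>[OF sv(1)] summable_\<gamma>_\<beta>[OF sw(1)]])
        have ss: "summable (\<lambda>k. \<gamma> k * \<bar>v k\<bar> + \<gamma> k * \<bar>w k\<bar>)" by (rule summable_add[OF sv(1) sw(1)])
        have le: "\<beta> (k + n) * \<bar>v (k + n) - w (k + n)\<bar> \<le> \<epsilon> n * (\<gamma> (k + n) * \<bar>v (k + n)\<bar> + \<gamma> (k + n) * \<bar>w (k + n)\<bar>)" for k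
        proof -
          have "\<beta> (k + n) * \<bar>v (k + n) - w (k + n)\<bar> \<le> (\<epsilon> n * \<gamma> (k + n)) * (\<bar>v (k + n)\<bar> + \<bar>w (k + n)\<bar>)"
            using \<epsilon>(1)[of n "k + n"] \<epsilon>_pos[of n] \<gamma>0[of "k + n"] by (intro mult_mono) auto
          then show ?thesis by (simp add: algebra_simps)
        qed
        have "(\<Sum>k. \<beta> k * \<bar>v k - w k\<bar>) - (\<Sum>k<n. \<beta> k * \<bar>v k - w k\<bar>) = (\<Sum>k. \<beta> (k + n) * \<bar>v (k + n) - w (k + n)\<bar>)"
          using suminf_split_initial_segment[OF sb, of n] by simp
        also have "\<dots> \<le> (\<Sum>k. \<epsilon> n * (\<gamma> (k + n) * \<bar>v (k + n)\<bar> + \<gamma> (k + n) * \<bar>w (k + n)\<bar>))"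
          by (intro suminf_le le summable_mult) (use sb ss in \<open>simp_all add: summable_iff_shift[of "\<lambda>k. \<beta> k * \<bar>v k - w k\<bar>" n] summable_iff_shift[of "\<lambda>k. \<gamma> k * \<bar>v k\<bar> + \<gamma> k * \<bar>w k\<bar>" n]\<close>)
        also have "\<dots> = \<epsilon> n * (\<Sum>k. \<gamma> (k + n) * \<bar>v (k + n)\<bar> + \<gamma> (k + n) * \<bar>w (k + n)\<bar>)"
          by (rule suminf_mult) (use ss in \<open>simp add: summable_iff_shift[of "\<lambda>k. \<gamma> k * \<bar>v k\<bar> + \<gamma> k * \<bar>w k\<bar>" n]\<close>)
        also have "\<dots> \<le> \<epsilon> n * (2 * R)"
        proof (intro mult_left_mono)
          have "(\<Sum>k. \<gamma> (k + n) * \<bar>v (k + n)\<bar> + \<gamma> (k + n) * \<bar>w (k + n)\<bar>) \<le> (\<Sum>k. \<gamma> k * \<bar>v k\<bar> + \<gamma> k * \<bar>w k\<bar>)"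
            using suminf_split_initial_segment[OF ss, of n] \<gamma>0 by (simp add: sum_nonneg)
          also have "\<dots> = (\<Sum>k. \<gamma> k * \<bar>v k\<bar>) + (\<Sum>k. \<gamma> k * \<bar>w k\<bar>)" using sv sw by (simp add: suminf_add)
          finally show "(\<Sum>k. \<gamma> (k + n) * \<bar>v (k + n)\<bar> + \<gamma> (k + n) * \<bar>w (k + n)\<bar>) \<le> 2 * R" using sv(2) sw(2) by simp
        qed (use \<epsilon>_pos[of n] in simp)
        finally have "(\<Sum>k. \<beta> k * \<bar>v k - w k\<bar>) - (\<Sum>k<n. \<beta> k * \<bar>v k - w k\<bar>) < e" using elim by simp
        moreover have "(\<Sum>k<n. \<beta> k * \<bar>v k - w k\<bar>) \<le> (\<Sum>k. \<beta> k * \<bar>v k - w k\<bar>)"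
          by (intro sum_le_suminf sb) (auto simp: \<beta>_nonneg)
        ultimately show "dist (\<Sum>k<n. \<beta> k * \<bar>v k - w k\<bar>) (\<Sum>k. \<beta> k * \<bar>v k - w k\<bar>) < e"
          by (simp add: dist_real_def)
      qed
    qed
  qed
qed simp

lemma path_continuous: "continuous_map (top_of_set (sum_ball \<gamma> R)) (mtopology_of (linf F)) path"
proof -
  interpret L: Metric_space "mspace (linf F)" "mdist (linf F)" by (rule Metric_space_mspace_mdist)
  have \<gamma>0: "0 \<le> \<gamma> k" for k using \<gamma>_pos[of k] by simp
  have s: "summable (\<lambda>k. \<beta> k * \<bar>w k\<bar>)" if "w \<in> sum_ball \<gamma> R" for w
    by (rule summable_\<gamma>_\<beta>[OF sum_ball_summable(1)[OF that \<gamma>0]])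
  show ?thesis
    unfolding mtopology_of_def L.continuous_map_to_metric
  proof (intro ballI allI impI)
    fix w and e :: real assume "w \<in> topspace (top_of_set (sum_ball \<gamma> R))" and e: "e > 0"
    then have w: "w \<in> sum_ball \<gamma> R" by simp
    let ?d = "\<lambda>v. \<Sum>k. \<beta> k * \<bar>v k - w k\<bar>"
    let ?U = "sum_ball \<gamma> R \<inter> ?d -` {..<e}"
    have "openin (top_of_set (sum_ball \<gamma> R)) ?U"
      by (rule continuous_openin_preimage_gen[OF dist_continuous[OF w]]) simp
    moreover have "w \<in> ?U" using w e by simp
    moreover have "path v \<in> L.mball (path w) e" if "v \<in> ?U" for v
      using that mdist_path[OF s s, of v w] w path_in_linf[OF s] by (auto simp: L.commute[of "path w"])
    ultimately show "\<exists>U. openin (top_of_set (sum_ball \<gamma> R)) U \<and> w \<in> U \<and> (\<forall>y\<in>U. path y \<in> L.mball (path w) e)"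
      by blast
  qed
qed

lemma W_in_ball: "\<exists>n::nat. W \<omega> \<in> sum_ball \<gamma> (real n)"
proof -
  obtain n :: nat where "(\<Sum>k. \<gamma> k * \<bar>W \<omega> k\<bar>) \<le> real n" using real_arch_simple by blast
  then have "W \<omega> \<in> sum_ball \<gamma> (real n)"
    using W_summable(1) \<gamma>_pos by (intro sum_ballI) (auto intro: less_imp_le)
  then show ?thesis ..
qed

lemma W_borel: "W \<in> measurable N borel"
  using W_meas by (rule measurable_coordinatewise_then_product)

text \<open>Measurability of the coordinates alone does not suffice, since \<open>linf F\<close> need not be separable. But
the sequence always lies in one of countably many compact balls, and \<open>path\<close> is continuous on each.\<close>

lemma path_measurable: "(\<lambda>\<omega>. path (W \<omega>)) \<in> measurable N (borel_of_metric (linf F))"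
  unfolding borel_of_metric_def
proof (rule measurable_measure_of)
  interpret L: Metric_space "mspace (linf F)" "mdist (linf F)" by (rule Metric_space_mspace_mdist)
  show "{U. openin (mtopology_of (linf F)) U} \<subseteq> Pow (mspace (linf F))"
    using openin_subset by (fastforce simp: mtopology_of_def)
  show "(\<lambda>\<omega>. path (W \<omega>)) \<in> space N \<rightarrow> mspace (linf F)" using path_in_linf[OF W_summable(2)] by auto
  fix U assume "U \<in> {U. openin (mtopology_of (linf F)) U}"
  then have U: "openin (mtopology_of (linf F)) U" by simp
  have B: "{w \<in> sum_ball \<gamma> (real n). path w \<in> U} \<in> sets borel" for n
  proof -
    have "openin (top_of_set (sum_ball \<gamma> (real n))) {w \<in> topspace (top_of_set (sum_ball \<gamma> (real n))). path w \<in> U}"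
      by (rule openin_continuous_map_preimage[OF path_continuous U])
    then obtain T where "open T" "{w \<in> sum_ball \<gamma> (real n). path w \<in> U} = sum_ball \<gamma> (real n) \<inter> T"
      by (auto simp: openin_open)
    moreover have "closed (sum_ball \<gamma> (real n))" by (intro compact_imp_closed compact_sum_ball \<gamma>_pos)
    ultimately show ?thesis by simp
  qed
  have "(\<lambda>\<omega>. path (W \<omega>)) -` U \<inter> space N = (\<Union>n. W -` {w \<in> sum_ball \<gamma> (real n). path w \<in> U} \<inter> space N)"
    using W_in_ball by auto
  also have "\<dots> \<in> sets N" by (intro sets.countable_UN image_subsetI measurable_sets[OF W_borel B])
  finally show "(\<lambda>\<omega>. path (W \<omega>)) -` U \<inter> space N \<in> sets N" .
qed

lemma path_tight:
  assumes e: "e > 0"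
  shows "\<exists>K. compactin (mtopology_of (linf F)) K \<and> 1 - e \<le> measure N {\<omega> \<in> space N. path (W \<omega>) \<in> K}"
proof -
  interpret N: prob_space N by (rule N)
  interpret L: Metric_space "mspace (linf F)" "mdist (linf F)" by (rule Metric_space_mspace_mdist)
  define A where "A n = W -` sum_ball \<gamma> (real n) \<inter> space N" for n
  have cl: "sum_ball \<gamma> (real n) \<in> sets borel" for n
    using compact_imp_closed[OF compact_sum_ball[OF \<gamma>_pos]] by simp
  have A: "A n \<in> sets N" for n unfolding A_def by (rule measurable_sets[OF W_borel cl])
  have "sum_ball \<gamma> (real m) \<subseteq> sum_ball \<gamma> (real n)" if "m \<le> n" for m n
    using that unfolding sum_ball_def by (fastforce intro: order_trans[of _ "real m" "real n"])
  then have "incseq A" unfolding incseq_def A_def by blast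
  then have "(\<lambda>n. N.prob (A n)) \<longlonglongrightarrow> N.prob (\<Union>n. A n)"
    using A by (intro N.finite_Lim_measure_incseq) auto
  also have "(\<Union>n. A n) = space N" using W_in_ball by (auto simp: A_def)
  finally have "(\<lambda>n. N.prob (A n)) \<longlonglongrightarrow> 1" by (simp add: N.prob_space)
  then have "\<forall>\<^sub>F n in sequentially. 1 - e < N.prob (A n)" using e by (simp add: order_tendsto_iff)
  then obtain n where n: "1 - e < N.prob (A n)" by (auto simp: eventually_sequentially)
  define K where "K = path ` sum_ball \<gamma> (real n)"
  have K: "compactin (mtopology_of (linf F)) K"
    unfolding K_def
    by (rule image_compactin[OF _ path_continuous[of "real n"]]) (simp add: compactin_subtopology compact_sum_ball[OF \<gamma>_pos])
  have "closedin (mtopology_of (linf F)) K"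
    using K unfolding mtopology_of_def by (intro compactin_imp_closedin L.Hausdorff_space_mtopology)
  then have "openin (mtopology_of (linf F)) (mspace (linf F) - K)" by (auto simp: closedin_def)
  then have "mspace (linf F) - K \<in> sets (borel_of_metric (linf F))"
    unfolding borel_of_metric_def using openin_subset[of "mtopology_of (linf F)"]
    by (subst sets_measure_of) (auto simp: mtopology_of_def)
  from measurable_sets[OF path_measurable this]
  have "space N - ((\<lambda>\<omega>. path (W \<omega>)) -` (mspace (linf F) - K) \<inter> space N) \<in> sets N" by (rule sets.compl_sets)
  also have "space N - ((\<lambda>\<omega>. path (W \<omega>)) -` (mspace (linf F) - K) \<inter> space N) = {\<omega> \<in> space N. path (W \<omega>) \<in> K}"
    using path_in_linf[OF W_summable(2)] by auto
  finally have "N.prob (A n) \<le> N.prob {\<omega> \<in> space N. path (W \<omega>) \<in> K}"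
    by (intro N.finite_measure_mono) (auto simp: A_def K_def)
  then show ?thesis using K n by (intro exI[of _ K]) auto
qed

lemma gauss_W: "b \<in> box_seq (\<lambda>k. c * \<beta> k) \<Longrightarrow> has_gauss N (\<lambda>\<omega>. ip b (W \<omega>)) (V b)"
  using gauss_ip[OF N W] W_summable(2) by auto

text \<open>A sequence of pairs with standard deviation distances tending to 0 and increments at least \<open>e\<close> would
have, by compactness of the box, a limiting pair at distance zero with different pairings, which
contradicts regularity.\<close>

lemma path_uniformly_continuous:
  assumes e: "e > 0"
  shows "\<exists>\<delta>>0. \<forall>f\<in>F. \<forall>g\<in>F. sd_dist M f g < \<delta> \<longrightarrow> \<bar>path (W \<omega>) f - path (W \<omega>) g\<bar> < e"
proof (rule ccontr)
  assume "\<not> ?thesis"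
  then have "\<exists>f\<in>F. \<exists>g\<in>F. sd_dist M f g < inverse (real (Suc n)) \<and> \<bar>path (W \<omega>) f - path (W \<omega>) g\<bar> \<ge> e" for n
    by (meson not_le inverse_positive_iff_positive of_nat_0_less_iff zero_less_Suc)
  then obtain f g where fg: "\<And>n. f n \<in> F" "\<And>n. g n \<in> F" "\<And>n. sd_dist M (f n) (g n) < inverse (real (Suc n))"
    "\<And>n. \<bar>path (W \<omega>) (f n) - path (W \<omega>) (g n)\<bar> \<ge> e" by metis
  let ?b = "\<lambda>n. coef (f n)" and ?c = "\<lambda>n. coef (g n)"
  have "seq_compact (box_seq \<beta> \<times> box_seq \<beta>)"
    unfolding compact_eq_seq_compact_metric[symmetric] by (intro compact_Times compact_box_seq)
  moreover have "\<forall>n. (?b n, ?c n) \<in> box_seq \<beta> \<times> box_seq \<beta>" using fg coef_box by simp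
  ultimately obtain l r where l: "l \<in> box_seq \<beta> \<times> box_seq \<beta>" and r: "strict_mono r"
    and lim: "((\<lambda>n. (?b n, ?c n)) \<circ> r) \<longlonglongrightarrow> l"
    by (rule seq_compactE)
  obtain b c where bc: "l = (b, c)" by force
  have b: "b \<in> box_seq \<beta>" and c: "c \<in> box_seq \<beta>" using l bc by auto
  have lb: "(\<lambda>j. ?b (r j)) \<longlonglongrightarrow> b" and lc: "(\<lambda>j. ?c (r j)) \<longlonglongrightarrow> c"
    using tendsto_fst[OF lim] tendsto_snd[OF lim] by (auto simp: bc o_def)
  have "(\<lambda>j. V (\<lambda>k. ?b (r j) k - ?c (r j) k)) \<longlonglongrightarrow> V (\<lambda>k. b k - c k)"
    by (rule V_tendsto[of _ 2])
       (auto intro!: box_sub coef_box fg b c tendsto_coordinatewise tendsto_diff coordinate_tendsto[OF lb] coordinate_tendsto[OF lc])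
  moreover have "(\<lambda>j. V (\<lambda>k. ?b (r j) k - ?c (r j) k)) \<longlonglongrightarrow> 0"
  proof (rule tendsto_sandwich[OF _ _ tendsto_const])
    have "(\<lambda>j. (inverse (real (Suc j)))\<^sup>2) \<longlonglongrightarrow> 0\<^sup>2" by (intro tendsto_power LIMSEQ_inverse_real_of_nat)
    then show "(\<lambda>j. (inverse (real (Suc j)))\<^sup>2) \<longlonglongrightarrow> 0" by simp
    show "\<forall>\<^sub>F j in sequentially. V (\<lambda>k. ?b (r j) k - ?c (r j) k) \<le> (inverse (real (Suc j)))\<^sup>2"
    proof (intro always_eventually allI)
      fix j
      let ?v = "V (\<lambda>k. ?b (r j) k - ?c (r j) k)"
      have "sqrt ?v < inverse (real (Suc (r j)))" using fg(3)[of "r j"] sd_dist_series fg(1,2) by simp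
      also have "\<dots> \<le> inverse (real (Suc j))" using seq_suble[OF r, of j] by (simp add: le_imp_inverse_le)
      finally have "(sqrt ?v)\<^sup>2 \<le> (inverse (real (Suc j)))\<^sup>2" by (intro power_mono) (auto simp: V_nonneg)
      then show "?v \<le> (inverse (real (Suc j)))\<^sup>2" by (simp add: V_nonneg)
    qed
  qed (simp add: V_nonneg)
  ultimately have "V (\<lambda>k. b k - c k) = 0" using LIMSEQ_unique by blast
  then have eq: "ip b (W \<omega>) = ip c (W \<omega>)" using reg[of \<omega>] b c by (auto simp: regular_def)
  have cont: "continuous_on (box_seq \<beta>) (\<lambda>b. ip b (W \<omega>))"
    by (rule continuous_on_ip_left[OF W_summable(2)])
  have "(\<lambda>j. \<bar>ip (?b (r j)) (W \<omega>) - ip (?c (r j)) (W \<omega>)\<bar>) \<longlonglongrightarrow> \<bar>ip b (W \<omega>) - ip c (W \<omega>)\<bar>"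
    using coef_box fg(1,2)
    by (intro tendsto_intros continuous_on_tendsto_compose[OF cont lb b] continuous_on_tendsto_compose[OF cont lc c]) auto
  then have "e \<le> \<bar>ip b (W \<omega>) - ip c (W \<omega>)\<bar>"
    by (rule LIMSEQ_le_const) (use fg in \<open>auto simp: path_def\<close>)
  then show False using eq e by simp
qed

text \<open>A linear combination of finitely many values of a path is the pairing of \<open>W\<close> with the same
combination of coefficient sequences, hence Gaussian by \<open>gauss_ip\<close>.\<close>

theorem bridge_path: "tight_brownian_bridge N M F (\<lambda>\<omega>. path (W \<omega>))"
  unfolding tight_brownian_bridge_def
proof (intro conjI allI impI ballI)
  interpret N: prob_space N by (rule N)
  show "prob_space N" by (rule N)
  show "(\<lambda>\<omega>. path (W \<omega>)) \<in> measurable N (borel_of_metric (linf F))" by (rule path_measurable)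
  show "\<exists>K. compactin (mtopology_of (linf F)) K \<and> 1 - e \<le> N.prob {\<omega> \<in> space N. path (W \<omega>) \<in> K}" if "e > 0" for e
    by (rule path_tight[OF that])
  show "\<exists>\<delta>>0. \<forall>f\<in>F. \<forall>g\<in>F. sd_dist M f g < \<delta> \<longrightarrow> \<bar>path (W \<omega>) f - path (W \<omega>) g\<bar> < e" if "e > 0" for \<omega> e
    by (rule path_uniformly_continuous[OF that])
  have gW: "has_gauss N (\<lambda>\<omega>. path (W \<omega>) f) (V (coef f))" if "f \<in> F" for f
    using gauss_W[OF box_one[OF coef_box[OF that]]] that by (simp add: path_def)
  show "N.expectation (\<lambda>\<omega>. path (W \<omega>) f) = 0" if "f \<in> F" for f
    by (rule has_gauss_moments(2)[OF N gW[OF that]])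
  show "cov N (\<lambda>\<omega>. path (W \<omega>) f) (\<lambda>\<omega>. path (W \<omega>) g) = cov M f g" if f: "f \<in> F" and g: "g \<in> F" for f g
  proof -
    have s: "summable (\<lambda>k. coef f k * W \<omega> k)" if "f \<in> F" for f \<omega>
      by (rule summable_ip(1)[OF coef_box[OF that] W_summable(2)])
    have "(\<lambda>k. coef f k + coef g k) \<in> box_seq (\<lambda>k. 2 * \<beta> k)"
      using coef_box[OF f] coef_box[OF g] unfolding box_seq_def by (smt (verit) mem_Collect_eq)
    from gauss_W[OF this]
    have "has_gauss N (\<lambda>\<omega>. path (W \<omega>) f + path (W \<omega>) g) (V (\<lambda>k. coef f k + coef g k))"
      using f g by (simp add: path_def ip_add[OF s[OF f] s[OF g]])
    note m = has_gauss_moments[OF N gW[OF f]] has_gauss_moments[OF N gW[OF g]] has_gauss_moments[OF N this]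
    let ?a = "\<lambda>\<omega>. path (W \<omega>) f" and ?b = "\<lambda>\<omega>. path (W \<omega>) g"
    have "cov N ?a ?b = (LINT \<omega>|N. ((?a \<omega> + ?b \<omega>)\<^sup>2 - (?a \<omega>)\<^sup>2 - (?b \<omega>)\<^sup>2) / 2)"
      unfolding cov_def m(2) m(6) by (intro Bochner_Integration.integral_cong refl) (simp add: power2_eq_square algebra_simps)
    also have "\<dots> = (V (\<lambda>k. coef f k + coef g k) - V (coef f) - V (coef g)) / 2"
      using m by simp
    finally show ?thesis using cov_series[OF f g] by simp
  qed
  show "gaussian_process N F (\<lambda>\<omega>. path (W \<omega>))"
    unfolding gaussian_process_def
  proof (intro conjI ballI allI impI)
    show "(\<lambda>\<omega>. path (W \<omega>) f) \<in> borel_measurable N" if "f \<in> F" for f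
      using gW[OF that] by (simp add: has_gauss_def)
    fix S and a :: "('a \<Rightarrow> real) \<Rightarrow> real" assume S: "finite S \<and> S \<subseteq> F"
    let ?b = "\<lambda>k. \<Sum>f\<in>S. a f * coef f k"
    have "\<bar>?b k\<bar> \<le> (\<Sum>f\<in>S. \<bar>a f\<bar>) * \<beta> k" for k
    proof -
      have "\<bar>?b k\<bar> \<le> (\<Sum>f\<in>S. \<bar>a f * coef f k\<bar>)" by (rule sum_abs)
      also have "\<dots> \<le> (\<Sum>f\<in>S. \<bar>a f\<bar> * \<beta> k)"
        using S coef_box by (intro sum_mono) (auto simp: abs_mult box_seq_def intro!: mult_left_mono)
      finally show ?thesis by (simp add: sum_distrib_right)
    qed
    then have "?b \<in> box_seq (\<lambda>k. (\<Sum>f\<in>S. \<bar>a f\<bar>) * \<beta> k)" by (simp add: box_seq_def)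
    from has_gauss_law[OF N gauss_W[OF this]]
    have law: "distr N borel (\<lambda>\<omega>. ip ?b (W \<omega>)) = normal_law 0 (sqrt (V ?b))" .
    have "ip ?b (W \<omega>) = (\<Sum>f\<in>S. a f * path (W \<omega>) f)" for \<omega>
    proof -
      have s: "summable (\<lambda>k. coef f k * W \<omega> k)" if "f \<in> S" for f
        using S that by (intro summable_ip(1)[OF coef_box W_summable(2)]) auto
      have "ip ?b (W \<omega>) = (\<Sum>k. \<Sum>f\<in>S. a f * (coef f k * W \<omega> k))"
        by (simp add: ip_def sum_distrib_right mult.assoc)
      also have "\<dots> = (\<Sum>f\<in>S. \<Sum>k. a f * (coef f k * W \<omega> k))"
        by (rule suminf_sum) (intro summable_mult s)
      also have "\<dots> = (\<Sum>f\<in>S. a f * path (W \<omega>) f)"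
        using S s by (intro sum.cong refl) (auto simp: path_def ip_def suminf_mult)
      finally show ?thesis .
    qed
    then show "\<exists>m s. 0 \<le> s \<and> distr N borel (\<lambda>\<omega>. \<Sum>f\<in>S. a f * path (W \<omega>) f) = normal_law m s"
      using law V_nonneg[of ?b] by (intro exI[of _ 0] exI[of _ "sqrt (V ?b)"]) simp
  qed
qed

end

section \<open>Coordinates of the empirical process\<close>

lemma (in prob_space) iid_second_moment:
  fixes \<xi> :: "nat \<Rightarrow> 'a \<Rightarrow> real"
  assumes ind: "indep_vars (\<lambda>_. borel) \<xi> UNIV" and bd: "\<And>i. bdd_meas M (\<xi> i)"
    and mean: "\<And>i. expectation (\<xi> i) = 0" and sq: "\<And>i. expectation (\<lambda>\<omega>. (\<xi> i \<omega>)\<^sup>2) \<le> C"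
  shows "bdd_meas M (\<lambda>\<omega>. \<Sum>i<n. \<xi> i \<omega>)" "expectation (\<lambda>\<omega>. (\<Sum>i<n. \<xi> i \<omega>)\<^sup>2) \<le> real n * C"
proof -
  note int = bdd_meas_integrable[OF prob_space_axioms]
  show bs: "bdd_meas M (\<lambda>\<omega>. \<Sum>i<n. \<xi> i \<omega>)" for n by (intro bdd_meas_sum bd)
  show "expectation (\<lambda>\<omega>. (\<Sum>i<n. \<xi> i \<omega>)\<^sup>2) \<le> real n * C"
  proof (induction n)
    case (Suc n)
    let ?S = "\<lambda>\<omega>. \<Sum>i<n. \<xi> i \<omega>"
    have "indep_vars (\<lambda>_. borel) \<xi> (insert n {..<n})" by (rule indep_vars_subset[OF ind]) auto
    from indep_vars_sum[OF _ _ this] have iv: "indep_var borel (\<xi> n) borel ?S" by simp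
    have zero: "expectation (\<lambda>\<omega>. \<xi> n \<omega> * ?S \<omega>) = 0"
      using indep_var_lebesgue_integral[OF iv int[OF bd] int[OF bs]] mean by simp
    have i: "integrable M (\<lambda>\<omega>. (\<xi> n \<omega>)\<^sup>2)" "integrable M (\<lambda>\<omega>. (?S \<omega>)\<^sup>2)" "integrable M (\<lambda>\<omega>. \<xi> n \<omega> * ?S \<omega>)"
      unfolding power2_eq_square by (intro int bdd_meas_mult bd bs)+
    have "expectation (\<lambda>\<omega>. (\<Sum>i<Suc n. \<xi> i \<omega>)\<^sup>2) =
        expectation (\<lambda>\<omega>. (?S \<omega>)\<^sup>2 + (\<xi> n \<omega>)\<^sup>2 + 2 * (\<xi> n \<omega> * ?S \<omega>))"
      by (intro Bochner_Integration.integral_cong refl) (simp add: power2_eq_square algebra_simps)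
    also have "\<dots> = expectation (\<lambda>\<omega>. (?S \<omega>)\<^sup>2) + expectation (\<lambda>\<omega>. (\<xi> n \<omega>)\<^sup>2)"
      using i zero by simp
    also have "\<dots> \<le> real n * C + C" using Suc sq[of n] by simp
    finally show ?case by (simp add: algebra_simps)
  qed simp
qed

definition normalized_sum :: "'a measure \<Rightarrow> (nat \<Rightarrow> 'a \<Rightarrow> real) \<Rightarrow> (nat \<Rightarrow> 'a) \<Rightarrow> nat \<Rightarrow> nat \<Rightarrow> real" where
  "normalized_sum M \<phi> x n k = (\<Sum>i<n. \<phi> k (x i) - (LINT y|M. \<phi> k y)) / sqrt (real n)"

context expansion begin

context
  fixes P :: "'w measure" and X :: "nat \<Rightarrow> 'w \<Rightarrow> 'a"
  assumes P: "prob_space P" and X: "prob_space.indep_vars P (\<lambda>_. M) X UNIV" and law: "\<And>i. distr P M (X i) = M"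
begin

lemma X_meas[measurable]: "X i \<in> measurable P M"
  using X P by (auto simp: prob_space.indep_vars_def)

lemma normalized_sum_measurable: "(\<lambda>\<omega>. normalized_sum M \<phi> (\<lambda>i. X i \<omega>) n k) \<in> borel_measurable P"
  unfolding normalized_sum_def by measurable

lemma distr_transfer:
  fixes g :: "'a \<Rightarrow> real"
  assumes [measurable]: "g \<in> borel_measurable M"
  shows "(LINT \<omega>|P. g (X i \<omega>)) = (LINT x|M. g x)" "integrable P (\<lambda>\<omega>. g (X i \<omega>)) \<longleftrightarrow> integrable M g"
    "distr P borel (\<lambda>\<omega>. g (X i \<omega>)) = distr M borel g"
proof -
  have "(LINT \<omega>|P. g (X i \<omega>)) = (LINT x|distr P M (X i). g x)"
    by (rule integral_distr[symmetric]) measurable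
  then show "(LINT \<omega>|P. g (X i \<omega>)) = (LINT x|M. g x)" by (simp only: law)
  have "integrable P (\<lambda>\<omega>. g (X i \<omega>)) \<longleftrightarrow> integrable (distr P M (X i)) g"
    by (rule integrable_distr_eq[symmetric]) measurable
  then show "integrable P (\<lambda>\<omega>. g (X i \<omega>)) \<longleftrightarrow> integrable M g" by (simp only: law)
  have "distr (distr P M (X i)) borel g = distr P borel (g \<circ> X i)"
    by (rule distr_distr) measurable
  then show "distr P borel (\<lambda>\<omega>. g (X i \<omega>)) = distr M borel g" by (simp only: law o_def)
qed

lemma normalized_sum_second_moment:
  "integrable P (\<lambda>\<omega>. (normalized_sum M \<phi> (\<lambda>i. X i \<omega>) n k)\<^sup>2)"
  "(LINT \<omega>|P. (normalized_sum M \<phi> (\<lambda>i. X i \<omega>) n k)\<^sup>2) \<le> 1"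
proof -
  interpret P: prob_space P by (rule P)
  define m where "m = (LINT y|M. \<phi> k y)"
  let ?\<xi> = "\<lambda>i \<omega>. \<phi> k (X i \<omega>) - m"
  note bm = bdd_\<phi>[of k]
  note i = bdd_meas_integrable[OF prob_space_axioms bm]
    bdd_meas_integrable[OF prob_space_axioms bdd_meas_mult[OF bm bm], folded power2_eq_square]
  have ind: "P.indep_vars (\<lambda>_. borel) ?\<xi> UNIV"
    by (rule P.indep_vars_compose2[OF X]) measurable
  have m1: "\<bar>m\<bar> \<le> 1" unfolding m_def by (rule abs_expectation_\<phi>)
  have bd: "bdd_meas P (?\<xi> j)" for j
  proof -
    have "\<bar>?\<xi> j \<omega>\<bar> \<le> 2" for \<omega> using bound_\<phi>[of k "X j \<omega>"] m1 by linarith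
    moreover have "?\<xi> j \<in> borel_measurable P" by measurable
    ultimately show ?thesis unfolding bdd_meas_def by (intro conjI exI[of _ 2] allI)
  qed
  have mean: "P.expectation (?\<xi> j) = 0" for j
    using distr_transfer(1)[of "\<lambda>x. \<phi> k x - m" j] i(1) by (simp add: prob_space m_def)
  have sq: "P.expectation (\<lambda>\<omega>. (?\<xi> j \<omega>)\<^sup>2) \<le> 1" for j
  proof -
    have "P.expectation (\<lambda>\<omega>. (?\<xi> j \<omega>)\<^sup>2) = variance (\<phi> k)"
      using distr_transfer(1)[of "\<lambda>x. (\<phi> k x - m)\<^sup>2" j] by (simp add: m_def)
    also have "\<dots> \<le> expectation (\<lambda>x. (\<phi> k x)\<^sup>2)" by (simp add: variance_eq[OF i])
    also have "\<dots> \<le> expectation (\<lambda>x. 1)"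
      using i(2) bound_\<phi> by (intro integral_mono) (auto simp: abs_square_le_1)
    finally show ?thesis by (simp add: prob_space)
  qed
  note sm = P.iid_second_moment[OF ind bd mean sq, of n]
  have eq: "(normalized_sum M \<phi> (\<lambda>i. X i \<omega>) n k)\<^sup>2 = (\<Sum>i<n. ?\<xi> i \<omega>)\<^sup>2 / real n" for \<omega>
    by (simp add: normalized_sum_def power_divide m_def)
  have "integrable P (\<lambda>\<omega>. (\<Sum>i<n. ?\<xi> i \<omega>)\<^sup>2)"
    unfolding power2_eq_square by (intro bdd_meas_integrable P bdd_meas_mult sm(1))
  then show "integrable P (\<lambda>\<omega>. (normalized_sum M \<phi> (\<lambda>i. X i \<omega>) n k)\<^sup>2)" unfolding eq by simp
  show "(LINT \<omega>|P. (normalized_sum M \<phi> (\<lambda>i. X i \<omega>) n k)\<^sup>2) \<le> 1"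
    unfolding eq using sm(2) by (cases "n = 0") (auto simp: field_simps)
qed

lemma normalized_sum_linear:
  "(\<Sum>k<K. t k * normalized_sum M \<phi> x n k) =
     (\<Sum>i<n. (\<Sum>k<K. t k * \<phi> k (x i)) - (LINT y|M. (\<Sum>k<K. t k * \<phi> k y))) / sqrt (real n)"
proof -
  note bm = bdd_\<phi>
  have E: "(LINT y|M. (\<Sum>k<K. t k * \<phi> k y)) = (\<Sum>k<K. t k * (LINT y|M. \<phi> k y))"
    using bdd_meas_integrable[OF prob_space_axioms bm] by simp
  have "(\<Sum>k<K. t k * normalized_sum M \<phi> x n k) =
      (\<Sum>k<K. \<Sum>i<n. t k * (\<phi> k (x i) - (LINT y|M. \<phi> k y))) / sqrt (real n)"
    unfolding normalized_sum_def by (simp add: sum_divide_distrib sum_distrib_left)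
  also have "(\<Sum>k<K. \<Sum>i<n. t k * (\<phi> k (x i) - (LINT y|M. \<phi> k y))) =
      (\<Sum>i<n. \<Sum>k<K. t k * (\<phi> k (x i) - (LINT y|M. \<phi> k y)))" by (rule sum.swap)
  finally show ?thesis unfolding E by (simp add: sum_subtractf right_diff_distrib)
qed

text \<open>A linear combination of the coordinates is a normalized sum of independent variables with the law of
\<open>\<Sum>k<K. t k * \<phi> k\<close>, to which the central limit theorem on the line applies. If their variance is 0,
they are almost surely equal to their mean and both sides are 1.\<close>

lemma normalized_sum_char:
  "(\<lambda>n. char (distr P borel (\<lambda>\<omega>. \<Sum>k<K. t k * normalized_sum M \<phi> (\<lambda>i. X i \<omega>) n k)) 1)
    \<longlonglongrightarrow> complex_of_real (exp (- variance (\<lambda>x. \<Sum>k<K. t k * \<phi> k x) / 2))"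
proof -
  interpret P: prob_space P by (rule P)
  define h where "h x = (\<Sum>k<K. t k * \<phi> k x)" for x
  have [measurable]: "h \<in> borel_measurable M" unfolding h_def by measurable
  have bm: "bdd_meas M h"
    unfolding h_def using bound_\<phi> meas_\<phi>
    by (intro bdd_meas_sum bdd_meas_mult bdd_meas_const) (auto simp: bdd_meas_def)
  note i = bdd_meas_integrable[OF prob_space_axioms bm]
    bdd_meas_integrable[OF prob_space_axioms bdd_meas_mult[OF bm bm], folded power2_eq_square]
  define m where "m = expectation h"
  define v where "v = variance h"
  have v0: "0 \<le> v" unfolding v_def by (rule variance_positive)
  let ?S = "\<lambda>n \<omega>. \<Sum>i<n. h (X i \<omega>) - m"
  have goal: "(\<lambda>n. char (distr P borel (\<lambda>\<omega>. ?S n \<omega> / sqrt (real n))) 1) \<longlonglongrightarrow> complex_of_real (exp (- v / 2))"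
  proof (cases "v = 0")
    case True
    have "AE x in M. (h x - m)\<^sup>2 = 0"
    proof -
      have "bdd_meas M (\<lambda>x. h x - m)" by (intro bdd_meas_diff bm bdd_meas_const)
      then have "integrable M (\<lambda>x. (h x - m)\<^sup>2)"
        unfolding power2_eq_square by (intro bdd_meas_integrable prob_space_axioms bdd_meas_mult)
      then show ?thesis
        using True unfolding v_def m_def by (subst (asm) integral_nonneg_eq_0_iff_AE) auto
    qed
    then have AE: "AE x in M. h x - m = 0" by simp
    have AEi: "AE \<omega> in P. h (X i \<omega>) - m = 0" for i
      by (rule AE_distrD[of "X i" P M "\<lambda>x. h x - m = 0", unfolded law, OF X_meas AE])
    have "AE \<omega> in P. \<forall>i. h (X i \<omega>) - m = 0" using AEi by (simp add: AE_all_countable)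
    then have "AE \<omega> in P. ?S n \<omega> / sqrt (real n) = 0" for n by eventually_elim simp
    then have "distr P borel (\<lambda>\<omega>. ?S n \<omega> / sqrt (real n)) = distr P borel (\<lambda>_. 0)" for n
      by (intro distr_cong_AE) (auto, measurable)
    then have "char (distr P borel (\<lambda>\<omega>. ?S n \<omega> / sqrt (real n))) 1 = 1" for n
      by (simp add: char_def integral_distr P.prob_space del: P.distr_const)
    then show ?thesis using True by simp
  next
    case False
    then have v: "v > 0" using v0 by simp
    have conv: "weak_conv_m (\<lambda>n. distr P borel (\<lambda>\<omega>. (\<Sum>i<n. h (X i \<omega>) - m) / sqrt (real n * (sqrt v)\<^sup>2))) std_normal_distribution"
    proof (rule P.central_limit_theorem)
      show "P.indep_vars (\<lambda>_. borel) (\<lambda>i \<omega>. h (X i \<omega>)) UNIV" by (rule P.indep_vars_compose2[OF X]) measurable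
      show "P.expectation (\<lambda>\<omega>. h (X n \<omega>)) = m" for n using distr_transfer(1)[of h n] by (simp add: m_def)
      show "sqrt v > 0" using v by simp
      show "integrable P (\<lambda>\<omega>. (h (X n \<omega>))\<^sup>2)" for n using distr_transfer(2)[of "\<lambda>x. (h x)\<^sup>2" n] i(2) by simp
      show "P.variance (\<lambda>\<omega>. h (X n \<omega>)) = (sqrt v)\<^sup>2" for n
        using distr_transfer(1)[of h n] distr_transfer(1)[of "\<lambda>x. (h x - m)\<^sup>2" n] v0 by (simp add: m_def v_def)
      show "distr P borel (\<lambda>\<omega>. h (X n \<omega>)) = distr M borel h" for n by (rule distr_transfer(3)) measurable
    qed
    have "(\<lambda>n. char (distr P borel (\<lambda>\<omega>. ?S n \<omega> / sqrt (real n * (sqrt v)\<^sup>2))) (sqrt v)) \<longlonglongrightarrow> char std_normal_distribution (sqrt v)"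
      by (rule levy_continuity1[OF _ real_dist_normal_dist conv]) (rule P.real_distribution_distr, measurable)
    moreover have "char (distr P borel (\<lambda>\<omega>. ?S n \<omega> / sqrt (real n * (sqrt v)\<^sup>2))) (sqrt v) =
        char (distr P borel (\<lambda>\<omega>. ?S n \<omega> / sqrt (real n))) 1" for n
    proof -
      have "(\<lambda>\<omega>. ?S n \<omega> / sqrt (real n)) = (\<lambda>\<omega>. sqrt v * (?S n \<omega> / sqrt (real n * (sqrt v)\<^sup>2)))"
        using v by (simp add: real_sqrt_mult)
      moreover have "char (distr P borel (\<lambda>\<omega>. sqrt v * (?S n \<omega> / sqrt (real n * (sqrt v)\<^sup>2)))) 1 =
          char (distr P borel (\<lambda>\<omega>. ?S n \<omega> / sqrt (real n * (sqrt v)\<^sup>2))) (sqrt v * 1)"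
        by (rule char_distr_scale) measurable
      ultimately show ?thesis by simp
    qed
    ultimately show ?thesis using v by (simp add: char_std_normal_distribution)
  qed
  show ?thesis using goal unfolding normalized_sum_linear h_def m_def v_def by simp
qed

end

end

section \<open>Nuclear expansion of smoothed Lipschitz functions\<close>

lemma flatten_series:
  fixes u :: "nat \<times> 'b \<Rightarrow> real" and A :: "nat \<Rightarrow> 'b set"
  assumes fin: "\<And>m. finite (A m)" and ne: "\<And>m. A m \<noteq> {}"
    and s: "summable (\<lambda>m. \<Sum>p\<in>A m. \<bar>u (m, p)\<bar>)" and e: "bij_betw e UNIV (Sigma UNIV A)"
  shows "summable (\<lambda>k::nat. \<bar>u (e k)\<bar>)" "(\<Sum>k. u (e k)) = (\<Sum>m. \<Sum>p\<in>A m. u (m, p))"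
proof -
  have abs: "(\<lambda>x. \<bar>u x\<bar>) summable_on Sigma UNIV A"
  proof (rule summable_on_SigmaI[where g = "\<lambda>m. \<Sum>p\<in>A m. \<bar>u (m, p)\<bar>"])
    show "((\<lambda>p. \<bar>u (m, p)\<bar>) has_sum (\<Sum>p\<in>A m. \<bar>u (m, p)\<bar>)) (A m)" for m by (rule has_sum_finite[OF fin])
    show "(\<lambda>m. \<Sum>p\<in>A m. \<bar>u (m, p)\<bar>) summable_on UNIV"
      using s by (subst summable_on_UNIV_nonneg_real_iff) (simp_all add: sum_nonneg)
  qed simp
  then have "(\<lambda>k. \<bar>u (e k)\<bar>) summable_on UNIV" by (subst summable_on_reindex_bij_betw[OF e])
  then show sk: "summable (\<lambda>k::nat. \<bar>u (e k)\<bar>)" by (simp add: summable_on_UNIV_nonneg_real_iff)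
  have sm: "u summable_on Sigma UNIV A"
    by (rule abs_summable_summable) (use abs in simp)
  have "infsum (\<lambda>k. u (e k)) UNIV = infsum u (Sigma UNIV A)" by (rule infsum_reindex_bij_betw[OF e])
  also have "\<dots> = infsum (\<lambda>m. infsum (\<lambda>p. u (m, p)) (A m)) UNIV" by (rule infsum_Sigma_banach[OF sm, symmetric])
  also have "\<dots> = infsum (\<lambda>m. \<Sum>p\<in>A m. u (m, p)) UNIV" by (simp add: fin)
  finally have eq: "infsum (\<lambda>k. u (e k)) UNIV = infsum (\<lambda>m. \<Sum>p\<in>A m. u (m, p)) UNIV" .
  have l: "infsum (\<lambda>k. u (e k)) UNIV = (\<Sum>k. u (e k))"
    by (rule infsumI[OF norm_summable_imp_has_sum[OF _ summable_sums[OF summable_rabs_cancel[OF sk]]]]) (use sk in simp)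
  have sm': "summable (\<lambda>m. \<bar>\<Sum>p\<in>A m. u (m, p)\<bar>)"
    by (rule summable_comparison_test[OF _ s]) (auto intro: sum_abs)
  have r: "infsum (\<lambda>m. \<Sum>p\<in>A m. u (m, p)) UNIV = (\<Sum>m. \<Sum>p\<in>A m. u (m, p))"
    by (rule infsumI[OF norm_summable_imp_has_sum[OF _ summable_sums[OF summable_rabs_cancel[OF sm']]]]) (use sm' in simp)
  show "(\<Sum>k. u (e k)) = (\<Sum>m. \<Sum>p\<in>A m. u (m, p))" using eq l r by simp
qed

text \<open>With \<open>r k\<close> the tail sum from \<open>k\<close> on, \<open>\<beta> k / sqrt (r k)\<close> is still summable, being at most
\<open>2 * (sqrt (r k) - sqrt (r (Suc k)))\<close>. Adding \<open>\<beta> k\<close> makes the new weights dominate the old ones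
also where \<open>r k > 1\<close>.\<close>

lemma slower_summable_weights:
  fixes \<beta> :: "nat \<Rightarrow> real"
  assumes pos: "\<And>k. 0 < \<beta> k" and s: "summable \<beta>"
  obtains \<gamma> \<epsilon> where "\<And>k. \<beta> k \<le> \<gamma> k" "summable \<gamma>" "\<And>n k. n \<le> k \<Longrightarrow> \<beta> k \<le> \<epsilon> n * \<gamma> k" "\<epsilon> \<longlonglongrightarrow> 0"
proof -
  define r where "r n = (\<Sum>k. \<beta> (k + n))" for n
  have sn: "summable (\<lambda>k. \<beta> (k + n))" for n using s by (simp add: summable_iff_shift)
  have rpos: "0 < r n" for n unfolding r_def by (rule suminf_pos[OF sn pos])
  have step: "r n = \<beta> n + r (Suc n)" for n
    using suminf_split_head[OF sn[of n]] by (simp add: r_def)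
  have dec: "r k \<le> r n" if "n \<le> k" for n k
  proof (rule decseqD[OF decseq_SucI that])
    show "r (Suc n) \<le> r n" for n using step[of n] pos[of n] by linarith
  qed
  have r0: "r \<longlonglongrightarrow> 0" unfolding r_def by (rule suminf_exist_split2[OF s])
  define \<gamma> where "\<gamma> k = \<beta> k + \<beta> k / sqrt (r k)" for k
  define \<epsilon> where "\<epsilon> n = sqrt (r n)" for n
  have ineq: "\<beta> k / sqrt (r k) \<le> 2 * (sqrt (r k) - sqrt (r (Suc k)))" for k
  proof -
    let ?a = "sqrt (r k)" and ?b = "sqrt (r (Suc k))"
    have b: "\<beta> k = ?a\<^sup>2 - ?b\<^sup>2" using step[of k] rpos[of k] rpos[of "Suc k"] by simp
    have "0 < ?a" "0 \<le> ?b" "?b \<le> ?a" using rpos[of k] rpos[of "Suc k"] dec[of k "Suc k"] by simp_all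
    then have "(?a - ?b) * (?a + ?b) \<le> (?a - ?b) * (2 * ?a)" by (intro mult_left_mono) auto
    then have "?a\<^sup>2 - ?b\<^sup>2 \<le> 2 * (?a - ?b) * ?a" by (simp add: power2_eq_square algebra_simps)
    then show ?thesis unfolding b using \<open>0 < ?a\<close> by (simp add: pos_divide_le_eq)
  qed
  have "summable (\<lambda>k. \<beta> k / sqrt (r k))"
  proof (rule summableI_nonneg_bounded)
    show "0 \<le> \<beta> k / sqrt (r k)" for k using pos[of k] rpos[of k] by simp
    fix n
    have "(\<Sum>k<n. \<beta> k / sqrt (r k)) \<le> (\<Sum>k<n. 2 * (sqrt (r k) - sqrt (r (Suc k))))" by (intro sum_mono ineq)
    also have "\<dots> = 2 * (sqrt (r 0) - sqrt (r n))"
      using sum_lessThan_telescope'[of "\<lambda>k. sqrt (r k)" n] by (simp only: sum_distrib_left[symmetric])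
    also have "\<dots> \<le> 2 * sqrt (r 0)" using rpos[of n] by simp
    finally show "(\<Sum>k<n. \<beta> k / sqrt (r k)) \<le> 2 * sqrt (r 0)" .
  qed
  then have "summable \<gamma>" unfolding \<gamma>_def by (intro summable_add s)
  moreover have "\<beta> k \<le> \<gamma> k" for k using pos[of k] rpos[of k] by (simp add: \<gamma>_def)
  moreover have "\<beta> k \<le> \<epsilon> n * \<gamma> k" if "n \<le> k" for n k
  proof -
    have "\<beta> k = sqrt (r k) * (\<beta> k / sqrt (r k))" using rpos[of k] by simp
    also have "\<dots> \<le> sqrt (r n) * \<gamma> k"
      using dec[OF that] pos[of k] rpos[of k] rpos[of n] by (intro mult_mono) (auto simp: \<gamma>_def)
    finally show ?thesis by (simp add: \<epsilon>_def)
  qed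
  moreover have "\<epsilon> \<longlonglongrightarrow> 0" unfolding \<epsilon>_def using tendsto_real_sqrt[OF r0] by simp
  ultimately show ?thesis using that by blast
qed

locale smoothing =
  fixes \<kappa> :: "real ^ 'n \<Rightarrow> real" and \<sigma> :: real
  assumes kern: "smoothing_kernel \<kappa>" and \<sigma>: "\<sigma> > 0"
begin

abbreviation k where "k \<equiv> scaled_kernel \<kappa> \<sigma>"

lemma k_nonneg: "0 \<le> k x"
  using kern \<sigma> by (simp add: smoothing_kernel_def scaled_kernel_def)

lemma k_even: "k (- x) = k x"
  using kern by (simp add: smoothing_kernel_def scaled_kernel_def)

lemma k_zero: "norm x \<ge> \<sigma> \<Longrightarrow> k x = 0"
  using kern \<sigma> by (auto simp: smoothing_kernel_def not_less)

lemma k_continuous: "continuous_on S k"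
proof -
  have "continuous_on UNIV \<kappa>"
    using kern by (auto simp: smoothing_kernel_def smooth_def dest: spec[of _ 0])
  moreover have "continuous_on UNIV (\<lambda>x :: real ^ 'n. x /\<^sub>R \<sigma>)" by (intro continuous_intros)
  ultimately have "continuous_on UNIV (\<lambda>x. \<kappa> (x /\<^sub>R \<sigma>))"
    by (rule continuous_on_compose2) simp
  then have "continuous_on UNIV k"
    unfolding scaled_kernel_def[abs_def] divide_inverse by (intro continuous_on_mult_right)
  then show ?thesis by (rule continuous_on_subset) simp
qed

lemma k_measurable[measurable]: "k \<in> borel_measurable borel"
  by (rule borel_measurable_continuous_onI[OF k_continuous])

lemma k_integral: "integrable lborel k" "(LINT x|lborel. k x) = 1"
proof -
  have [measurable]: "\<kappa> \<in> borel_measurable borel"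
    using kern by (auto simp: smoothing_kernel_def)
  have \<kappa>: "has_bochner_integral lborel \<kappa> 1"
    using kern by (auto simp: smoothing_kernel_def has_bochner_integral_iff)
  have l: "lborel = density (distr lborel borel (\<lambda>x :: real ^ 'n. 0 + \<sigma> *\<^sub>R x)) (\<lambda>_. ennreal (\<bar>\<sigma>\<bar> ^ DIM(real ^ 'n)))"
    using \<sigma> by (intro lborel_affine) simp
  let ?D = "distr lborel borel (\<lambda>x :: real ^ 'n. 0 + \<sigma> *\<^sub>R x)"
  have *: "(\<sigma> ^ CARD('n)) * k (0 + \<sigma> *\<^sub>R x) = \<kappa> x" for x using \<sigma> by (simp add: scaled_kernel_def)
  have "integrable ?D (\<lambda>x. (\<sigma> ^ CARD('n)) * k x)"
    by (subst integrable_distr_eq) (use \<kappa> in \<open>simp_all only: * has_bochner_integral_iff, simp_all\<close>)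
  moreover have v: "(LINT x|?D. (\<sigma> ^ CARD('n)) * k x) = 1"
    by (subst integral_distr) (use \<kappa> in \<open>simp_all only: * has_bochner_integral_iff, simp_all\<close>)
  ultimately have iD: "integrable ?D (\<lambda>x. \<sigma> ^ DIM(real ^ 'n) *\<^sub>R k x)"
    and vD: "(LINT x|?D. \<sigma> ^ DIM(real ^ 'n) *\<^sub>R k x) = 1"
    by simp_all
  show "integrable lborel k"
    using iD \<sigma> by (subst l, subst integrable_density) simp_all
  show "(LINT x|lborel. k x) = 1"
    using vD \<sigma> by (subst l, subst integral_density) simp_all
qed

lemma k_uniform:
  assumes "e > 0" obtains \<delta> where "\<delta> > 0" "\<And>u v. dist u v \<le> \<delta> \<Longrightarrow> \<bar>k u - k v\<bar> \<le> e"
proof -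
  let ?Q = "cball (0 :: real ^ 'n) (\<sigma> + 1)"
  have "uniformly_continuous_on ?Q k"
    by (intro compact_uniformly_continuous k_continuous) simp
  then obtain d where d: "d > 0" "\<And>u v. u \<in> ?Q \<Longrightarrow> v \<in> ?Q \<Longrightarrow> dist v u < d \<Longrightarrow> dist (k v) (k u) < e"
    using assms unfolding uniformly_continuous_on_def by meson
  show ?thesis
  proof (rule that[of "min (d / 2) 1"])
    fix u v :: "real ^ 'n" assume uv: "dist u v \<le> min (d / 2) 1"
    show "\<bar>k u - k v\<bar> \<le> e"
    proof (cases "u \<in> ?Q \<and> v \<in> ?Q")
      case True
      then show ?thesis using d(2)[of v u] uv d(1) by (simp add: dist_real_def)
    next
      case False
      moreover have "norm u \<le> norm v + 1" "norm v \<le> norm u + 1"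
        using uv norm_triangle_ineq2[of u v] norm_triangle_ineq2[of v u] by (auto simp: dist_norm norm_minus_commute)
      ultimately have "norm u \<ge> \<sigma>" "norm v \<ge> \<sigma>" by auto
      then show ?thesis using k_zero assms by simp
    qed
  qed (use d in simp)
qed

lemma k_bounded: obtains B where "\<And>x. k x \<le> B"
proof -
  have "bounded (k ` cball 0 \<sigma>)"
    by (intro compact_imp_bounded compact_continuous_image k_continuous) simp
  then obtain B where B: "\<And>x. x \<in> cball 0 \<sigma> \<Longrightarrow> \<bar>k x\<bar> \<le> B"
    unfolding bounded_iff real_norm_def by blast
  have "k x \<le> \<bar>B\<bar>" for x
    using B[of x] k_zero[of x] by (cases "norm x \<le> \<sigma>") auto
  then show ?thesis using that by blast
qed

text \<open>For \<open>norm x \<le> R\<close> the convolution is the integral of \<open>f y * k (x - y)\<close> over the ball \<open>K\<close> of radius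
\<open>R + \<sigma>\<close>. Take measurable roundings \<open>q m\<close> of finite range with
\<open>\<bar>k (x - q m y) - k (x - y)\<bar> \<le> (1/2)^m\<close> on \<open>K\<close> and write \<open>k (x - y)\<close> as the telescoping sum of
\<open>k (x - q m y) - k (x - q (m - 1) y)\<close>. The term of level \<open>m\<close> depends on \<open>y\<close> only through the cell of
\<open>y\<close> for the pair of roundings, so integrating it against \<open>f\<close> gives a finite sum of integrals of \<open>f\<close>
over cells times fixed functions of \<open>x\<close>. Those functions are \<open>O((1/2)^m)\<close>; the integrals are at most
the radius times the volume of the cell, and the cells of a level partition \<open>K\<close>. So the
coefficients are dominated by a geometric series, whatever \<open>f\<close> is.\<close>

lemma nuclear_expansion:
  fixes R :: real
  assumes R: "R \<ge> 0"
  obtains \<phi> :: "nat \<Rightarrow> real ^ 'n \<Rightarrow> real" and \<beta> :: "nat \<Rightarrow> real" and coef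
  where "\<And>j. \<phi> j \<in> borel_measurable borel" "\<And>j x. \<bar>\<phi> j x\<bar> \<le> 1" "\<And>j. 0 < \<beta> j" "summable \<beta>"
    "\<And>f. f \<in> smoothed_Lip \<kappa> \<sigma> \<Longrightarrow> coef f \<in> box_seq \<beta>"
    "\<And>f x. f \<in> smoothed_Lip \<kappa> \<sigma> \<Longrightarrow> norm x \<le> R \<Longrightarrow> f x = ip (coef f) (\<lambda>j. \<phi> j x)"
proof -
  define \<rho> where "\<rho> = R + \<sigma>"
  have \<rho>: "\<rho> > 0" using R \<sigma> by (simp add: \<rho>_def)
  define K where "K = cball (0 :: real ^ 'n) \<rho>"
  have [measurable]: "K \<in> sets borel" by (simp add: K_def)
  have Kfin: "emeasure lborel K < \<infinity>" unfolding K_def by (rule emeasure_bounded_finite) simp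
  obtain B where B: "\<And>x. k x \<le> B" using k_bounded by blast
  have B0: "0 \<le> B" using B[of 0] k_nonneg[of 0] by simp
  define \<eta> where "\<eta> m = (1 / 2 :: real) ^ m" for m
  have "\<exists>q. q \<in> borel_measurable borel \<and> finite (range q) \<and> (\<forall>y\<in>K. \<forall>x. \<bar>k (x - q y) - k (x - y)\<bar> \<le> \<eta> m)" for m
  proof -
    have "\<eta> m > 0" by (simp add: \<eta>_def)
    then obtain \<delta> where \<delta>: "\<delta> > 0" "\<And>u v. dist u v \<le> \<delta> \<Longrightarrow> \<bar>k u - k v\<bar> \<le> \<eta> m" using k_uniform by metis
    have "bounded K" by (simp add: K_def)
    then obtain q :: "real ^ 'n \<Rightarrow> real ^ 'n" where "q \<in> borel_measurable borel" "finite (range q)"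
      "\<And>y. y \<in> K \<Longrightarrow> dist (q y) y \<le> \<delta>" using finite_range_quantizer[OF _ \<delta>(1)] by metis
    then show ?thesis using \<delta>(2) by (intro exI[of _ q]) (auto simp: dist_norm norm_minus_commute)
  qed
  then obtain q :: "nat \<Rightarrow> real ^ 'n \<Rightarrow> real ^ 'n" where q[measurable]: "\<And>m. q m \<in> borel_measurable borel"
    and qfin: "\<And>m. finite (range (q m))"
    and qk: "\<And>m y x. y \<in> K \<Longrightarrow> \<bar>k (x - q m y) - k (x - y)\<bar> \<le> \<eta> m" by metis
  (* At level 0 the second component is a copy of the first and D ignores it, so that the
     telescoping sum starts from k (x - q 0 y). *)
  define r where "r m y = (q m y, q (m - 1) y)" for m y
  define D where "D m p x = k (x - fst p) - (if m = 0 then 0 else k (x - snd p))"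
    for m :: nat and p :: "(real ^ 'n) \<times> (real ^ 'n)" and x
  (* B bounds the level 0 term; on later levels two rounding errors add up to 3 * \<eta> m. *)
  define E where "E m = (B + 3) * \<eta> m" for m
  have E0: "E m > 0" for m using B0 by (simp add: E_def \<eta>_def)
  have DE: "\<bar>D m (r m y) x\<bar> \<le> E m" if "y \<in> K" for m y x
  proof (cases "m = 0")
    case True
    then show ?thesis using B[of "x - q 0 y"] k_nonneg[of "x - q 0 y"] by (simp add: D_def r_def E_def \<eta>_def)
  next
    case False
    then have "\<eta> (m - 1) = 2 * \<eta> m" by (cases m) (auto simp: \<eta>_def)
    then have "\<bar>D m (r m y) x\<bar> \<le> 3 * \<eta> m"
      using qk[OF that, of x m] qk[OF that, of x "m - 1"] False by (simp add: D_def r_def)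
    also have "\<dots> \<le> E m" using B0 by (simp add: E_def \<eta>_def)
    finally show ?thesis .
  qed
  define J where "J m = r m ` K" for m
  have Jfin: "finite (J m)" for m
  proof -
    have "J m \<subseteq> range (q m) \<times> range (q (m - 1))" by (auto simp: J_def r_def)
    then show ?thesis using qfin by (meson finite_SigmaI finite_subset)
  qed
  have Jne: "J m \<noteq> {}" for m using \<rho> by (auto simp: J_def K_def)
  define A where "A m p = {y \<in> K. r m y = p}" for m p
  have A[measurable]: "A m p \<in> sets borel" for m p
  proof -
    have "{y \<in> space borel. q m y = fst p \<and> q (m - 1) y = snd p} \<in> sets borel" by measurable
    then have "K \<inter> {y. q m y = fst p \<and> q (m - 1) y = snd p} \<in> sets borel" by auto
    moreover have "A m p = K \<inter> {y. q m y = fst p \<and> q (m - 1) y = snd p}" by (auto simp: A_def r_def prod_eq_iff)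
    ultimately show ?thesis by simp
  qed
  have Afin: "emeasure lborel (A m p) < \<infinity>" for m p
    using Kfin emeasure_mono[of "A m p" K lborel] by (auto simp: A_def intro: le_less_trans)
  have Asum: "(\<Sum>p\<in>J m. measure lborel (A m p)) = measure lborel K" for m
  proof -
    have "measure lborel (\<Union>p\<in>J m. A m p) = (\<Sum>p\<in>J m. measure lborel (A m p))"
    proof (rule measure_finite_Union[OF Jfin])
      show "A m ` J m \<subseteq> sets lborel" using A by auto
      show "disjoint_family_on (A m) (J m)" by (auto simp: disjoint_family_on_def A_def)
      show "emeasure lborel (A m p) \<noteq> \<infinity>" for p using Afin[of m p] by auto
    qed
    moreover have "(\<Union>p\<in>J m. A m p) = K" by (auto simp: J_def A_def)
    ultimately show ?thesis by simp
  qed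
  define pre where "pre g = (SOME f. f \<in> Lip10 \<and> g = fun_convolution f k)" for g :: "real ^ 'n \<Rightarrow> real"
  have pre: "pre g \<in> Lip10" "g = fun_convolution (pre g) k" if "g \<in> smoothed_Lip \<kappa> \<sigma>" for g
    using someI_ex[of "\<lambda>f. f \<in> Lip10 \<and> g = fun_convolution f k"] that
    by (auto simp: smoothed_Lip_def pre_def)
  have fint: "integrable lborel (\<lambda>y. f y * indicator (A m p) y)" "integrable lborel (\<lambda>y. f y * indicator K y)"
    "\<bar>LINT y|lborel. f y * indicator (A m p) y\<bar> \<le> \<rho> * measure lborel (A m p)"
    if f: "f \<in> Lip10" for f m p
  proof -
    have [measurable]: "f \<in> borel_measurable borel" using Lip10_D(3)[OF f] .
    have iK: "integrable lborel (\<lambda>y. \<rho> * indicator K y)" using Kfin by (intro integrable_mult_right integrable_real_indicator) auto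
    have iA: "integrable lborel (\<lambda>y. \<rho> * indicator (A m p) y)" using Afin by (intro integrable_mult_right integrable_real_indicator) auto
    have fle: "\<bar>f y * indicator C y\<bar> \<le> \<rho> * indicator C y" if "C \<subseteq> K" for C y
      using Lip10_D(2)[OF f, of y] that by (auto simp: indicator_def K_def abs_mult)
    have AK: "A m p \<subseteq> K" by (auto simp: A_def)
    show i1: "integrable lborel (\<lambda>y. f y * indicator (A m p) y)"
      by (rule Bochner_Integration.integrable_bound[OF iA]) (use fle[OF AK] in \<open>auto intro: order_trans[OF _ abs_ge_self]\<close>)
    show "integrable lborel (\<lambda>y. f y * indicator K y)"
      by (rule Bochner_Integration.integrable_bound[OF iK]) (use fle[OF order_refl] in \<open>auto intro: order_trans[OF _ abs_ge_self]\<close>)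
    have "\<bar>LINT y|lborel. f y * indicator (A m p) y\<bar> \<le> (LINT y|lborel. \<bar>f y * indicator (A m p) y\<bar>)" by (rule integral_abs_bound)
    also have "\<dots> \<le> (LINT y|lborel. \<rho> * indicator (A m p) y)"
      by (intro integral_mono iA integrable_abs i1) (use fle[OF AK] in auto)
    also have "\<dots> = \<rho> * measure lborel (A m p)" using Afin by simp
    finally show "\<bar>LINT y|lborel. f y * indicator (A m p) y\<bar> \<le> \<rho> * measure lborel (A m p)" .
  qed
  define e where "e = from_nat_into (Sigma UNIV J)"
  have e: "bij_betw e UNIV (Sigma UNIV J)"
    unfolding e_def
  proof (rule bij_betw_from_nat_into)
    show "countable (Sigma UNIV J)" using Jfin by (intro countable_SIGMA) (auto intro: countable_finite)
    have "infinite (fst ` Sigma UNIV J)"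
    proof -
      have "fst ` Sigma UNIV J = UNIV" using Jne by force
      then show ?thesis by simp
    qed
    then show "infinite (Sigma UNIV J)" using finite_imageI by blast
  qed
  define \<Phi> where "\<Phi> mp x = D (fst mp) (snd mp) x / E (fst mp)" for mp x
  define b where "b g mp = E (fst mp) * (LINT y|lborel. pre g y * indicator (A (fst mp) (snd mp)) y)" for g mp
  define \<beta>0 where "\<beta>0 mp = E (fst mp) * (\<rho> * measure lborel (A (fst mp) (snd mp)))" for mp
  have \<beta>0: "0 \<le> \<beta>0 mp" for mp using E0[of "fst mp"] \<rho> by (simp add: \<beta>0_def)
  have inJ: "snd (e j) \<in> J (fst (e j))" for j
  proof -
    have "e j \<in> Sigma UNIV J" using bij_betwE[OF e] by blast
    then show ?thesis by auto
  qed
  have s\<beta>: "summable (\<lambda>m. \<Sum>p\<in>J m. \<bar>\<beta>0 (m, p)\<bar>)"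
  proof -
    have "(\<Sum>p\<in>J m. \<bar>\<beta>0 (m, p)\<bar>) = (1 / 2) ^ m * ((B + 3) * \<rho> * measure lborel K)" for m
    proof -
      have "(\<Sum>p\<in>J m. \<bar>\<beta>0 (m, p)\<bar>) = (\<Sum>p\<in>J m. \<beta>0 (m, p))" using \<beta>0 by simp
      also have "\<dots> = E m * (\<rho> * (\<Sum>p\<in>J m. measure lborel (A m p)))"
        unfolding \<beta>0_def by (simp add: sum_distrib_left)
      finally show ?thesis unfolding Asum by (simp add: E_def \<eta>_def)
    qed
    then show ?thesis by (simp add: summable_geometric summable_mult2)
  qed
  have bb: "\<bar>b g mp\<bar> \<le> \<beta>0 mp" if "g \<in> smoothed_Lip \<kappa> \<sigma>" for g mp
    using fint(3)[OF pre(1)[OF that], of "fst mp" "snd mp"] E0[of "fst mp"]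
    by (simp add: b_def \<beta>0_def abs_mult)
  have \<Phi>1: "\<bar>\<Phi> (m, p) x\<bar> \<le> 1" if "p \<in> J m" for m p x
    using DE[of _ m x] that E0[of m] by (auto simp: \<Phi>_def J_def)
  show ?thesis
  (* The additional (1 / 2) ^ j makes the weights strictly positive also for cells of
     volume 0. *)
  proof (rule that[of "\<lambda>j. \<Phi> (e j)" "\<lambda>j. \<beta>0 (e j) + (1 / 2) ^ j" "\<lambda>g j. b g (e j)"])
    show "\<Phi> (e j) \<in> borel_measurable borel" for j unfolding \<Phi>_def D_def by measurable
    show "\<bar>\<Phi> (e j) x\<bar> \<le> 1" for j x using \<Phi>1[OF inJ[of j]] by simp
    show "0 < \<beta>0 (e j) + (1 / 2) ^ j" for j by (intro add_nonneg_pos \<beta>0) simp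
    have "summable (\<lambda>j. \<bar>\<beta>0 (e j)\<bar>)" by (rule flatten_series(1)[OF Jfin Jne s\<beta> e])
    then show "summable (\<lambda>j. \<beta>0 (e j) + (1 / 2) ^ j)"
      using \<beta>0 by (intro summable_add) (simp_all add: summable_geometric)
    fix g assume g: "g \<in> smoothed_Lip \<kappa> \<sigma>"
    show "(\<lambda>j. b g (e j)) \<in> box_seq (\<lambda>j. \<beta>0 (e j) + (1 / 2) ^ j)"
      unfolding box_seq_def
    proof (intro CollectI allI)
      fix j
      have "(0 :: real) \<le> (1 / 2) ^ j" by simp
      then show "\<bar>b g (e j)\<bar> \<le> \<beta>0 (e j) + (1 / 2) ^ j" using bb[OF g, of "e j"] by linarith
    qed
    fix x :: "real ^ 'n" assume x: "norm x \<le> R"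
    let ?f = "pre g"
    note f = pre(1)[OF g]
    have [measurable]: "?f \<in> borel_measurable borel" using Lip10_D(3)[OF f] .
    define T where "T m = (LINT y|lborel. ?f y * indicator K y * k (x - q m y))" for m
    have inner: "(\<Sum>p\<in>J m. b g (m, p) * \<Phi> (m, p) x) = (LINT y|lborel. ?f y * indicator K y * D m (r m y) x)" for m
    proof -
      have "(\<Sum>p\<in>J m. b g (m, p) * \<Phi> (m, p) x) = (\<Sum>p\<in>J m. LINT y|lborel. (?f y * indicator (A m p) y) * D m p x)"
        using E0[of m] by (intro sum.cong refl) (simp add: b_def \<Phi>_def)
      also have "\<dots> = (LINT y|lborel. (\<Sum>p\<in>J m. (?f y * indicator (A m p) y) * D m p x))"
        by (rule Bochner_Integration.integral_sum[symmetric]) (intro integrable_mult_left fint(1)[OF f])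
      also have "\<dots> = (LINT y|lborel. ?f y * indicator K y * D m (r m y) x)"
      proof (intro Bochner_Integration.integral_cong refl)
        fix y
        have "(\<Sum>p\<in>J m. (?f y * indicator (A m p) y) * D m p x) = (\<Sum>p\<in>J m. if p = r m y then ?f y * indicator K y * D m (r m y) x else 0)"
          by (intro sum.cong refl) (auto simp: A_def indicator_def)
        also have "\<dots> = ?f y * indicator K y * D m (r m y) x"
          using Jfin[of m] by (auto simp: J_def indicator_def)
        finally show "(\<Sum>p\<in>J m. (?f y * indicator (A m p) y) * D m p x) = ?f y * indicator K y * D m (r m y) x" .
      qed
      finally show ?thesis .
    qed
    have ik: "integrable lborel (\<lambda>y. ?f y * indicator K y * k (x - h y))" if [measurable]: "h \<in> borel_measurable borel" for h
    proof (rule Bochner_Integration.integrable_bound[OF integrable_mult_right[OF fint(2)[OF f], of B]])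
      show "AE y in lborel. norm (?f y * indicator K y * k (x - h y)) \<le> norm (B * (?f y * indicator K y))"
      proof (rule AE_I2)
        fix y
        have "\<bar>?f y * indicator K y\<bar> * k (x - h y) \<le> \<bar>?f y * indicator K y\<bar> * B"
          by (rule mult_left_mono[OF B abs_ge_zero])
        moreover have "norm (?f y * indicator K y * k (x - h y)) = \<bar>?f y * indicator K y\<bar> * k (x - h y)"
          using k_nonneg by (simp add: abs_mult)
        moreover have "norm (B * (?f y * indicator K y)) = \<bar>?f y * indicator K y\<bar> * B"
          using B0 by (simp add: abs_mult)
        ultimately show "norm (?f y * indicator K y * k (x - h y)) \<le> norm (B * (?f y * indicator K y))" by linarith
      qed
    qed measurable
    have tele: "(LINT y|lborel. ?f y * indicator K y * D m (r m y) x) = T m - (if m = 0 then 0 else T (m - 1))" for m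
    proof (cases "m = 0")
      case False
      have "(LINT y|lborel. ?f y * indicator K y * D m (r m y) x) =
          (LINT y|lborel. ?f y * indicator K y * k (x - q m y) - ?f y * indicator K y * k (x - q (m - 1) y))"
        using False by (simp add: D_def r_def right_diff_distrib)
      then show ?thesis using False ik[OF q] by (simp add: T_def)
    qed (simp add: D_def r_def T_def)
    have "(\<Sum>m<n. (LINT y|lborel. ?f y * indicator K y * D m (r m y) x)) = (if n = 0 then 0 else T (n - 1))" for n
      by (induction n) (auto simp: tele)
    moreover have Tlim: "T \<longlonglongrightarrow> g x"
    proof -
      have gx: "g x = (LINT y|lborel. ?f y * indicator K y * k (x - y))"
      proof -
        have "g x = (LINT y|lborel. ?f y * k (x - y))" using pre(2)[OF g] by (metis fun_convolution_def)
        also have "\<dots> = (LINT y|lborel. ?f y * indicator K y * k (x - y))"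
        proof (intro Bochner_Integration.integral_cong refl)
          fix y
          show "?f y * k (x - y) = ?f y * indicator K y * k (x - y)"
          proof (cases "y \<in> K")
            case False
            then have "norm (x - y) \<ge> \<sigma>"
              using x norm_triangle_ineq2[of y x] by (auto simp: K_def \<rho>_def norm_minus_commute)
            then show ?thesis using k_zero by simp
          qed simp
        qed
        finally show ?thesis .
      qed
      have "(\<lambda>m. T m - g x) \<longlonglongrightarrow> 0"
      proof (rule Lim_null_comparison[OF always_eventually])
        let ?C = "LINT y|lborel. \<bar>?f y * indicator K y\<bar>"
        show "\<forall>m. norm (T m - g x) \<le> \<eta> m * ?C"
        proof
          fix m
          let ?h = "\<lambda>y. ?f y * indicator K y * k (x - q m y) - ?f y * indicator K y * k (x - y)"
          have 1: "T m - g x = (LINT y|lborel. ?f y * indicator K y * k (x - q m y) - ?f y * indicator K y * k (x - y))"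
            unfolding T_def gx using ik[OF q[of m]] ik[of "\<lambda>y. y"] by simp
          have 2: "norm (LINT y|lborel. ?h y) \<le> (LINT y|lborel. norm (?h y))"
            by (rule integral_norm_bound)
          have 3: "(LINT y|lborel. norm (?h y)) \<le> (LINT y|lborel. \<eta> m * \<bar>?f y * indicator K y\<bar>)"
          proof (rule integral_mono)
            show "integrable lborel (\<lambda>y. norm (?f y * indicator K y * k (x - q m y) - ?f y * indicator K y * k (x - y)))"
              using ik[OF q[of m]] ik[of "\<lambda>y. y"] by simp
            show "integrable lborel (\<lambda>y. \<eta> m * \<bar>?f y * indicator K y\<bar>)"
              by (intro integrable_mult_right integrable_abs fint(2)[OF f])
            show "norm (?f y * indicator K y * k (x - q m y) - ?f y * indicator K y * k (x - y)) \<le> \<eta> m * \<bar>?f y * indicator K y\<bar>" for y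
            proof (cases "y \<in> K")
              case True
              have "norm (?f y * indicator K y * k (x - q m y) - ?f y * indicator K y * k (x - y)) =
                  \<bar>k (x - q m y) - k (x - y)\<bar> * \<bar>?f y * indicator K y\<bar>"
                by (simp only: left_diff_distrib[symmetric] real_norm_def abs_mult[symmetric])
                   (simp add: algebra_simps)
              then show ?thesis using qk[OF True, of x m] by (simp add: mult_right_mono)
            qed simp
          qed
          show "norm (T m - g x) \<le> \<eta> m * ?C" unfolding 1 by (rule order_trans[OF 2]) (use 3 in simp)
        qed
        show "(\<lambda>m. \<eta> m * ?C) \<longlonglongrightarrow> 0"
          unfolding \<eta>_def by (intro tendsto_mult_left_zero LIMSEQ_power_zero) simp
      qed
      then show ?thesis by (simp add: LIM_zero_iff)
    qed
    ultimately have "(\<lambda>n. \<Sum>m<n. (LINT y|lborel. ?f y * indicator K y * D m (r m y) x)) \<longlonglongrightarrow> g x"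
      by (subst filterlim_sequentially_Suc[symmetric]) simp
    then have outer: "(\<Sum>m. \<Sum>p\<in>J m. b g (m, p) * \<Phi> (m, p) x) = g x"
      unfolding inner by (intro sums_unique[symmetric]) (simp add: sums_def)
    have s': "summable (\<lambda>m. \<Sum>p\<in>J m. \<bar>b g (m, p) * \<Phi> (m, p) x\<bar>)"
    proof (rule summable_comparison_test[OF _ s\<beta>], intro exI allI impI)
      fix m
      have "(\<Sum>p\<in>J m. \<bar>b g (m, p) * \<Phi> (m, p) x\<bar>) \<le> (\<Sum>p\<in>J m. \<bar>\<beta>0 (m, p)\<bar>)"
      proof (intro sum_mono)
        fix p assume "p \<in> J m"
        then have "\<bar>b g (m, p)\<bar> * \<bar>\<Phi> (m, p) x\<bar> \<le> \<beta>0 (m, p) * 1"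
          using bb[OF g, of "(m, p)"] \<Phi>1[of p m x] \<beta>0 by (intro mult_mono) auto
        then show "\<bar>b g (m, p) * \<Phi> (m, p) x\<bar> \<le> \<bar>\<beta>0 (m, p)\<bar>" using \<beta>0[of "(m, p)"] by (simp add: abs_mult)
      qed
      then show "norm (\<Sum>p\<in>J m. \<bar>b g (m, p) * \<Phi> (m, p) x\<bar>) \<le> (\<Sum>p\<in>J m. \<bar>\<beta>0 (m, p)\<bar>)" by (simp add: sum_nonneg)
    qed
    show "g x = ip (\<lambda>j. b g (e j)) (\<lambda>j. \<Phi> (e j) x)"
      unfolding ip_def using flatten_series(2)[OF Jfin Jne s' e] outer by simp
  qed
qed

end

section \<open>Duality for the smoothed distance\<close>

context smoothing
begin

lemma kernel_measure_prob: "prob_space (kernel_measure \<kappa> \<sigma>)"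
proof
  have "emeasure (kernel_measure \<kappa> \<sigma>) (space (kernel_measure \<kappa> \<sigma>)) = (\<integral>\<^sup>+x. ennreal (k x) \<partial>lborel)"
    unfolding kernel_measure_def by (subst emeasure_density) (auto intro!: nn_integral_cong)
  also have "\<dots> = ennreal 1" using nn_integral_eq_integral[OF k_integral(1)] k_nonneg k_integral(2) by simp
  finally show "emeasure (kernel_measure \<kappa> \<sigma>) (space (kernel_measure \<kappa> \<sigma>)) = 1" by simp
qed

lemma sets_kernel_measure[measurable_cong]: "sets (kernel_measure \<kappa> \<sigma>) = sets borel"
  by (simp add: kernel_measure_def)

lemma AE_kernel_measure: "AE y in kernel_measure \<kappa> \<sigma>. norm y \<le> \<sigma>"
proof -
  have "norm y \<le> \<sigma>" if "0 < ennreal (k y)" for y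
    using k_zero[of y] that by (cases "norm y \<le> \<sigma>") auto
  then show ?thesis unfolding kernel_measure_def by (subst AE_density) auto
qed

text \<open>By Fubini's theorem and evenness of the kernel, smoothing the measure amounts to smoothing the
integrand.\<close>

lemma smoothed_measure:
  assumes \<alpha>: "prob_space \<alpha>" and s: "sets \<alpha> = sets borel" and AE: "AE x in \<alpha>. norm x \<le> R"
  shows "prob_space (\<alpha> \<star> kernel_measure \<kappa> \<sigma>)" "sets (\<alpha> \<star> kernel_measure \<kappa> \<sigma>) = sets borel"
    "AE x in (\<alpha> \<star> kernel_measure \<kappa> \<sigma>). norm x \<le> R + \<sigma>"
    "\<And>f. f \<in> Lip10 \<Longrightarrow> (LINT x|(\<alpha> \<star> kernel_measure \<kappa> \<sigma>). f x) = (LINT x|\<alpha>. fun_convolution f k x)"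
proof -
  note [measurable_cong] = s
  let ?\<eta> = "kernel_measure \<kappa> \<sigma>"
  interpret \<alpha>: prob_space \<alpha> by fact
  interpret \<eta>: prob_space ?\<eta> by (rule kernel_measure_prob)
  interpret \<alpha>\<eta>: pair_prob_space \<alpha> ?\<eta> ..
  have [measurable]: "(\<lambda>z. fst z + snd z) \<in> borel_measurable (\<alpha> \<Otimes>\<^sub>M ?\<eta>)" by measurable
  have conv: "\<alpha> \<star> ?\<eta> = distr (\<alpha> \<Otimes>\<^sub>M ?\<eta>) borel (\<lambda>z. fst z + snd z)"
    by (simp add: convolution_def case_prod_beta')
  show prob: "prob_space (\<alpha> \<star> ?\<eta>)" unfolding conv by (rule \<alpha>\<eta>.prob_space_distr) measurable
  show sets: "sets (\<alpha> \<star> ?\<eta>) = sets borel" by simp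
  have "AE z in \<alpha> \<Otimes>\<^sub>M ?\<eta>. norm (fst z + snd z) \<le> R + \<sigma>"
  proof (rule \<alpha>\<eta>.AE_pair_measure)
    show "{z \<in> space (\<alpha> \<Otimes>\<^sub>M ?\<eta>). norm (fst z + snd z) \<le> R + \<sigma>} \<in> sets (\<alpha> \<Otimes>\<^sub>M ?\<eta>)" by measurable
    show "AE x in \<alpha>. AE y in ?\<eta>. norm (fst (x, y) + snd (x, y)) \<le> R + \<sigma>"
      using AE
    proof eventually_elim
      case (elim x)
      show ?case using AE_kernel_measure
      proof eventually_elim
        case (elim y)
        then show ?case using \<open>norm x \<le> R\<close> norm_triangle_ineq[of x y] by simp
      qed
    qed
  qed
  then show AEc: "AE x in (\<alpha> \<star> ?\<eta>). norm x \<le> R + \<sigma>"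
    unfolding conv by (subst AE_distr_iff) measurable
  fix f :: "real ^ 'n \<Rightarrow> real" assume f: "f \<in> Lip10"
  have [measurable]: "f \<in> borel_measurable borel" using Lip10_D(3)[OF f] .
  have "integrable (\<alpha> \<star> ?\<eta>) f" by (rule Lip10_integrable(1)[OF prob sets AEc f])
  then have i: "integrable (\<alpha> \<Otimes>\<^sub>M ?\<eta>) (\<lambda>z. f (fst z + snd z))"
    unfolding conv by (subst (asm) integrable_distr_eq) measurable
  have "(LINT x|(\<alpha> \<star> ?\<eta>). f x) = (LINT z|(\<alpha> \<Otimes>\<^sub>M ?\<eta>). f (fst z + snd z))"
    unfolding conv by (rule integral_distr) measurable
  also have "\<dots> = (LINT x|\<alpha>. LINT y|?\<eta>. f (x + y))"
    using \<alpha>\<eta>.integral_fst'[OF i] by simp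
  also have "\<dots> = (LINT x|\<alpha>. fun_convolution f k x)"
  proof (intro Bochner_Integration.integral_cong refl)
    fix x
    have "(LINT y|?\<eta>. f (x + y)) = (LINT y|lborel. k y * f (x + y))"
      unfolding kernel_measure_def using k_nonneg by (subst integral_density) simp_all
    also have "\<dots> = (LINT y|lborel. f (x + y) * k (x - (x + y)))"
      by (simp add: k_even mult.commute)
    also have "\<dots> = (LINT z|distr lborel borel ((+) x). f z * k (x - z))"
      by (rule integral_distr[symmetric]) measurable
    also have "\<dots> = fun_convolution f k x" unfolding lborel_distr_plus fun_convolution_def ..
    finally show "(LINT y|?\<eta>. f (x + y)) = fun_convolution f k x" .
  qed
  finally show "(LINT x|(\<alpha> \<star> kernel_measure \<kappa> \<sigma>). f x) = (LINT x|\<alpha>. fun_convolution f k x)" .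
qed

theorem smooth_wasserstein1_dual:
  assumes "prob_space \<alpha>" "sets \<alpha> = sets borel" "AE x in \<alpha>. norm x \<le> R"
    and "prob_space \<beta>" "sets \<beta> = sets borel" "AE x in \<beta>. norm x \<le> R"
  shows "smooth_wasserstein1 \<kappa> \<sigma> \<alpha> \<beta> = (SUP f\<in>smoothed_Lip \<kappa> \<sigma>. (LINT x|\<alpha>. f x) - (LINT x|\<beta>. f x))"
    "bdd_above ((\<lambda>f. (LINT x|\<alpha>. f x) - (LINT x|\<beta>. f x)) ` smoothed_Lip \<kappa> \<sigma>)"
proof -
  note a = smoothed_measure[OF assms(1-3)] and b = smoothed_measure[OF assms(4-6)]
  let ?D = "\<lambda>f. (LINT x|(\<alpha> \<star> kernel_measure \<kappa> \<sigma>). f x) - (LINT x|(\<beta> \<star> kernel_measure \<kappa> \<sigma>). f x)"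
  have bd: "?D f \<le> 2 * (R + \<sigma>)" if "f \<in> Lip10" for f
    using Lip10_integrable(2)[OF a(1-3) that] Lip10_integrable(2)[OF b(1-3) that] unfolding abs_le_iff by (simp add: distrib_left)
  have eq: "?D f = (LINT x|\<alpha>. fun_convolution f k x) - (LINT x|\<beta>. fun_convolution f k x)" if "f \<in> Lip10" for f
    by (simp add: a(4) b(4) that)
  have bdd: "bdd_above (?D ` Lip10)" using bd by (intro bdd_aboveI2)
  have "0 \<le> (SUP f\<in>Lip10. ?D f)"
    using cSUP_upper[OF zero_in_Lip10 bdd] by simp
  then have "smooth_wasserstein1 \<kappa> \<sigma> \<alpha> \<beta> = (SUP f\<in>Lip10. ?D f)"
    unfolding smooth_wasserstein1_def Kantorovich_Rubinstein[OF a(1) b(1) a(2) b(2) a(3) b(3)] by simp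
  also have "\<dots> = (SUP f\<in>Lip10. (LINT x|\<alpha>. fun_convolution f k x) - (LINT x|\<beta>. fun_convolution f k x))"
    by (intro SUP_cong refl eq)
  finally show "smooth_wasserstein1 \<kappa> \<sigma> \<alpha> \<beta> = (SUP f\<in>smoothed_Lip \<kappa> \<sigma>. (LINT x|\<alpha>. f x) - (LINT x|\<beta>. f x))"
    by (simp add: smoothed_Lip_def image_image)
  show "bdd_above ((\<lambda>f. (LINT x|\<alpha>. f x) - (LINT x|\<beta>. f x)) ` smoothed_Lip \<kappa> \<sigma>)"
    using bd eq unfolding smoothed_Lip_def by (intro bdd_aboveI[of _ "2 * (R + \<sigma>)"]) auto
qed

lemma smoothed_Lip_lipschitz:
  assumes "g \<in> smoothed_Lip \<kappa> \<sigma>"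
  shows "\<bar>g x - g y\<bar> \<le> dist x y" "g \<in> borel_measurable borel"
proof -
  obtain f where f: "f \<in> Lip10" and g: "g = fun_convolution f k" using assms by (auto simp: smoothed_Lip_def)
  have [measurable]: "f \<in> borel_measurable borel" using Lip10_D(3)[OF f] .
  have gx: "g x = (LINT z|lborel. f (x - z) * k z)" for x
  proof -
    have "g x = (LINT y|lborel. f y * k (x - y))" by (simp add: g fun_convolution_def)
    also have "\<dots> = (LINT y|distr lborel borel ((+) x). f y * k (x - y))" unfolding lborel_distr_plus ..
    also have "\<dots> = (LINT z|lborel. f (x + z) * k (x - (x + z)))" by (rule integral_distr) measurable
    also have "\<dots> = (LINT z|lborel. f (x + z) * k z)" by (simp add: k_even)
    also have "\<dots> = (LINT z|distr lborel borel (\<lambda>x :: real ^ 'n. 0 + (- 1) *\<^sub>R x). f (x + z) * k z)"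
      using lborel_affine[of "- 1" "0 :: real ^ 'n"] by (simp add: density_1)
    also have "\<dots> = (LINT z|lborel. f (x + (0 + (- 1) *\<^sub>R z)) * k (0 + (- 1) *\<^sub>R z))" by (rule integral_distr) measurable
    also have "\<dots> = (LINT z|lborel. f (x - z) * k z)" by (simp add: k_even)
    finally show ?thesis .
  qed
  have i: "integrable lborel (\<lambda>z. f (x - z) * k z)" for x
  proof (rule Bochner_Integration.integrable_bound[OF integrable_mult_right[OF k_integral(1), of "norm x + \<sigma>"]])
    show "AE z in lborel. norm (f (x - z) * k z) \<le> norm ((norm x + \<sigma>) * k z)"
    proof (rule AE_I2)
      fix z
      show "norm (f (x - z) * k z) \<le> norm ((norm x + \<sigma>) * k z)"
      proof (cases "norm z \<ge> \<sigma>")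
        case False
        then have "\<bar>f (x - z)\<bar> \<le> norm x + \<sigma>"
          using Lip10_D(2)[OF f, of "x - z"] norm_triangle_ineq4[of x z] by linarith
        then show ?thesis using k_nonneg[of z] \<sigma> by (simp add: abs_mult mult_right_mono)
      qed (simp add: k_zero)
    qed
  qed measurable
  show lip: "\<bar>g x - g y\<bar> \<le> dist x y" for x y
  proof -
    have "g x - g y = (LINT z|lborel. f (x - z) * k z - f (y - z) * k z)" unfolding gx using i by simp
    also have "\<bar>\<dots>\<bar> \<le> (LINT z|lborel. \<bar>f (x - z) * k z - f (y - z) * k z\<bar>)" by (rule integral_abs_bound)
    also have "\<dots> \<le> (LINT z|lborel. dist x y * k z)"
    proof (rule integral_mono)
      show "integrable lborel (\<lambda>z. \<bar>f (x - z) * k z - f (y - z) * k z\<bar>)" using i by simp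
      show "integrable lborel (\<lambda>z. dist x y * k z)" using k_integral by simp
      show "\<bar>f (x - z) * k z - f (y - z) * k z\<bar> \<le> dist x y * k z" for z
        using Lip10_D(1)[OF f, of "x - z" "y - z"] k_nonneg[of z]
        by (simp add: left_diff_distrib[symmetric] abs_mult dist_norm mult_right_mono)
    qed
    finally show ?thesis using k_integral by simp
  qed
  have "1-lipschitz_on UNIV g" by (rule lipschitz_onI) (use lip in \<open>auto simp: dist_real_def\<close>)
  then show "g \<in> borel_measurable borel"
    by (intro borel_measurable_continuous_onI lipschitz_on_continuous_on)
qed

end

lemma empirical_measure_props:
  fixes x :: "nat \<Rightarrow> 'a::{second_countable_topology, real_normed_vector}"
  assumes "n \<ge> 1"
  shows "prob_space (empirical_measure n x)" "sets (empirical_measure n x) = sets borel"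
    "\<And>Q. (\<And>i. i < n \<Longrightarrow> Q (x i)) \<Longrightarrow> AE y in empirical_measure n x. Q y"
    "\<And>f :: 'a \<Rightarrow> real. f \<in> borel_measurable borel \<Longrightarrow> (LINT y|empirical_measure n x. f y) = (\<Sum>i<n. f (x i)) / real n"
proof -
  have ne: "{..<n} \<noteq> {}" "finite {..<n}" using assms by (auto simp: lessThan_empty_iff)
  interpret U: prob_space "uniform_count_measure {..<n}" by (rule prob_space_uniform_count_measure) (use ne in auto)
  have [measurable]: "x \<in> measurable (uniform_count_measure {..<n}) borel"
    by (simp add: measurable_def space_uniform_count_measure sets_uniform_count_measure)
  show "prob_space (empirical_measure n x)" unfolding empirical_measure_def by (rule U.prob_space_distr) measurable
  show "sets (empirical_measure n x) = sets borel" by (simp add: empirical_measure_def)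
  show "AE y in empirical_measure n x. Q y" if "\<And>i. i < n \<Longrightarrow> Q (x i)" for Q
  proof -
    have "finite (x ` {..<n})" by simp
    then have cl: "closed (x ` {..<n})" by (rule finite_imp_closed)
    have "AE i in uniform_count_measure {..<n}. x i \<in> x ` {..<n}"
      by (rule AE_I2) (auto simp: space_uniform_count_measure)
    then have "AE y in empirical_measure n x. y \<in> x ` {..<n}"
      unfolding empirical_measure_def using cl by (subst AE_distr_iff) (auto simp: pred_def)
    then show ?thesis by eventually_elim (use that in auto)
  qed
  show "(LINT y|empirical_measure n x. f y) = (\<Sum>i<n. f (x i)) / real n" if [measurable]: "f \<in> borel_measurable borel" for f :: "'a \<Rightarrow> real"
    unfolding empirical_measure_def
    by (subst integral_distr) (measurable, simp add: lebesgue_integral_point_measure_finite uniform_count_measure_def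
        sum_divide_distrib lebesgue_integral_point_measure_finite)
qed

section \<open>Distances of empirical measures\<close>

text \<open>The complement of the support is covered by open null sets, of which countably many suffice by
Lindelof's theorem.\<close>

lemma AE_in_support:
  fixes S :: "'a::second_countable_topology set"
  assumes "\<mu> \<in> prob_measures_on S"
  shows "AE x in \<mu>. x \<in> S"
proof -
  have s: "sets \<mu> = sets borel" and supp: "measure_support \<mu> \<subseteq> S" using assms by (auto simp: prob_measures_on_def)
  define \<F> where "\<F> = {U. open U \<and> emeasure \<mu> U = 0}"
  obtain \<F>' where F': "\<F>' \<subseteq> \<F>" "countable \<F>'" "\<Union>\<F>' = \<Union>\<F>"
    by (rule Lindelof[of \<F>]) (auto simp: \<F>_def)
  have "U \<in> null_sets \<mu>" if "U \<in> \<F>'" for U using that F'(1) s by (auto simp: \<F>_def null_sets_def)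
  then have "\<Union>\<F>' \<in> null_sets \<mu>" using null_sets_UN'[OF F'(2), of "\<lambda>U. U" \<mu>] by simp
  moreover have "{x \<in> space \<mu>. \<not> x \<in> S} \<subseteq> \<Union>\<F>'"
  proof
    fix x assume "x \<in> {x \<in> space \<mu>. \<not> x \<in> S}"
    then have "x \<notin> measure_support \<mu>" using supp by blast
    then obtain U where "open U" "x \<in> U" "\<not> 0 < emeasure \<mu> U" unfolding measure_support_def by blast
    then show "x \<in> \<Union>\<F>'" unfolding F'(3) by (auto simp: \<F>_def)
  qed
  ultimately show ?thesis by (rule AE_I')
qed

lemma SUP_affine:
  fixes f :: "'a \<Rightarrow> real"
  assumes "A \<noteq> {}" "bdd_above (f ` A)" "c > 0"
  shows "c * ((SUP b\<in>A. f b) - m) = (SUP b\<in>A. c * (f b - m))"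
proof (rule antisym)
  have bdd: "bdd_above ((\<lambda>b. c * (f b - m)) ` A)"
  proof -
    obtain B where "\<And>b. b \<in> A \<Longrightarrow> f b \<le> B" using assms(2) by (auto simp: bdd_above_def)
    then show ?thesis using assms(3) by (intro bdd_aboveI2[of _ _ "c * (B - m)"]) auto
  qed
  have "f b \<le> (SUP b\<in>A. c * (f b - m)) / c + m" if "b \<in> A" for b
    using cSUP_upper[OF that bdd] assms(3) by (simp add: field_simps)
  then have "(SUP b\<in>A. f b) \<le> (SUP b\<in>A. c * (f b - m)) / c + m" using assms(1) by (intro cSUP_least)
  then show "c * ((SUP b\<in>A. f b) - m) \<le> (SUP b\<in>A. c * (f b - m))" using assms(3) by (simp add: field_simps)
  show "(SUP b\<in>A. c * (f b - m)) \<le> c * ((SUP b\<in>A. f b) - m)"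
    using assms by (intro cSUP_least mult_left_mono diff_right_mono cSUP_upper) auto
qed

lemma continuous_on_SUP_lipschitz:
  fixes h :: "'f \<Rightarrow> 'z::topological_space \<Rightarrow> real"
  assumes "F \<noteq> {}" "\<And>z. bdd_above ((\<lambda>f. h f z) ` F)"
    and lip: "\<And>f z z'. f \<in> F \<Longrightarrow> \<bar>h f z' - h f z\<bar> \<le> \<delta> z' z"
    and \<delta>: "\<And>z. continuous_on UNIV (\<lambda>z'. \<delta> z' z)" "\<And>z. \<delta> z z = 0"
  shows "continuous_on UNIV (\<lambda>z. SUP f\<in>F. h f z)"
  unfolding continuous_on_def
proof
  fix z
  have d0: "((\<lambda>z'. \<delta> z' z) \<longlongrightarrow> 0) (at z within UNIV)"
  proof -
    have "((\<lambda>z'. \<delta> z' z) \<longlongrightarrow> \<delta> z z) (at z within UNIV)" using \<delta>(1)[of z] unfolding continuous_on_def by blast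
    then show ?thesis by (simp only: \<delta>(2))
  qed
  have "((\<lambda>z'. (SUP f\<in>F. h f z') - (SUP f\<in>F. h f z)) \<longlongrightarrow> 0) (at z within UNIV)"
  proof (rule Lim_null_comparison[OF always_eventually d0], intro allI)
    show "norm ((SUP f\<in>F. h f z') - (SUP f\<in>F. h f z)) \<le> \<delta> z' z" for z'
      unfolding real_norm_def by (rule SUP_diff_le[OF assms(1,2,2) lip])
  qed
  then show "((\<lambda>z. SUP f\<in>F. h f z) \<longlongrightarrow> (SUP f\<in>F. h f z)) (at z within UNIV)" by (simp add: LIM_zero_iff)
qed

context smoothing
begin

lemma smoothed_Lip_nonempty: "smoothed_Lip \<kappa> \<sigma> \<noteq> {}"
  using zero_in_Lip10 by (auto simp: smoothed_Lip_def)

lemma empirical_average_lipschitz: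
  assumes "f \<in> smoothed_Lip \<kappa> \<sigma>"
  shows "\<bar>(\<Sum>i<n. f (x i)) / real n - (\<Sum>i<n. f (y i)) / real n\<bar> \<le> (\<Sum>i<n. dist (x i) (y i)) / real n"
proof -
  have "\<bar>(\<Sum>i<n. f (x i)) - (\<Sum>i<n. f (y i))\<bar> \<le> (\<Sum>i<n. \<bar>f (x i) - f (y i)\<bar>)"
    unfolding sum_subtractf[symmetric] by (rule sum_abs)
  also have "\<dots> \<le> (\<Sum>i<n. dist (x i) (y i))" by (intro sum_mono smoothed_Lip_lipschitz(1)[OF assms])
  finally show ?thesis
    by (cases "n = 0") (simp_all add: diff_divide_distrib[symmetric] abs_divide divide_right_mono)
qed

lemma one_sample_dual:
  assumes n: "n \<ge> 1" and \<nu>: "prob_space \<nu>" "sets \<nu> = sets borel" "AE x in \<nu>. norm x \<le> R"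
  shows "smooth_wasserstein1 \<kappa> \<sigma> (empirical_measure n x) \<nu> =
      (SUP f\<in>smoothed_Lip \<kappa> \<sigma>. (\<Sum>i<n. f (x i)) / real n - (LINT y|\<nu>. f y))"
    "bdd_above ((\<lambda>f. (\<Sum>i<n. f (x i)) / real n - (LINT y|\<nu>. f y)) ` smoothed_Lip \<kappa> \<sigma>)"
proof -
  note e = empirical_measure_props[where x = x, OF n]
  define R' where "R' = max R (Max ((\<lambda>i. norm (x i)) ` {..<n}))"
  have AEx: "AE y in empirical_measure n x. norm y \<le> R'"
    by (rule e(3)) (auto simp: R'_def intro!: max.coboundedI2 Max_ge)
  have AE\<nu>: "AE y in \<nu>. norm y \<le> R'" using \<nu>(3) by eventually_elim (simp add: R'_def)
  have eq: "(LINT y|empirical_measure n x. f y) - (LINT y|\<nu>. f y) = (\<Sum>i<n. f (x i)) / real n - (LINT y|\<nu>. f y)"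
    if "f \<in> smoothed_Lip \<kappa> \<sigma>" for f
    using e(4)[OF smoothed_Lip_lipschitz(2)[OF that]] by simp
  note d = smooth_wasserstein1_dual[OF e(1,2) AEx \<nu>(1,2) AE\<nu>]
  show "smooth_wasserstein1 \<kappa> \<sigma> (empirical_measure n x) \<nu> =
      (SUP f\<in>smoothed_Lip \<kappa> \<sigma>. (\<Sum>i<n. f (x i)) / real n - (LINT y|\<nu>. f y))"
    unfolding d(1) by (rule SUP_cong[OF refl eq])
  have "(\<lambda>f. (\<Sum>i<n. f (x i)) / real n - (LINT y|\<nu>. f y)) ` smoothed_Lip \<kappa> \<sigma> =
      (\<lambda>f. (LINT y|empirical_measure n x. f y) - (LINT y|\<nu>. f y)) ` smoothed_Lip \<kappa> \<sigma>"
    by (rule image_cong[OF refl eq[symmetric]])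
  then show "bdd_above ((\<lambda>f. (\<Sum>i<n. f (x i)) / real n - (LINT y|\<nu>. f y)) ` smoothed_Lip \<kappa> \<sigma>)"
    using d(2) by simp
qed

lemma two_sample_dual:
  assumes n: "n \<ge> 1"
  shows "smooth_wasserstein1 \<kappa> \<sigma> (empirical_measure n x) (empirical_measure n y) =
      (SUP f\<in>smoothed_Lip \<kappa> \<sigma>. (\<Sum>i<n. f (x i)) / real n - (\<Sum>i<n. f (y i)) / real n)"
    "bdd_above ((\<lambda>f. (\<Sum>i<n. f (x i)) / real n - (\<Sum>i<n. f (y i)) / real n) ` smoothed_Lip \<kappa> \<sigma>)"
proof -
  note e = empirical_measure_props[where x = y, OF n]
  have AEy: "AE z in empirical_measure n y. norm z \<le> Max ((\<lambda>i. norm (y i)) ` {..<n})"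
    by (rule e(3)) (auto intro!: Max_ge)
  have eq: "(\<Sum>i<n. f (x i)) / real n - (LINT y|empirical_measure n y. f y) = (\<Sum>i<n. f (x i)) / real n - (\<Sum>i<n. f (y i)) / real n"
    if "f \<in> smoothed_Lip \<kappa> \<sigma>" for f
    using e(4)[OF smoothed_Lip_lipschitz(2)[OF that]] by simp
  note d = one_sample_dual[OF n e(1,2) AEy, of x]
  show "smooth_wasserstein1 \<kappa> \<sigma> (empirical_measure n x) (empirical_measure n y) =
      (SUP f\<in>smoothed_Lip \<kappa> \<sigma>. (\<Sum>i<n. f (x i)) / real n - (\<Sum>i<n. f (y i)) / real n)"
    unfolding d(1) by (rule SUP_cong[OF refl eq])
  have "(\<lambda>f. (\<Sum>i<n. f (x i)) / real n - (\<Sum>i<n. f (y i)) / real n) ` smoothed_Lip \<kappa> \<sigma> =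
      (\<lambda>f. (\<Sum>i<n. f (x i)) / real n - (LINT y|empirical_measure n y. f y)) ` smoothed_Lip \<kappa> \<sigma>"
    by (rule image_cong[OF refl eq[symmetric]])
  then show "bdd_above ((\<lambda>f. (\<Sum>i<n. f (x i)) / real n - (\<Sum>i<n. f (y i)) / real n) ` smoothed_Lip \<kappa> \<sigma>)"
    using d(2) by simp
qed

lemma continuous_on_point: "continuous_on UNIV (\<lambda>x :: nat \<Rightarrow> real ^ 'n. x i)"
  by (rule continuous_on_product_coordinates)

text \<open>By duality the distance is a supremum of functions that are equicontinuous in the sample points, so
it is continuous in them.\<close>

lemma empirical_measurable:
  assumes X: "\<And>i. X i \<in> borel_measurable P" and Y: "\<And>i. Y i \<in> borel_measurable P"
    and \<nu>: "prob_space \<nu>" "sets \<nu> = sets borel" "AE x in \<nu>. norm x \<le> R"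
  shows "(\<lambda>\<omega>. sqrt (real n) * (smooth_wasserstein1 \<kappa> \<sigma> (empirical_measure n (\<lambda>i. X i \<omega>)) \<nu> - m)) \<in> borel_measurable P"
    and "(\<lambda>\<omega>. sqrt (real n) * (smooth_wasserstein1 \<kappa> \<sigma> (empirical_measure n (\<lambda>i. X i \<omega>)) (empirical_measure n (\<lambda>i. Y i \<omega>)) - m)) \<in> borel_measurable P"
proof -
  have [measurable]: "(\<lambda>\<omega> i. X i \<omega>) \<in> measurable P borel" "(\<lambda>\<omega> i. Y i \<omega>) \<in> measurable P borel"
    by (intro measurable_coordinatewise_then_product X Y)+
  have "(\<lambda>\<omega>. smooth_wasserstein1 \<kappa> \<sigma> (empirical_measure n (\<lambda>i. X i \<omega>)) \<nu>) \<in> borel_measurable P"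
    and "(\<lambda>\<omega>. smooth_wasserstein1 \<kappa> \<sigma> (empirical_measure n (\<lambda>i. X i \<omega>)) (empirical_measure n (\<lambda>i. Y i \<omega>))) \<in> borel_measurable P"
    if n: "n \<ge> 1"
  proof -
    have "continuous_on UNIV (\<lambda>x. SUP f\<in>smoothed_Lip \<kappa> \<sigma>. (\<Sum>i<n. f (x i)) / real n - (LINT y|\<nu>. f y))"
    proof (rule continuous_on_SUP_lipschitz[OF smoothed_Lip_nonempty one_sample_dual(2)[OF n \<nu>],
          where \<delta> = "\<lambda>x y. (\<Sum>i<n. dist (x i) (y i)) / real n"])
      show "continuous_on UNIV (\<lambda>x. (\<Sum>i<n. dist (x i) (y i)) / real n)" for y :: "nat \<Rightarrow> real ^ 'n"
        using n by (intro continuous_on_divide continuous_on_sum continuous_on_dist continuous_on_const continuous_on_point) simp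
    qed (use empirical_average_lipschitz in auto)
    then have [measurable]: "(\<lambda>x. SUP f\<in>smoothed_Lip \<kappa> \<sigma>. (\<Sum>i<n. f (x i)) / real n - (LINT y|\<nu>. f y)) \<in> borel_measurable borel"
      by (rule borel_measurable_continuous_onI)
    show "(\<lambda>\<omega>. smooth_wasserstein1 \<kappa> \<sigma> (empirical_measure n (\<lambda>i. X i \<omega>)) \<nu>) \<in> borel_measurable P"
      unfolding one_sample_dual(1)[OF n \<nu>]
      by (rule measurable_compose[where f = "\<lambda>\<omega> i. X i \<omega>" and N = borel]) measurable
    have fst: "continuous_on UNIV (\<lambda>z :: (nat \<Rightarrow> real ^ 'n) \<times> (nat \<Rightarrow> real ^ 'n). fst z i)" for i
      by (rule continuous_on_compose2[OF continuous_on_point continuous_on_fst[OF continuous_on_id]]) simp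
    have snd: "continuous_on UNIV (\<lambda>z :: (nat \<Rightarrow> real ^ 'n) \<times> (nat \<Rightarrow> real ^ 'n). snd z i)" for i
      by (rule continuous_on_compose2[OF continuous_on_point continuous_on_snd[OF continuous_on_id]]) simp
    have "continuous_on UNIV (\<lambda>z. SUP f\<in>smoothed_Lip \<kappa> \<sigma>. (\<Sum>i<n. f (fst z i)) / real n - (\<Sum>i<n. f (snd z i)) / real n)"
    proof (rule continuous_on_SUP_lipschitz[OF smoothed_Lip_nonempty two_sample_dual(2)[OF n],
          where \<delta> = "\<lambda>x y. (\<Sum>i<n. dist (fst x i) (fst y i)) / real n + (\<Sum>i<n. dist (snd x i) (snd y i)) / real n"])
      show "continuous_on UNIV (\<lambda>x. (\<Sum>i<n. dist (fst x i) (fst y i)) / real n + (\<Sum>i<n. dist (snd x i) (snd y i)) / real n)"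
        for y :: "(nat \<Rightarrow> real ^ 'n) \<times> (nat \<Rightarrow> real ^ 'n)"
        using n by (intro continuous_on_add continuous_on_divide continuous_on_sum continuous_on_dist continuous_on_const fst snd) auto
      fix f and z z' :: "(nat \<Rightarrow> real ^ 'n) \<times> (nat \<Rightarrow> real ^ 'n)" assume f: "f \<in> smoothed_Lip \<kappa> \<sigma>"
      show "\<bar>(\<Sum>i<n. f (fst z' i)) / real n - (\<Sum>i<n. f (snd z' i)) / real n - ((\<Sum>i<n. f (fst z i)) / real n - (\<Sum>i<n. f (snd z i)) / real n)\<bar>
          \<le> (\<Sum>i<n. dist (fst z' i) (fst z i)) / real n + (\<Sum>i<n. dist (snd z' i) (snd z i)) / real n"
        using empirical_average_lipschitz[OF f, where n = n and x = "fst z'" and y = "fst z"]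
          empirical_average_lipschitz[OF f, where n = n and x = "snd z'" and y = "snd z"] by linarith
    qed simp
    then have [measurable]: "(\<lambda>z. SUP f\<in>smoothed_Lip \<kappa> \<sigma>. (\<Sum>i<n. f (fst z i)) / real n - (\<Sum>i<n. f (snd z i)) / real n) \<in> borel_measurable borel"
      by (rule borel_measurable_continuous_onI)
    have "(\<lambda>\<omega>. ((\<lambda>i. X i \<omega>), (\<lambda>i. Y i \<omega>))) \<in> measurable P borel" by measurable
    from measurable_compose[OF this, of "\<lambda>z. SUP f\<in>smoothed_Lip \<kappa> \<sigma>. (\<Sum>i<n. f (fst z i)) / real n - (\<Sum>i<n. f (snd z i)) / real n" borel]
    show "(\<lambda>\<omega>. smooth_wasserstein1 \<kappa> \<sigma> (empirical_measure n (\<lambda>i. X i \<omega>)) (empirical_measure n (\<lambda>i. Y i \<omega>))) \<in> borel_measurable P"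
      unfolding two_sample_dual(1)[OF n] by simp
  qed note * = this
  show "(\<lambda>\<omega>. sqrt (real n) * (smooth_wasserstein1 \<kappa> \<sigma> (empirical_measure n (\<lambda>i. X i \<omega>)) \<nu> - m)) \<in> borel_measurable P"
    (* For n = 0 the factor sqrt 0 makes the function constant. *)
    using *(1) by (cases "n = 0") auto
  show "(\<lambda>\<omega>. sqrt (real n) * (smooth_wasserstein1 \<kappa> \<sigma> (empirical_measure n (\<lambda>i. X i \<omega>)) (empirical_measure n (\<lambda>i. Y i \<omega>)) - m)) \<in> borel_measurable P"
    using *(2) by (cases "n = 0") auto
qed

end

section \<open>Suprema over the completion\<close>

lemma box_seq_l1_tendsto:
  assumes "\<And>n. b n \<in> box_seq \<beta>" "c \<in> box_seq \<beta>" "b \<longlonglongrightarrow> c" "summable \<beta>"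
  shows "(\<lambda>n. \<Sum>k. \<bar>b n k - c k\<bar>) \<longlonglongrightarrow> 0" "\<And>n. summable (\<lambda>k. \<bar>b n k - c k\<bar>)"
proof -
  have le: "\<bar>x k - c k\<bar> \<le> 2 * \<beta> k" if "x \<in> box_seq \<beta>" for x k
    using box_seqD[OF that, of k] box_seqD[OF assms(2), of k] by linarith
  have "continuous_on (box_seq \<beta>) (\<lambda>x. \<Sum>k. \<bar>x k - c k\<bar>)"
    by (rule continuous_on_suminf_bounded[OF _ _ summable_mult[OF assms(4), of 2]])
       (use le in \<open>auto intro!: continuous_on_rabs continuous_on_diff continuous_on_const continuous_on_coordinate\<close>)
  from continuous_on_tendsto_compose[OF this assms(3,2)] assms(1)
  show "(\<lambda>n. \<Sum>k. \<bar>b n k - c k\<bar>) \<longlonglongrightarrow> 0" by simp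
  show "summable (\<lambda>k. \<bar>b n k - c k\<bar>)" for n
    by (rule summable_comparison_test[OF _ summable_mult[OF assms(4), of 2]]) (use le[OF assms(1)] in auto)
qed

text \<open>The coefficient sequences of a Cauchy sequence for \<open>d\<close> need not converge, but some subsequence
converges to a sequence \<open>b\<close> in the box. Both the functional and the path have limits along the whole
Cauchy sequence, so these limits are \<open>a b\<close> and \<open>ip b w\<close>. Conversely, every \<open>b\<close> in the closure is a
limit of coefficient sequences, which then converge in \<open>\<ell>\<^sup>1\<close> since the box has summable weights, and
\<open>d\<close> is dominated by the \<open>\<ell>\<^sup>1\<close> distance.\<close>

lemma potentials_image:
  fixes coef :: "'f \<Rightarrow> nat \<Rightarrow> real" and a :: "(nat \<Rightarrow> real) \<Rightarrow> real"
  assumes box: "\<And>f. f \<in> F \<Longrightarrow> coef f \<in> box_seq \<beta>" and \<beta>: "\<And>k. 0 \<le> \<beta> k" "summable \<beta>"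
    and w: "summable (\<lambda>k. \<beta> k * \<bar>w k\<bar>)"
    and uc: "\<And>e. e > 0 \<Longrightarrow> \<exists>\<delta>>0. \<forall>f\<in>F. \<forall>g\<in>F. d f g < \<delta> \<longrightarrow> \<bar>ip (coef f) w - ip (coef g) w\<bar> < e"
    and d: "\<And>f g. f \<in> F \<Longrightarrow> g \<in> F \<Longrightarrow> d f g \<le> C * (\<Sum>k. \<bar>coef f k - coef g k\<bar>)" and C: "C > 0"
    and a: "continuous_on (box_seq \<beta>) a"
  shows "(\<lambda>u. lim (\<lambda>j. ip (coef (u j)) w)) ` {u \<in> pseudo_completion d F. (\<lambda>j. a (coef (u j))) \<longlonglongrightarrow> m} =
         (\<lambda>b. ip b w) ` {b \<in> closure (coef ` F). a b = m}" (is "?L = ?R")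
    and "\<And>u. u \<in> pseudo_completion d F \<Longrightarrow> convergent (\<lambda>j. ip (coef (u j)) w)"
proof -
  have cl: "closure (coef ` F) \<subseteq> box_seq \<beta>" using box by (intro closure_minimal closed_box_seq) auto
  note cont = continuous_on_ip_left[OF w]
  show conv: "convergent (\<lambda>j. ip (coef (u j)) w)" if u: "u \<in> pseudo_completion d F" for u
  proof -
    have "Cauchy (\<lambda>j. ip (coef (u j)) w)"
    proof (rule metric_CauchyI)
      fix e :: real assume "e > 0"
      then obtain \<delta> where \<delta>: "\<delta> > 0" "\<And>f g. f \<in> F \<Longrightarrow> g \<in> F \<Longrightarrow> d f g < \<delta> \<Longrightarrow> \<bar>ip (coef f) w - ip (coef g) w\<bar> < e"
        using uc by meson
      have "\<exists>n0. \<forall>i\<ge>n0. \<forall>j\<ge>n0. d (u i) (u j) < \<delta>"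
        using u \<delta>(1) unfolding pseudo_completion_def by simp
      then obtain n0 where "\<And>i j. i \<ge> n0 \<Longrightarrow> j \<ge> n0 \<Longrightarrow> d (u i) (u j) < \<delta>" by auto
      moreover have "u j \<in> F" for j using u by (auto simp: pseudo_completion_def)
      ultimately show "\<exists>M. \<forall>i\<ge>M. \<forall>j\<ge>M. dist (ip (coef (u i)) w) (ip (coef (u j)) w) < e"
        using \<delta>(2) unfolding dist_real_def by meson
    qed
    then show ?thesis by (simp add: Cauchy_convergent_iff)
  qed
  show "?L = ?R"
  proof (intro equalityI subsetI)
    fix y assume "y \<in> ?L"
    then obtain u where u: "u \<in> pseudo_completion d F" and ul: "(\<lambda>j. a (coef (u j))) \<longlonglongrightarrow> m"
      and y: "y = lim (\<lambda>j. ip (coef (u j)) w)" by auto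
    have uF: "u j \<in> F" for j using u by (auto simp: pseudo_completion_def)
    have "compact (closure (coef ` F))"
      using compact_Int_closed[OF compact_box_seq closed_closure, of \<beta>] cl by (metis Int_absorb1)
    then have "seq_compact (closure (coef ` F))" by (simp add: compact_eq_seq_compact_metric)
    moreover have "\<forall>j. coef (u j) \<in> closure (coef ` F)" using uF closure_subset by blast
    ultimately obtain b r where b: "b \<in> closure (coef ` F)" and r: "strict_mono r"
      and lim: "((\<lambda>j. coef (u j)) \<circ> r) \<longlonglongrightarrow> b"
      by (rule seq_compactE)
    have lim': "(\<lambda>j. coef (u (r j))) \<longlonglongrightarrow> b" using lim by (simp add: o_def)
    have bb: "b \<in> box_seq \<beta>" using b cl by auto
    have "(\<lambda>j. a (coef (u (r j)))) \<longlonglongrightarrow> a b"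
      by (rule continuous_on_tendsto_compose[OF a lim' bb]) (use box uF in auto)
    moreover have "(\<lambda>j. a (coef (u (r j)))) \<longlonglongrightarrow> m"
      using LIMSEQ_subseq_LIMSEQ[OF ul r] by (simp add: o_def)
    ultimately have ab: "a b = m" by (rule LIMSEQ_unique)
    have "(\<lambda>j. ip (coef (u (r j))) w) \<longlonglongrightarrow> ip b w"
      by (rule continuous_on_tendsto_compose[OF cont lim' bb]) (use box uF in auto)
    moreover have "(\<lambda>j. ip (coef (u (r j))) w) \<longlonglongrightarrow> y"
      using LIMSEQ_subseq_LIMSEQ[OF iffD1[OF convergent_LIMSEQ_iff conv[OF u]] r] by (simp add: o_def y)
    ultimately have "y = ip b w" using LIMSEQ_unique by blast
    then show "y \<in> ?R" using b ab by blast
  next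
    fix y assume "y \<in> ?R"
    then obtain b where b: "b \<in> closure (coef ` F)" and ab: "a b = m" and y: "y = ip b w" by auto
    obtain c where c: "\<And>j. c j \<in> coef ` F" and cb: "c \<longlonglongrightarrow> b" using b unfolding closure_sequential by auto
    then have "\<exists>f. f \<in> F \<and> c j = coef f" for j by blast
    then obtain u where uF: "\<And>j. u j \<in> F" and uc': "\<And>j. c j = coef (u j)" by metis
    have lim: "(\<lambda>j. coef (u j)) \<longlonglongrightarrow> b" using cb uc' by (metis ext)
    have bb: "b \<in> box_seq \<beta>" using b cl by auto
    note l1 = box_seq_l1_tendsto[of "\<lambda>j. coef (u j)", OF box[OF uF] bb lim \<beta>(2)]
    have "u \<in> pseudo_completion d F"
      unfolding pseudo_completion_def
    proof (intro CollectI conjI allI impI)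
      show "range u \<subseteq> F" using uF by auto
      fix e :: real assume e: "e > 0"
      then have "\<forall>\<^sub>F j in sequentially. (\<Sum>k. \<bar>coef (u j) k - b k\<bar>) < e / (2 * C)"
        using l1(1) C by (simp add: order_tendsto_iff)
      then obtain n0 where n0: "\<And>j. j \<ge> n0 \<Longrightarrow> (\<Sum>k. \<bar>coef (u j) k - b k\<bar>) < e / (2 * C)"
        by (auto simp: eventually_sequentially)
      have "d (u i) (u j) < e" if "i \<ge> n0" "j \<ge> n0" for i j
      proof -
        have ss: "summable (\<lambda>k. \<bar>coef (u i) k - b k\<bar> + \<bar>coef (u j) k - b k\<bar>)" by (intro summable_add l1(2))
        have s: "summable (\<lambda>k. \<bar>coef (u i) k - coef (u j) k\<bar>)"
          by (rule summable_comparison_test[OF _ ss]) auto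
        have "(\<Sum>k. \<bar>coef (u i) k - coef (u j) k\<bar>) \<le> (\<Sum>k. \<bar>coef (u i) k - b k\<bar> + \<bar>coef (u j) k - b k\<bar>)"
          by (rule suminf_le[OF _ s ss]) auto
        also have "\<dots> = (\<Sum>k. \<bar>coef (u i) k - b k\<bar>) + (\<Sum>k. \<bar>coef (u j) k - b k\<bar>)"
          by (rule suminf_add[symmetric]) (rule l1(2))+
        also have "\<dots> < e / C" using n0[OF that(1)] n0[OF that(2)] by simp
        finally have "C * (\<Sum>k. \<bar>coef (u i) k - coef (u j) k\<bar>) < e" using C by (simp add: field_simps)
        then show ?thesis using d[OF uF uF, of i j] by linarith
      qed
      then show "\<exists>N. \<forall>m\<ge>N. \<forall>n\<ge>N. d (u m) (u n) < e" by blast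
    qed
    moreover have "(\<lambda>j. a (coef (u j))) \<longlonglongrightarrow> m"
      unfolding ab[symmetric] by (rule continuous_on_tendsto_compose[OF a lim bb]) (use box uF in auto)
    moreover have "lim (\<lambda>j. ip (coef (u j)) w) = y"
      unfolding y by (rule limI, rule continuous_on_tendsto_compose[OF cont lim bb]) (use box uF in auto)
    ultimately show "y \<in> ?L" by blast
  qed
qed

text \<open>By continuity, a countable dense subset of \<open>M\<close> gives the same supremum.\<close>

lemma SUP_ip_measurable:
  assumes M: "M \<subseteq> box_seq \<beta>" "M \<noteq> {}"
    and V: "\<And>k. (\<lambda>\<omega>. V \<omega> k) \<in> borel_measurable N" "\<And>\<omega>. summable (\<lambda>k. \<beta> k * \<bar>V \<omega> k\<bar>)"
  shows "(\<lambda>\<omega>. SUP b\<in>M. ip b (V \<omega>)) \<in> borel_measurable N"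
proof -
  obtain D where D: "countable D" "D \<subseteq> M" "M \<subseteq> closure D" by (rule separable)
  have Dne: "D \<noteq> {}" using D(3) M(2) by auto
  note [measurable] = V(1)
  have bdd: "bdd_above ((\<lambda>b. ip b (V \<omega>)) ` M)" "bdd_above ((\<lambda>b. ip b (V \<omega>)) ` D)" for \<omega>
    using D(2) M(1) by (intro bdd_above_ip[of _ \<beta>] V(2); auto)+
  have "(SUP b\<in>M. ip b (V \<omega>)) = (SUP b\<in>D. ip b (V \<omega>))" for \<omega>
  proof (rule antisym)
    have "closure D \<subseteq> box_seq \<beta>" using D(2) M(1) by (intro closure_minimal closed_box_seq) auto
    then have c: "continuous_on (closure D) (\<lambda>b. ip b (V \<omega>))"
      using continuous_on_subset[OF continuous_on_ip_left[OF V(2)]] by blast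
    have "(\<lambda>b. ip b (V \<omega>)) ` closure D \<subseteq> {..(SUP b\<in>D. ip b (V \<omega>))}"
      by (rule image_closure_subset[OF c]) (auto intro: cSUP_upper bdd(2))
    then show "(SUP b\<in>M. ip b (V \<omega>)) \<le> (SUP b\<in>D. ip b (V \<omega>))"
      using D(3) M(2) by (intro cSUP_least) auto
    show "(SUP b\<in>D. ip b (V \<omega>)) \<le> (SUP b\<in>M. ip b (V \<omega>))"
      using D(2) Dne by (intro cSUP_subset_mono bdd(1)) auto
  qed
  moreover have "(\<lambda>\<omega>. SUP b\<in>D. ip b (V \<omega>)) \<in> borel_measurable N"
    by (rule borel_measurable_cSUP[OF D(1) _ bdd(2)]) (simp add: ip_def)
  ultimately show ?thesis by simp
qed

section \<open>Expectations and standard deviations of series\<close>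

context expansion
begin

lemma expectation_series:
  assumes "b \<in> box_seq \<beta>"
  shows "expectation (series b) = ip b (\<lambda>k. expectation (\<phi> k))"
proof -
  note bm = bdd_\<phi>
  have i: "integrable M (\<lambda>x. b k * \<phi> k x)" for k using bdd_meas_integrable[OF prob_space_axioms bm] by simp
  have le: "\<bar>b k * \<phi> k x\<bar> \<le> \<beta> k" for k x
  proof -
    have "\<bar>b k\<bar> * \<bar>\<phi> k x\<bar> \<le> \<beta> k * 1" using box_seqD[OF assms, of k] bound_\<phi>[of k x] \<beta>_nonneg by (intro mult_mono) auto
    then show ?thesis by (simp add: abs_mult)
  qed
  have "(LINT x|M. (\<Sum>k. b k * \<phi> k x)) = (\<Sum>k. LINT x|M. b k * \<phi> k x)"
  proof (rule integral_suminf[OF i])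
    show "AE x in M. summable (\<lambda>k. norm (b k * \<phi> k x))"
      by (intro AE_I2 summable_comparison_test[OF _ sum_\<beta>]) (use le in auto)
    show "summable (\<lambda>k. LINT x|M. norm (b k * \<phi> k x))"
    proof (rule summable_comparison_test[OF _ sum_\<beta>], intro exI allI impI)
      fix k
      have "(LINT x|M. norm (b k * \<phi> k x)) \<le> (LINT x|M. \<beta> k)"
        using i le by (intro integral_mono) auto
      then show "norm (LINT x|M. norm (b k * \<phi> k x)) \<le> \<beta> k" by (simp add: prob_space)
    qed
  qed
  then show ?thesis by (simp add: series_def[abs_def] ip_def)
qed

lemma ip_normalized_sum:
  assumes b: "b \<in> box_seq \<beta>"
  shows "ip b (normalized_sum M \<phi> x n) = (\<Sum>i<n. series b (x i) - expectation (series b)) / sqrt (real n)"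
proof -
  let ?t = "\<lambda>i k. b k * (\<phi> k (x i) - expectation (\<phi> k))"
  have s1: "summable (\<lambda>k. b k * \<phi> k y)" for y using series_summable_bounded(1)[OF box_one[OF b]] .
  have s2: "summable (\<lambda>k. b k * expectation (\<phi> k))"
    by (rule summable_ip(1)[OF b summable_box[OF sum_\<beta> _ \<beta>_nonneg, of _ 1]]) (simp add: box_seq_def abs_expectation_\<phi>)
  have s: "summable (?t i)" for i using summable_diff[OF s1 s2] by (simp add: right_diff_distrib)
  have t: "(\<Sum>k. ?t i k) = series b (x i) - expectation (series b)" for i
    unfolding expectation_series[OF b] series_def ip_def by (subst suminf_diff[OF s1 s2]) (simp add: right_diff_distrib)
  have "ip b (normalized_sum M \<phi> x n) = (\<Sum>k. (\<Sum>i<n. ?t i k) / sqrt (real n))"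
    by (simp add: ip_def normalized_sum_def sum_distrib_left)
  also have "\<dots> = (\<Sum>k. (\<Sum>i<n. ?t i k)) / sqrt (real n)" by (rule suminf_divide) (intro summable_sum s)
  also have "(\<Sum>k. (\<Sum>i<n. ?t i k)) = (\<Sum>i<n. \<Sum>k. ?t i k)" by (rule suminf_sum) (rule s)
  finally show ?thesis unfolding t .
qed

lemma sqrt_V_le_l1:
  assumes "c \<in> box_seq (\<lambda>k. 2 * \<beta> k)" "summable (\<lambda>k. \<bar>c k\<bar>)"
  shows "sqrt (V c) \<le> (\<Sum>k. \<bar>c k\<bar>)"
proof -
  let ?s = "\<Sum>k. \<bar>c k\<bar>"
  have bm: "bdd_meas M (series c)" by (rule bdd_series[OF assms(1)])
  note i = bdd_meas_integrable[OF prob_space_axioms bm]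
    bdd_meas_integrable[OF prob_space_axioms bdd_meas_mult[OF bm bm], folded power2_eq_square]
  have le: "\<bar>series c x\<bar> \<le> ?s" for x
    unfolding series_def using summable_ip(2)[of c "\<lambda>k. \<bar>c k\<bar>" "\<lambda>k. \<phi> k x"] suminf_le[of "\<lambda>k. \<bar>c k\<bar> * \<bar>\<phi> k x\<bar>" "\<lambda>k. \<bar>c k\<bar>"]
      summable_box[OF assms(2) \<phi>_box, of x] assms(2) bound_\<phi>
    by (force simp: box_seq_def mult_left_le)
  have "V c \<le> expectation (\<lambda>x. (series c x)\<^sup>2)" unfolding V_def by (simp add: variance_eq[OF i])
  also have "\<dots> \<le> expectation (\<lambda>x. ?s\<^sup>2)"
    using i(2) power_mono[OF le abs_ge_zero, of _ 2] by (intro integral_mono) auto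
  finally have "V c \<le> ?s\<^sup>2" by (simp add: prob_space)
  moreover have "0 \<le> ?s" by (rule suminf_nonneg[OF assms(2)]) simp
  ultimately show ?thesis using real_sqrt_le_mono[of "V c" "?s\<^sup>2"] by simp
qed

end

lemma (in class_expansion) sd_dist_le_l1:
  assumes "f \<in> F" "g \<in> F" shows "sd_dist M f g \<le> (\<Sum>k. \<bar>coef f k - coef g k\<bar>)"
proof -
  note box = coef_box[OF assms(1)] coef_box[OF assms(2)]
  have "summable (\<lambda>k. \<bar>coef f k - coef g k\<bar>)"
    by (rule summable_comparison_test[OF _ summable_mult[OF sum_\<beta>, of 2]])
       (use box_seqD[OF box_sub[OF box]] in auto)
  then show ?thesis unfolding sd_dist_series[OF assms] by (intro sqrt_V_le_l1 box_sub box)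
qed

section \<open>Independent pairs\<close>

lemma (in prob_space) indep_var_char_add:
  assumes ind: "indep_var A X B Y" and [measurable]: "f \<in> borel_measurable A" "g \<in> borel_measurable B"
  shows "char (distr M borel (\<lambda>\<omega>. f (X \<omega>) + g (Y \<omega>))) t =
    char (distr M borel (\<lambda>\<omega>. f (X \<omega>))) t * char (distr M borel (\<lambda>\<omega>. g (Y \<omega>))) t"
proof -
  have "indep_var borel (f \<circ> X) borel (g \<circ> Y)" by (rule indep_var_compose[OF ind]) measurable
  then show ?thesis using char_distr_add[of "f \<circ> X" "g \<circ> Y" t] by (simp add: o_def)
qed

lemma embedded_law:
  assumes R: "prob_space R" and i: "inj i"
  shows "prob_space (embed_measure R i)" "inv i \<in> measurable (embed_measure R i) R"
    "distr (embed_measure R i) R (inv i) = R"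
proof -
  interpret R: prob_space R by fact
  have m1: "i \<in> measurable R (embed_measure R i)" by (rule measurable_embed_measure2[OF i])
  have e: "embed_measure R i = distr R (embed_measure R i) i" by (rule embed_measure_eq_distr[OF i])
  show "prob_space (embed_measure R i)" by (subst e) (rule R.prob_space_distr[OF m1])
  show m2: "inv i \<in> measurable (embed_measure R i) R"
    by (rule measurable_embed_measure1) (simp add: inv_f_f[OF i])
  have "distr (embed_measure R i) R (inv i) = distr (distr R (embed_measure R i) i) R (inv i)" by (subst e) (rule refl)
  also have "\<dots> = distr R R (inv i \<circ> i)" by (rule distr_distr[OF m2 m1])
  also have "\<dots> = R" unfolding inv_o_cancel[OF i] id_def by (rule distr_id2) simp
  finally show "distr (embed_measure R i) R (inv i) = R" .
qed

text \<open>Independent sequences live on a product of two spaces, whereas a space of functionals may be required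
as the sample space. An injection transports the product measure there.\<close>

lemma product_with_embedding:
  assumes "prob_space Q1" "prob_space Q2" and i: "inj i"
  defines "N \<equiv> embed_measure (Q1 \<Otimes>\<^sub>M Q2) i"
  shows "prob_space N" "distr N Q1 (\<lambda>\<omega>. fst (inv i \<omega>)) = Q1" "distr N Q2 (\<lambda>\<omega>. snd (inv i \<omega>)) = Q2"
    "prob_space.indep_var N Q1 (\<lambda>\<omega>. fst (inv i \<omega>)) Q2 (\<lambda>\<omega>. snd (inv i \<omega>))"
    "(\<lambda>\<omega>. fst (inv i \<omega>)) \<in> measurable N Q1" "(\<lambda>\<omega>. snd (inv i \<omega>)) \<in> measurable N Q2"
proof -
  interpret Q1: prob_space Q1 by fact
  interpret Q2: prob_space Q2 by fact
  interpret P: pair_prob_space Q1 Q2 ..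
  interpret P': pair_prob_space Q2 Q1 ..
  note e = embedded_law[OF P.prob_space_axioms i, folded N_def]
  show "prob_space N" by (rule e(1))
  then interpret N: prob_space N .
  note [measurable] = e(2)
  show m1: "(\<lambda>\<omega>. fst (inv i \<omega>)) \<in> measurable N Q1" by measurable
  show m2: "(\<lambda>\<omega>. snd (inv i \<omega>)) \<in> measurable N Q2" by measurable
  have "distr (distr N (Q1 \<Otimes>\<^sub>M Q2) (inv i)) Q1 fst = distr N Q1 (fst \<circ> inv i)" by (rule distr_distr) measurable
  then show d1: "distr N Q1 (\<lambda>\<omega>. fst (inv i \<omega>)) = Q1"
    unfolding e(3) Q2.distr_pair_fst by (simp add: o_def)
  have sndm: "distr (Q1 \<Otimes>\<^sub>M Q2) Q2 snd = Q2"
  proof -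
    have "distr (Q1 \<Otimes>\<^sub>M Q2) Q2 snd = distr (distr (Q2 \<Otimes>\<^sub>M Q1) (Q1 \<Otimes>\<^sub>M Q2) (\<lambda>(x, y). (y, x))) Q2 snd"
      by (subst P.distr_pair_swap) (rule refl)
    also have "\<dots> = distr (Q2 \<Otimes>\<^sub>M Q1) Q2 (snd \<circ> (\<lambda>(x, y). (y, x)))" by (rule distr_distr) measurable
    also have "\<dots> = distr (Q2 \<Otimes>\<^sub>M Q1) Q2 fst" by (rule distr_cong) auto
    finally show ?thesis by (simp add: Q1.distr_pair_fst)
  qed
  have "distr (distr N (Q1 \<Otimes>\<^sub>M Q2) (inv i)) Q2 snd = distr N Q2 (snd \<circ> inv i)" by (rule distr_distr) measurable
  then show d2: "distr N Q2 (\<lambda>\<omega>. snd (inv i \<omega>)) = Q2"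
    unfolding e(3) sndm by (simp add: o_def)
  show "N.indep_var Q1 (\<lambda>\<omega>. fst (inv i \<omega>)) Q2 (\<lambda>\<omega>. snd (inv i \<omega>))"
    unfolding N.indep_var_distribution_eq d1 d2 using m1 m2 e(3) by simp
qed

lemma gauss_coords_distr:
  assumes "gauss_coords Q M \<phi> W" "p \<in> measurable N Q" "distr N Q p = Q"
  shows "gauss_coords N M \<phi> (\<lambda>\<omega>. W (p \<omega>))"
proof -
  have [measurable]: "(\<lambda>\<omega>. W \<omega> k) \<in> borel_measurable Q" for k by (rule gauss_coords_measurable[OF assms(1)])
  note [measurable] = assms(2)
  have "distr N borel (\<lambda>\<omega>. \<Sum>k<K. t k * W (p \<omega>) k) = distr Q borel (\<lambda>\<omega>. \<Sum>k<K. t k * W \<omega> k)" for t K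
  proof -
    have "distr (distr N Q p) borel (\<lambda>\<omega>. \<Sum>k<K. t k * W \<omega> k) = distr N borel ((\<lambda>\<omega>. \<Sum>k<K. t k * W \<omega> k) \<circ> p)"
      by (rule distr_distr) measurable
    then show ?thesis by (simp add: assms(3) o_def)
  qed
  then show ?thesis using assms(1) unfolding gauss_coords_def has_gauss_def by simp
qed

section \<open>The limit theorem\<close>

lemma (in prob_space) indep_vars_cong_sets:
  assumes "indep_vars (\<lambda>_. A) X I" "sets A = sets B"
  shows "indep_vars (\<lambda>_. B) X I"
  using assms(1) unfolding indep_vars_def2 assms(2) by (simp add: measurable_cong_sets[OF refl assms(2)])

text \<open>Both limits are instances of \<open>sup_functional_limit\<close> for the same set \<open>A\<close> of coefficient sequences and
the same functional \<open>a\<close>. In the two-sample case the coordinates are differences, and independence of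
the samples, like independence of the bridges, makes the characteristic functions factorise.\<close>

theorem theorem6:
  fixes \<kappa> :: "real ^ 'n \<Rightarrow> real" and S :: "(real ^ 'n) set" and \<sigma> :: real
    and \<mu> \<nu> :: "(real ^ 'n) measure"
    and P :: "'w measure" and X Y :: "nat \<Rightarrow> 'w \<Rightarrow> real ^ 'n"
  assumes "smoothing_kernel \<kappa>" and "compact S" and "\<sigma> > 0"
    and "\<mu> \<in> prob_measures_on S" and "\<nu> \<in> prob_measures_on S"
    and "prob_space P"
    and "prob_space.indep_vars P (\<lambda>_. borel) X UNIV" and "\<And>i. distr P borel (X i) = \<mu>"
    and "prob_space.indep_vars P (\<lambda>_. borel) Y UNIV" and "\<And>i. distr P borel (Y i) = \<nu>"
    and "prob_space.indep_var P (PiM UNIV (\<lambda>_. borel)) (\<lambda>\<omega> i. X i \<omega>)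
                                (PiM UNIV (\<lambda>_. borel)) (\<lambda>\<omega> i. Y i \<omega>)"
  shows "\<exists>(N :: (((real ^ 'n \<Rightarrow> real) \<Rightarrow> real) \<times> ((real ^ 'n \<Rightarrow> real) \<Rightarrow> real)) measure) G G'.
           tight_brownian_bridge N \<mu> (smoothed_Lip \<kappa> \<sigma>) G \<and>
           tight_brownian_bridge N \<nu> (smoothed_Lip \<kappa> \<sigma>) G' \<and>
           prob_space.indep_var N (borel_of_metric (linf (smoothed_Lip \<kappa> \<sigma>))) G
                                  (borel_of_metric (linf (smoothed_Lip \<kappa> \<sigma>))) G' \<and>
           conv_in_distr
             P (\<lambda>n \<omega>. sqrt (real n) *
                  (smooth_wasserstein1 \<kappa> \<sigma> (empirical_measure n (\<lambda>i. X i \<omega>)) \<nu>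
                   - smooth_wasserstein1 \<kappa> \<sigma> \<mu> \<nu>))
             N (\<lambda>\<omega>. SUP u\<in>optimal_potentials1 \<kappa> \<sigma> \<mu> \<nu>. completion_ext (G \<omega>) u) \<and>
           conv_in_distr
             P (\<lambda>n \<omega>. sqrt (real n) *
                  (smooth_wasserstein1 \<kappa> \<sigma> (empirical_measure n (\<lambda>i. X i \<omega>))
                                              (empirical_measure n (\<lambda>i. Y i \<omega>))
                   - smooth_wasserstein1 \<kappa> \<sigma> \<mu> \<nu>))
             N (\<lambda>\<omega>. SUP u\<in>optimal_potentials2 \<kappa> \<sigma> \<mu> \<nu>.
                  completion_ext (G \<omega>) u - completion_ext (G' \<omega>) u)"
proof -
  interpret smoothing \<kappa> \<sigma> using assms by unfold_locales
  interpret P: prob_space P by fact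
  have \<mu>: "prob_space \<mu>" "sets \<mu> = sets borel" and \<nu>: "prob_space \<nu>" "sets \<nu> = sets borel"
    using assms(4,5) by (auto simp: prob_measures_on_def)
  note [measurable_cong] = \<mu>(2) \<nu>(2)
  obtain R where R: "R \<ge> 0" "\<And>x. x \<in> S \<Longrightarrow> norm x \<le> R"
  proof -
    obtain B where "\<And>x. x \<in> S \<Longrightarrow> norm x \<le> B"
      using compact_imp_bounded[OF assms(2)] unfolding bounded_iff by blast
    then show ?thesis by (intro that[of "max 0 B"]) (auto intro: max.coboundedI2)
  qed
  have AE\<mu>: "AE x in \<mu>. norm x \<le> R"
    using AE_in_support[OF assms(4)] by (rule eventually_mono) (rule R(2))
  have AE\<nu>: "AE x in \<nu>. norm x \<le> R"
    using AE_in_support[OF assms(5)] by (rule eventually_mono) (rule R(2))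
  let ?F = "smoothed_Lip \<kappa> \<sigma>"
  obtain \<phi> :: "nat \<Rightarrow> real ^ 'n \<Rightarrow> real" and \<beta> coef
    where \<phi>[measurable]: "\<And>j. \<phi> j \<in> borel_measurable borel" and \<phi>1: "\<And>j x. \<bar>\<phi> j x\<bar> \<le> 1"
      and \<beta>: "\<And>j. 0 < \<beta> j" "summable \<beta>"
      and coef: "\<And>f. f \<in> ?F \<Longrightarrow> coef f \<in> box_seq \<beta>"
      and rep: "\<And>f x. f \<in> ?F \<Longrightarrow> norm x \<le> R \<Longrightarrow> f x = ip (coef f) (\<lambda>j. \<phi> j x)"
    by (rule nuclear_expansion[OF R(1)]) (rule that)
  have \<beta>0: "0 \<le> \<beta> k" for k using \<beta>(1)[of k] by simp
  obtain \<gamma> \<epsilon> where \<gamma>: "\<And>k. \<beta> k \<le> \<gamma> k" "summable \<gamma>" and \<epsilon>: "\<And>n k. n \<le> k \<Longrightarrow> \<beta> k \<le> \<epsilon> n * \<gamma> k" "\<epsilon> \<longlonglongrightarrow> 0"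
    by (rule slower_summable_weights[OF \<beta>]) (rule that)
  interpret Mu: expansion \<mu> \<phi> \<beta>
    using \<mu> \<phi>1 \<beta> by (intro expansion.intro expansion_axioms.intro) auto
  interpret Nu: expansion \<nu> \<phi> \<beta>
    using \<nu> \<phi>1 \<beta> by (intro expansion.intro expansion_axioms.intro) auto
  interpret Mu: class_expansion \<mu> \<phi> \<beta> ?F coef
  proof
    show "?F \<noteq> {}" by (rule smoothed_Lip_nonempty)
    show "f \<in> borel_measurable \<mu>" if "f \<in> ?F" for f using smoothed_Lip_lipschitz(2)[OF that] by simp
    show "AE x in \<mu>. f x = Mu.series (coef f) x" if "f \<in> ?F" for f
      using AE\<mu> by eventually_elim (simp add: Mu.series_def rep[OF that])
  qed (rule coef)
  interpret Nu: class_expansion \<nu> \<phi> \<beta> ?F coef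
  proof
    show "?F \<noteq> {}" by (rule smoothed_Lip_nonempty)
    show "f \<in> borel_measurable \<nu>" if "f \<in> ?F" for f using smoothed_Lip_lipschitz(2)[OF that] by simp
    show "AE x in \<nu>. f x = Nu.series (coef f) x" if "f \<in> ?F" for f
      using AE\<nu> by eventually_elim (simp add: Nu.series_def rep[OF that])
  qed (rule coef)
  obtain Q1 :: "(nat \<Rightarrow> real) measure" and W1 where Q1: "prob_space Q1" "gauss_coords Q1 \<mu> \<phi> W1" "\<And>\<omega>. Mu.regular \<gamma> (W1 \<omega>)"
    by (rule Mu.regular_coords_exist[OF \<gamma>]) (rule that)
  obtain Q2 :: "(nat \<Rightarrow> real) measure" and W2 where Q2: "prob_space Q2" "gauss_coords Q2 \<nu> \<phi> W2" "\<And>\<omega>. Nu.regular \<gamma> (W2 \<omega>)"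
    by (rule Nu.regular_coords_exist[OF \<gamma>]) (rule that)
  (* An injection of sequences into functionals on functions: the constant functions with values
     0, 1, 2, ... recover the coordinates. *)
  define \<iota>0 :: "(nat \<Rightarrow> real) \<Rightarrow> (real ^ 'n \<Rightarrow> real) \<Rightarrow> real" where "\<iota>0 w h = w (nat \<lfloor>h 0\<rfloor>)" for w h
  define \<iota> where "\<iota> z = (\<iota>0 (fst z), \<iota>0 (snd z))" for z
  have "inj \<iota>0"
  proof (rule injI, rule ext)
    fix v w :: "nat \<Rightarrow> real" and k assume "\<iota>0 v = \<iota>0 w"
    then have "\<iota>0 v (\<lambda>_. real k) = \<iota>0 w (\<lambda>_. real k)" by simp
    then show "v k = w k" by (simp add: \<iota>0_def)
  qed
  then have \<iota>: "inj \<iota>" by (auto simp: inj_on_def \<iota>_def prod_eq_iff)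
  define N where "N = embed_measure (Q1 \<Otimes>\<^sub>M Q2) \<iota>"
  define p1 where "p1 \<omega> = fst (inv \<iota> \<omega>)" for \<omega>
  define p2 where "p2 \<omega> = snd (inv \<iota> \<omega>)" for \<omega>
  note Np = product_with_embedding[OF Q1(1) Q2(1) \<iota>, folded N_def p1_def p2_def]
  interpret N: prob_space N by (rule Np(1))
  define W where "W \<omega> = W1 (p1 \<omega>)" for \<omega>
  define W' where "W' \<omega> = W2 (p2 \<omega>)" for \<omega>
  have gW: "gauss_coords N \<mu> \<phi> W" unfolding W_def by (rule gauss_coords_distr[OF Q1(2) Np(5,2)])
  have gW': "gauss_coords N \<nu> \<phi> W'" unfolding W'_def by (rule gauss_coords_distr[OF Q2(2) Np(6,3)])
  interpret B: bridge \<mu> \<phi> \<beta> ?F coef N W \<gamma> \<epsilon>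
    by (rule bridge.intro[OF Mu.class_expansion_axioms], rule bridge_axioms.intro,
        rule Np(1), rule gW, simp only: W_def, rule Q1(3), rule \<gamma>(1), erule \<epsilon>(1), rule \<epsilon>(2))
  interpret B': bridge \<nu> \<phi> \<beta> ?F coef N W' \<gamma> \<epsilon>
    by (rule bridge.intro[OF Nu.class_expansion_axioms], rule bridge_axioms.intro,
        rule Np(1), rule gW', simp only: W'_def, rule Q2(3), rule \<gamma>(1), erule \<epsilon>(1), rule \<epsilon>(2))
  interpret B1: bridge \<mu> \<phi> \<beta> ?F coef Q1 W1 \<gamma> \<epsilon>
    by (rule bridge.intro[OF Mu.class_expansion_axioms], rule bridge_axioms.intro,
        rule Q1(1), rule Q1(2), rule Q1(3), rule \<gamma>(1), erule \<epsilon>(1), rule \<epsilon>(2))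
  interpret B2: bridge \<nu> \<phi> \<beta> ?F coef Q2 W2 \<gamma> \<epsilon>
    by (rule bridge.intro[OF Nu.class_expansion_axioms], rule bridge_axioms.intro,
        rule Q2(1), rule Q2(2), rule Q2(3), rule \<gamma>(1), erule \<epsilon>(1), rule \<epsilon>(2))
  define G where "G \<omega> = Mu.path (W \<omega>)" for \<omega>
  define G' where "G' \<omega> = Nu.path (W' \<omega>)" for \<omega>
  have bridges: "tight_brownian_bridge N \<mu> ?F G" "tight_brownian_bridge N \<nu> ?F G'"
    unfolding G_def G'_def by (rule B.bridge_path, rule B'.bridge_path)
  have indep: "N.indep_var (borel_of_metric (linf ?F)) G (borel_of_metric (linf ?F)) G'"
    using N.indep_var_compose[OF Np(4) B1.path_measurable B2.path_measurable]
    by (simp add: G_def[abs_def] G'_def[abs_def] W_def W'_def o_def)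

  (* The functional \<mu> - \<nu> in coordinates. *)
  define d where "d k = (LINT x|\<mu>. \<phi> k x) - (LINT x|\<nu>. \<phi> k x)" for k
  define a where "a b = ip b d" for b
  define m where "m = smooth_wasserstein1 \<kappa> \<sigma> \<mu> \<nu>"
  define A where "A = coef ` ?F"
  define M where "M = {b \<in> closure A. a b = m}"
  have d2: "d \<in> box_seq (\<lambda>_. 2)"
    unfolding box_seq_def
  proof (intro CollectI allI)
    show "\<bar>d k\<bar> \<le> 2" for k
      using Mu.abs_expectation_\<phi>[of k] Nu.abs_expectation_\<phi>[of k] unfolding d_def by linarith
  qed
  have sd: "summable (\<lambda>k. \<beta> k * \<bar>d k\<bar>)" by (rule summable_box[OF \<beta>(2) d2 \<beta>0])
  have a_cont: "continuous_on (box_seq \<beta>) a" unfolding a_def by (rule continuous_on_ip_left[OF sd])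
  have int\<mu>: "(LINT x|\<mu>. f x) = ip (coef f) (\<lambda>k. LINT x|\<mu>. \<phi> k x)" "integrable \<mu> f" if f: "f \<in> ?F" for f
  proof -
    note [measurable] = smoothed_Lip_lipschitz(2)[OF f]
    have "(LINT x|\<mu>. f x) = (LINT x|\<mu>. Mu.series (coef f) x)"
      using Mu.repr[OF f] by (intro integral_cong_AE) measurable
    then show "(LINT x|\<mu>. f x) = ip (coef f) (\<lambda>k. LINT x|\<mu>. \<phi> k x)" by (simp add: Mu.expectation_series[OF coef[OF f]])
    have "integrable \<mu> (Mu.series (coef f))"
      by (rule bdd_meas_integrable[OF \<mu>(1) Mu.bdd_series[OF Mu.box_one[OF coef[OF f]]]])
    then show "integrable \<mu> f"
      using Mu.repr[OF f] by (subst integrable_cong_AE[of f \<mu> "Mu.series (coef f)"]) simp_all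
  qed
  have int\<nu>: "(LINT x|\<nu>. f x) = ip (coef f) (\<lambda>k. LINT x|\<nu>. \<phi> k x)" if f: "f \<in> ?F" for f
  proof -
    note [measurable] = smoothed_Lip_lipschitz(2)[OF f]
    have "(LINT x|\<nu>. f x) = (LINT x|\<nu>. Nu.series (coef f) x)"
      using Nu.repr[OF f] by (intro integral_cong_AE) measurable
    then show ?thesis by (simp add: Nu.expectation_series[OF coef[OF f]])
  qed
  have a_coef: "a (coef f) = (LINT x|\<mu>. f x) - (LINT x|\<nu>. f x)" if f: "f \<in> ?F" for f
  proof -
    have s: "summable (\<lambda>k. coef f k * (LINT x|\<mu>. \<phi> k x))" "summable (\<lambda>k. coef f k * (LINT x|\<nu>. \<phi> k x))"
      by (rule summable_ip(1)[OF coef[OF f] summable_box[OF \<beta>(2) _ \<beta>0, of _ 1]];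
          simp add: box_seq_def Mu.abs_expectation_\<phi> Nu.abs_expectation_\<phi>)+
    show ?thesis
      unfolding int\<mu>(1)[OF f] int\<nu>[OF f] a_def ip_def d_def
      by (subst suminf_diff[OF s]) (simp add: right_diff_distrib)
  qed
  note dual = smooth_wasserstein1_dual[OF \<mu> AE\<mu> \<nu> AE\<nu>]
  have m_SUP: "m = (SUP b\<in>A. a b)"
    unfolding m_def dual(1) A_def image_image by (rule SUP_cong[OF refl]) (simp add: a_coef)
  have A: "A \<subseteq> box_seq \<beta>" "A \<noteq> {}" using coef smoothed_Lip_nonempty by (auto simp: A_def)
  note mx = maximizers_nonempty[OF A a_cont, folded m_SUP]
  have M: "M \<subseteq> box_seq \<beta>" "M \<noteq> {}" using mx(1,4) by (auto simp: M_def)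

  (* The empirical processes of the two samples in coordinates. *)
  define UX where "UX n \<omega> = normalized_sum \<mu> \<phi> (\<lambda>i. X i \<omega>) n" for n \<omega>
  define UY where "UY n \<omega> = normalized_sum \<nu> \<phi> (\<lambda>i. Y i \<omega>) n" for n \<omega>
  have X: "P.indep_vars (\<lambda>_. \<mu>) X UNIV" by (rule P.indep_vars_cong_sets[OF assms(7)]) (simp add: \<mu>)
  have Y: "P.indep_vars (\<lambda>_. \<nu>) Y UNIV" by (rule P.indep_vars_cong_sets[OF assms(9)]) (simp add: \<nu>)
  have lawX: "distr P \<mu> (X i) = \<mu>" and lawY: "distr P \<nu> (Y i) = \<nu>" for i
    using assms(8)[of i] assms(10)[of i] distr_cong[OF refl \<mu>(2), of P "X i" "X i"] distr_cong[OF refl \<nu>(2), of P "Y i" "Y i"]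
    by simp_all
  note iidX = P.prob_space_axioms X lawX and iidY = P.prob_space_axioms Y lawY
  have X_meas[measurable]: "X i \<in> borel_measurable P" and Y_meas[measurable]: "Y i \<in> borel_measurable P" for i
    using assms(7,9) by (auto simp: P.indep_vars_def2)
  have UX_meas: "(\<lambda>\<omega>. UX n \<omega> k) \<in> borel_measurable P" for n k unfolding UX_def by (rule Mu.normalized_sum_measurable[OF iidX])
  have UY_meas: "(\<lambda>\<omega>. UY n \<omega> k) \<in> borel_measurable P" for n k unfolding UY_def by (rule Nu.normalized_sum_measurable[OF iidY])
  note UX2 = Mu.normalized_sum_second_moment[OF iidX, folded UX_def]
  note UY2 = Nu.normalized_sum_second_moment[OF iidY, folded UY_def]
  note W2m = Mu.gauss_coords_second_moment[OF Np(1) gW] and W2m' = Nu.gauss_coords_second_moment[OF Np(1) gW']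
  have bX: "AE \<omega> in P. \<forall>i. norm (X i \<omega>) \<le> R" "AE \<omega> in P. \<forall>i. norm (Y i \<omega>) \<le> R"
  proof -
    have "AE \<omega> in P. norm (X i \<omega>) \<le> R" for i
      by (rule AE_distrD[OF X_meas]) (simp only: assms(8) AE\<mu>)
    moreover have "AE \<omega> in P. norm (Y i \<omega>) \<le> R" for i
      by (rule AE_distrD[OF Y_meas]) (simp only: assms(10) AE\<nu>)
    ultimately show "AE \<omega> in P. \<forall>i. norm (X i \<omega>) \<le> R" "AE \<omega> in P. \<forall>i. norm (Y i \<omega>) \<le> R"
      by (simp_all add: AE_all_countable)
  qed
  have ipX: "ip (coef f) (normalized_sum \<mu> \<phi> x n) = sqrt (real n) * ((\<Sum>i<n. f (x i)) / real n - (LINT y|\<mu>. f y))"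
    and ipY: "ip (coef f) (normalized_sum \<nu> \<phi> x n) = sqrt (real n) * ((\<Sum>i<n. f (x i)) / real n - (LINT y|\<nu>. f y))"
    if f: "f \<in> ?F" and n: "n \<ge> 1" and x: "\<And>i. norm (x i) \<le> R" for f n x
  proof -
    have key: "(\<Sum>i<n. f (x i) - c) / sqrt (real n) = sqrt (real n) * ((\<Sum>i<n. f (x i)) / real n - c)" for c
    proof -
      have "(\<Sum>i<n. f (x i) - c) = sqrt (real n) * sqrt (real n) * ((\<Sum>i<n. f (x i)) / real n - c)"
        using n by (simp add: sum_subtractf field_simps)
      then show ?thesis using n by (simp add: field_simps)
    qed
    show "ip (coef f) (normalized_sum \<mu> \<phi> x n) = sqrt (real n) * ((\<Sum>i<n. f (x i)) / real n - (LINT y|\<mu>. f y))"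
      unfolding Mu.ip_normalized_sum[OF coef[OF f]] Mu.expectation_series[OF coef[OF f]] int\<mu>(1)[OF f] key[symmetric]
      by (simp add: Mu.series_def rep[OF f x])
    show "ip (coef f) (normalized_sum \<nu> \<phi> x n) = sqrt (real n) * ((\<Sum>i<n. f (x i)) / real n - (LINT y|\<nu>. f y))"
      unfolding Nu.ip_normalized_sum[OF coef[OF f]] Nu.expectation_series[OF coef[OF f]] int\<nu>[OF f] key[symmetric]
      by (simp add: Nu.series_def rep[OF f x])
  qed

  have conv1: "conv_in_distr P
     (\<lambda>n \<omega>. sqrt (real n) * (smooth_wasserstein1 \<kappa> \<sigma> (empirical_measure n (\<lambda>i. X i \<omega>)) \<nu> - m))
     N (\<lambda>\<omega>. SUP u\<in>optimal_potentials1 \<kappa> \<sigma> \<mu> \<nu>. completion_ext (G \<omega>) u)"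
  proof (rule sup_functional_limit[where U = UX and V = W and C = 1 and \<beta> = \<beta> and A = A and a = a and m = m and M = M])
    show "fdd_conv P UX N W"
      unfolding fdd_conv_def UX_def
    proof (intro allI)
      fix K and t :: "nat \<Rightarrow> real"
      have "char (distr N borel (\<lambda>\<omega>. \<Sum>k<K. t k * W \<omega> k)) 1 =
          complex_of_real (exp (- Mu.variance (\<lambda>x. \<Sum>k<K. t k * \<phi> k x) / 2))"
        using gW unfolding gauss_coords_def has_gauss_def by simp
      then show "(\<lambda>n. char (distr P borel (\<lambda>\<omega>. \<Sum>k<K. t k * normalized_sum \<mu> \<phi> (\<lambda>i. X i \<omega>) n k)) 1)
          \<longlonglongrightarrow> char (distr N borel (\<lambda>\<omega>. \<Sum>k<K. t k * W \<omega> k)) 1"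
        using Mu.normalized_sum_char[OF iidX, of t K] by simp
    qed
    show "(\<lambda>\<omega>. sqrt (real n) * (smooth_wasserstein1 \<kappa> \<sigma> (empirical_measure n (\<lambda>i. X i \<omega>)) \<nu> - m)) \<in> borel_measurable P" for n
      by (rule empirical_measurable(1)[OF X_meas Y_meas \<nu> AE\<nu>])
    show "AE \<omega> in P. sqrt (real n) * (smooth_wasserstein1 \<kappa> \<sigma> (empirical_measure n (\<lambda>i. X i \<omega>)) \<nu> - m) =
        (SUP b\<in>A. sqrt (real n) * (a b - m) + ip b (UX n \<omega>))" if n: "n \<ge> 1" for n
      using bX(1)
    proof eventually_elim
      case (elim \<omega>)
      have "sqrt (real n) * (smooth_wasserstein1 \<kappa> \<sigma> (empirical_measure n (\<lambda>i. X i \<omega>)) \<nu> - m) =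
          (SUP f\<in>?F. sqrt (real n) * ((\<Sum>i<n. f (X i \<omega>)) / real n - (LINT y|\<nu>. f y) - m))"
        unfolding one_sample_dual(1)[OF n \<nu> AE\<nu>]
        by (rule SUP_affine[OF smoothed_Lip_nonempty one_sample_dual(2)[OF n \<nu> AE\<nu>]]) (use n in simp)
      also have "\<dots> = (SUP f\<in>?F. sqrt (real n) * (a (coef f) - m) + ip (coef f) (UX n \<omega>))"
        using elim n by (intro SUP_cong refl) (simp add: a_coef UX_def ipX[OF _ n] algebra_simps)
      finally show ?case by (simp add: A_def image_image)
    qed
    have eq: "(SUP u\<in>optimal_potentials1 \<kappa> \<sigma> \<mu> \<nu>. completion_ext (G \<omega>) u) = (SUP b\<in>M. ip b (W \<omega>))" for \<omega>
    proof -
      let ?OP = "{u \<in> pseudo_completion (sd_dist \<mu>) ?F. (\<lambda>j. a (coef (u j))) \<longlonglongrightarrow> m}"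
      have uF: "u j \<in> ?F" if "u \<in> pseudo_completion (sd_dist \<mu>) ?F" for u j
        using that by (auto simp: pseudo_completion_def)
      have lint: "(LINT x|\<mu>. (u k x - (LINT y|\<nu>. u k y))) = a (coef (u k))" if "u k \<in> ?F" for u :: "nat \<Rightarrow> real ^ 'n \<Rightarrow> real" and k
        using int\<mu>(2)[OF that] a_coef[OF that] by (simp add: Mu.prob_space)
      (* Optimality in the completion is convergence of a along the coefficient sequences. *)
      have "optimal_potentials1 \<kappa> \<sigma> \<mu> \<nu> = ?OP"
        unfolding optimal_potentials1_def m_def
      proof (intro Collect_cong conj_cong refl)
        fix u assume "u \<in> pseudo_completion (sd_dist \<mu>) ?F"
        then have "(\<lambda>k. LINT x|\<mu>. (u k x - (LINT y|\<nu>. u k y))) = (\<lambda>k. a (coef (u k)))"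
          using lint[of u] uF by (intro ext) simp
        then show "((\<lambda>k. LINT x|\<mu>. (u k x - (LINT y|\<nu>. u k y))) \<longlonglongrightarrow> smooth_wasserstein1 \<kappa> \<sigma> \<mu> \<nu>) =
            ((\<lambda>j. a (coef (u j))) \<longlonglongrightarrow> smooth_wasserstein1 \<kappa> \<sigma> \<mu> \<nu>)" by simp
      qed
      moreover have "completion_ext (G \<omega>) u = lim (\<lambda>j. ip (coef (u j)) (W \<omega>))" if "u \<in> ?OP" for u
        using that uF by (simp add: completion_ext_def G_def Mu.path_def)
      ultimately have "completion_ext (G \<omega>) ` optimal_potentials1 \<kappa> \<sigma> \<mu> \<nu> = (\<lambda>u. lim (\<lambda>j. ip (coef (u j)) (W \<omega>))) ` ?OP"
        by (simp cong: image_cong_simp)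
      also have "\<dots> = (\<lambda>b. ip b (W \<omega>)) ` M"
        unfolding M_def A_def
      proof (rule potentials_image(1)[OF coef \<beta>0 \<beta>(2) B.W_summable(2) _ _ zero_less_one a_cont])
        show "\<exists>\<delta>>0. \<forall>f\<in>?F. \<forall>g\<in>?F. sd_dist \<mu> f g < \<delta> \<longrightarrow> \<bar>ip (coef f) (W \<omega>) - ip (coef g) (W \<omega>)\<bar> < e" if "e > 0" for e
          using B.path_uniformly_continuous[OF that, of \<omega>] by (simp add: Mu.path_def)
        show "sd_dist \<mu> f g \<le> 1 * (\<Sum>k. \<bar>coef f k - coef g k\<bar>)" if "f \<in> ?F" "g \<in> ?F" for f g
          using Mu.sd_dist_le_l1[OF that] by simp
      qed
      finally show ?thesis by simp
    qed
    show "(\<lambda>\<omega>. SUP u\<in>optimal_potentials1 \<kappa> \<sigma> \<mu> \<nu>. completion_ext (G \<omega>) u) \<in> borel_measurable N"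
      unfolding eq by (rule SUP_ip_measurable[OF M B.W_meas B.W_summable(2)])
    show "AE \<omega> in N. (SUP u\<in>optimal_potentials1 \<kappa> \<sigma> \<mu> \<nu>. completion_ext (G \<omega>) u) = (SUP b\<in>M. ip b (W \<omega>))"
      unfolding eq by simp
  qed (fact P.prob_space_axioms Np(1) UX_meas B.W_meas UX2 W2m \<beta>0 \<beta>(2) A a_cont m_SUP M_def)+

  define UD where "UD n \<omega> k = UX n \<omega> k - UY n \<omega> k" for n \<omega> k
  define WD where "WD \<omega> k = W \<omega> k - W' \<omega> k" for \<omega> k
  have WD_sum: "summable (\<lambda>k. \<beta> k * \<bar>WD \<omega> k\<bar>)" for \<omega>
    unfolding WD_def by (rule summable_weighted_diff[OF \<beta>0 B.W_summable(2) B'.W_summable(2)])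
  have WD_meas: "(\<lambda>\<omega>. WD \<omega> k) \<in> borel_measurable N" for k
    unfolding WD_def using B.W_meas B'.W_meas by (intro borel_measurable_diff)
  have ip_WD: "ip b (WD \<omega>) = ip b (W \<omega>) - ip b (W' \<omega>)" if "b \<in> box_seq \<beta>" for b \<omega>
    unfolding ip_def WD_def
    by (subst suminf_diff[OF summable_ip(1)[OF that B.W_summable(2)] summable_ip(1)[OF that B'.W_summable(2)]])
       (simp add: right_diff_distrib)
  have second_moment_diff: "integrable Q (\<lambda>\<omega>. (u \<omega> - v \<omega>)\<^sup>2)" "(LINT \<omega>|Q. (u \<omega> - v \<omega>)\<^sup>2) \<le> 4"
    if [measurable]: "u \<in> borel_measurable Q" "v \<in> borel_measurable Q"
      and i: "integrable Q (\<lambda>\<omega>. (u \<omega>)\<^sup>2)" "integrable Q (\<lambda>\<omega>. (v \<omega>)\<^sup>2)"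
      and le: "(LINT \<omega>|Q. (u \<omega>)\<^sup>2) \<le> 1" "(LINT \<omega>|Q. (v \<omega>)\<^sup>2) \<le> 1"
    for Q :: "'q measure" and u v :: "'q \<Rightarrow> real"
  proof -
    have pw: "(x - y)\<^sup>2 \<le> 2 * x\<^sup>2 + 2 * y\<^sup>2" for x y :: real
      using zero_le_power2[of "x + y"] by (simp add: power2_sum power2_diff)
    have i2: "integrable Q (\<lambda>\<omega>. 2 * (u \<omega>)\<^sup>2 + 2 * (v \<omega>)\<^sup>2)" using i by simp
    show i3: "integrable Q (\<lambda>\<omega>. (u \<omega> - v \<omega>)\<^sup>2)"
      by (rule Bochner_Integration.integrable_bound[OF i2]) (use pw in auto)
    have "(LINT \<omega>|Q. (u \<omega> - v \<omega>)\<^sup>2) \<le> (LINT \<omega>|Q. 2 * (u \<omega>)\<^sup>2 + 2 * (v \<omega>)\<^sup>2)"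
      by (rule integral_mono[OF i3 i2 pw])
    also have "\<dots> \<le> 4" using i le by simp
    finally show "(LINT \<omega>|Q. (u \<omega> - v \<omega>)\<^sup>2) \<le> 4" .
  qed

  have conv2: "conv_in_distr P
     (\<lambda>n \<omega>. sqrt (real n) * (smooth_wasserstein1 \<kappa> \<sigma> (empirical_measure n (\<lambda>i. X i \<omega>)) (empirical_measure n (\<lambda>i. Y i \<omega>)) - m))
     N (\<lambda>\<omega>. SUP u\<in>optimal_potentials2 \<kappa> \<sigma> \<mu> \<nu>. completion_ext (G \<omega>) u - completion_ext (G' \<omega>) u)"
  proof (rule sup_functional_limit[where U = UD and V = WD and C = 4 and \<beta> = \<beta> and A = A and a = a and m = m and M = M])
    show "(\<lambda>\<omega>. UD n \<omega> k) \<in> borel_measurable P" for n k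
      unfolding UD_def using UX_meas UY_meas by (intro borel_measurable_diff)
    show "integrable P (\<lambda>\<omega>. (UD n \<omega> k)\<^sup>2)" "(LINT \<omega>|P. (UD n \<omega> k)\<^sup>2) \<le> 4" for n k
      unfolding UD_def using second_moment_diff[OF UX_meas UY_meas UX2(1) UY2(1) UX2(2) UY2(2)] by auto
    show "integrable N (\<lambda>\<omega>. (WD \<omega> k)\<^sup>2)" "(LINT \<omega>|N. (WD \<omega> k)\<^sup>2) \<le> 4" for k
      unfolding WD_def using second_moment_diff[OF B.W_meas B'.W_meas W2m(1) W2m'(1) W2m(2) W2m'(2)] by auto
    show "fdd_conv P UD N WD"
      unfolding fdd_conv_def
    proof (intro allI)
      fix K and t :: "nat \<Rightarrow> real"
      have split: "(\<Sum>k<K. t k * (u k - v k)) = (\<Sum>k<K. t k * u k) + (\<Sum>k<K. - t k * v k)" for u v :: "nat \<Rightarrow> real"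
        by (simp add: right_diff_distrib sum_subtractf sum_negf)
      have charP: "char (distr P borel (\<lambda>\<omega>. \<Sum>k<K. t k * UD n \<omega> k)) 1 =
          char (distr P borel (\<lambda>\<omega>. \<Sum>k<K. t k * UX n \<omega> k)) 1 * char (distr P borel (\<lambda>\<omega>. \<Sum>k<K. - t k * UY n \<omega> k)) 1" for n
        unfolding UD_def split UX_def UY_def
        by (rule P.indep_var_char_add[OF assms(11), where f = "\<lambda>x. \<Sum>k<K. t k * normalized_sum \<mu> \<phi> x n k"
              and g = "\<lambda>x. \<Sum>k<K. - t k * normalized_sum \<nu> \<phi> x n k"])
           (unfold normalized_sum_def, measurable)
      have charN: "char (distr N borel (\<lambda>\<omega>. \<Sum>k<K. t k * WD \<omega> k)) 1 =
          char (distr N borel (\<lambda>\<omega>. \<Sum>k<K. t k * W \<omega> k)) 1 * char (distr N borel (\<lambda>\<omega>. \<Sum>k<K. - t k * W' \<omega> k)) 1"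
      proof -
        have [measurable]: "(\<lambda>\<omega>. W1 \<omega> k) \<in> borel_measurable Q1" "(\<lambda>\<omega>. W2 \<omega> k) \<in> borel_measurable Q2" for k
          by (rule B1.W_meas, rule B2.W_meas)
        show ?thesis
          unfolding WD_def split W_def W'_def
          by (rule N.indep_var_char_add[OF Np(4), where f = "\<lambda>\<omega>. \<Sum>k<K. t k * W1 \<omega> k" and g = "\<lambda>\<omega>. \<Sum>k<K. - t k * W2 \<omega> k"]) measurable
      qed
      have "char (distr N borel (\<lambda>\<omega>. \<Sum>k<K. t k * W \<omega> k)) 1 = complex_of_real (exp (- Mu.variance (\<lambda>x. \<Sum>k<K. t k * \<phi> k x) / 2))"
        using gW unfolding gauss_coords_def has_gauss_def by simp
      moreover have "char (distr N borel (\<lambda>\<omega>. \<Sum>k<K. (- t k) * W' \<omega> k)) 1 = complex_of_real (exp (- Nu.variance (\<lambda>x. \<Sum>k<K. (- t k) * \<phi> k x) / 2))"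
        using gW'[unfolded gauss_coords_def, rule_format, of "\<lambda>k. - t k" K] unfolding has_gauss_def by simp
      ultimately show "(\<lambda>n. char (distr P borel (\<lambda>\<omega>. \<Sum>k<K. t k * UD n \<omega> k)) 1) \<longlonglongrightarrow> char (distr N borel (\<lambda>\<omega>. \<Sum>k<K. t k * WD \<omega> k)) 1"
        unfolding charP charN UX_def UY_def
        using tendsto_mult[OF Mu.normalized_sum_char[OF iidX, of t K] Nu.normalized_sum_char[OF iidY, of "\<lambda>k. - t k" K]] by simp
    qed
    show "(\<lambda>\<omega>. sqrt (real n) * (smooth_wasserstein1 \<kappa> \<sigma> (empirical_measure n (\<lambda>i. X i \<omega>)) (empirical_measure n (\<lambda>i. Y i \<omega>)) - m)) \<in> borel_measurable P" for n
      by (rule empirical_measurable(2)[OF X_meas Y_meas \<nu> AE\<nu>])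
    show "AE \<omega> in P. sqrt (real n) * (smooth_wasserstein1 \<kappa> \<sigma> (empirical_measure n (\<lambda>i. X i \<omega>)) (empirical_measure n (\<lambda>i. Y i \<omega>)) - m) =
        (SUP b\<in>A. sqrt (real n) * (a b - m) + ip b (UD n \<omega>))" if n: "n \<ge> 1" for n
      using bX
        weighted_squares(2)[where U = "UX n" and C = 1, OF P.prob_space_axioms UX_meas \<beta>0 \<beta>(2) UX2]
        weighted_squares(2)[where U = "UY n" and C = 1, OF P.prob_space_axioms UY_meas \<beta>0 \<beta>(2) UY2]
    proof eventually_elim
      case (elim \<omega>)
      have ip_UD: "ip (coef f) (UD n \<omega>) = ip (coef f) (UX n \<omega>) - ip (coef f) (UY n \<omega>)" if "f \<in> ?F" for f
        unfolding ip_def UD_def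
        by (subst suminf_diff[OF summable_ip(1)[OF coef[OF that] elim(3)] summable_ip(1)[OF coef[OF that] elim(4)]])
           (simp add: right_diff_distrib)
      have "sqrt (real n) * (smooth_wasserstein1 \<kappa> \<sigma> (empirical_measure n (\<lambda>i. X i \<omega>)) (empirical_measure n (\<lambda>i. Y i \<omega>)) - m) =
          (SUP f\<in>?F. sqrt (real n) * ((\<Sum>i<n. f (X i \<omega>)) / real n - (\<Sum>i<n. f (Y i \<omega>)) / real n - m))"
        unfolding two_sample_dual(1)[OF n]
        by (rule SUP_affine[OF smoothed_Lip_nonempty two_sample_dual(2)[OF n]]) (use n in simp)
      also have "\<dots> = (SUP f\<in>?F. sqrt (real n) * (a (coef f) - m) + ip (coef f) (UD n \<omega>))"
        using elim n by (intro SUP_cong refl) (simp add: a_coef ip_UD UX_def UY_def ipX[OF _ n] ipY[OF _ n] algebra_simps)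
      finally show ?case by (simp add: A_def image_image)
    qed
    have eq: "(SUP u\<in>optimal_potentials2 \<kappa> \<sigma> \<mu> \<nu>. completion_ext (G \<omega>) u - completion_ext (G' \<omega>) u) = (SUP b\<in>M. ip b (WD \<omega>))" for \<omega>
    proof -
      let ?d = "\<lambda>f g. sd_dist \<mu> f g + sd_dist \<nu> f g"
      let ?OP = "{u \<in> pseudo_completion ?d ?F. (\<lambda>j. a (coef (u j))) \<longlonglongrightarrow> m}"
      have uF: "u j \<in> ?F" if "u \<in> pseudo_completion ?d ?F" for u j
        using that by (auto simp: pseudo_completion_def)
      have "optimal_potentials2 \<kappa> \<sigma> \<mu> \<nu> = ?OP"
        unfolding optimal_potentials2_def m_def
      proof (intro Collect_cong conj_cong refl)
        fix u assume "u \<in> pseudo_completion ?d ?F"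
        then have "(\<lambda>k. (LINT x|\<mu>. u k x) - (LINT x|\<nu>. u k x)) = (\<lambda>k. a (coef (u k)))"
          using uF by (intro ext) (simp add: a_coef)
        then show "((\<lambda>k. (LINT x|\<mu>. u k x) - (LINT x|\<nu>. u k x)) \<longlonglongrightarrow> smooth_wasserstein1 \<kappa> \<sigma> \<mu> \<nu>) =
            ((\<lambda>j. a (coef (u j))) \<longlonglongrightarrow> smooth_wasserstein1 \<kappa> \<sigma> \<mu> \<nu>)" by simp
      qed
      have d_le: "?d f g \<le> 2 * (\<Sum>k. \<bar>coef f k - coef g k\<bar>)" if "f \<in> ?F" "g \<in> ?F" for f g
        using Mu.sd_dist_le_l1[OF that] Nu.sd_dist_le_l1[OF that] by simp
      have sd0: "0 \<le> sd_dist \<mu> f g" "0 \<le> sd_dist \<nu> f g" if "f \<in> ?F" "g \<in> ?F" for f g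
        by (simp_all add: Mu.sd_dist_series[OF that] Nu.sd_dist_series[OF that] Mu.V_nonneg Nu.V_nonneg)
      have uc: "\<exists>\<delta>>0. \<forall>f\<in>?F. \<forall>g\<in>?F. ?d f g < \<delta> \<longrightarrow> \<bar>ip (coef f) (W \<omega>) - ip (coef g) (W \<omega>)\<bar> < e" if e: "e > 0" for e
      proof -
        obtain \<delta> where "\<delta> > 0" "\<forall>f\<in>?F. \<forall>g\<in>?F. sd_dist \<mu> f g < \<delta> \<longrightarrow> \<bar>ip (coef f) (W \<omega>) - ip (coef g) (W \<omega>)\<bar> < e"
          using B.path_uniformly_continuous[OF e, of \<omega>] by (auto simp: Mu.path_def)
        then show ?thesis using sd0 by (intro exI[of _ \<delta>]) (smt (verit))
      qed
      have uc': "\<exists>\<delta>>0. \<forall>f\<in>?F. \<forall>g\<in>?F. ?d f g < \<delta> \<longrightarrow> \<bar>ip (coef f) (W' \<omega>) - ip (coef g) (W' \<omega>)\<bar> < e" if e: "e > 0" for e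
      proof -
        obtain \<delta> where "\<delta> > 0" "\<forall>f\<in>?F. \<forall>g\<in>?F. sd_dist \<nu> f g < \<delta> \<longrightarrow> \<bar>ip (coef f) (W' \<omega>) - ip (coef g) (W' \<omega>)\<bar> < e"
          using B'.path_uniformly_continuous[OF e, of \<omega>] by (auto simp: Nu.path_def)
        then show ?thesis using sd0 by (intro exI[of _ \<delta>]) (smt (verit))
      qed
      have ucD: "\<exists>\<delta>>0. \<forall>f\<in>?F. \<forall>g\<in>?F. ?d f g < \<delta> \<longrightarrow> \<bar>ip (coef f) (WD \<omega>) - ip (coef g) (WD \<omega>)\<bar> < e" if e: "e > 0" for e
      proof -
        have e2: "e / 2 > 0" using e by simp
        obtain \<delta> where \<delta>: "\<delta> > 0" "\<And>f g. f \<in> ?F \<Longrightarrow> g \<in> ?F \<Longrightarrow> ?d f g < \<delta> \<Longrightarrow> \<bar>ip (coef f) (W \<omega>) - ip (coef g) (W \<omega>)\<bar> < e / 2"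
          using uc[OF e2] by blast
        obtain \<delta>' where \<delta>': "\<delta>' > 0" "\<And>f g. f \<in> ?F \<Longrightarrow> g \<in> ?F \<Longrightarrow> ?d f g < \<delta>' \<Longrightarrow> \<bar>ip (coef f) (W' \<omega>) - ip (coef g) (W' \<omega>)\<bar> < e / 2"
          using uc'[OF e2] by blast
        have "\<bar>ip (coef f) (WD \<omega>) - ip (coef g) (WD \<omega>)\<bar> < e" if "f \<in> ?F" "g \<in> ?F" "?d f g < min \<delta> \<delta>'" for f g
          using \<delta>(2)[OF that(1,2)] \<delta>'(2)[OF that(1,2)] that(3)
          unfolding ip_WD[OF coef[OF that(1)]] ip_WD[OF coef[OF that(2)]] by linarith
        then show ?thesis using \<delta>(1) \<delta>'(1) by (intro exI[of _ "min \<delta> \<delta>'"]) auto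
      qed
      have two: "(2 :: real) > 0" by simp
      have "completion_ext (G \<omega>) u - completion_ext (G' \<omega>) u = lim (\<lambda>j. ip (coef (u j)) (WD \<omega>))" if u: "u \<in> ?OP" for u
      proof -
        have up: "u \<in> pseudo_completion ?d ?F" using u by simp
        note c1 = potentials_image(2)[OF coef \<beta>0 \<beta>(2) B.W_summable(2) uc d_le two a_cont up]
        note c2 = potentials_image(2)[OF coef \<beta>0 \<beta>(2) B'.W_summable(2) uc' d_le two a_cont up]
        have "(\<lambda>j. ip (coef (u j)) (W \<omega>) - ip (coef (u j)) (W' \<omega>)) \<longlonglongrightarrow>
            lim (\<lambda>j. ip (coef (u j)) (W \<omega>)) - lim (\<lambda>j. ip (coef (u j)) (W' \<omega>))"
          using c1 c2 by (intro tendsto_diff) (simp_all add: convergent_LIMSEQ_iff)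
        then have "lim (\<lambda>j. ip (coef (u j)) (W \<omega>) - ip (coef (u j)) (W' \<omega>)) =
            lim (\<lambda>j. ip (coef (u j)) (W \<omega>)) - lim (\<lambda>j. ip (coef (u j)) (W' \<omega>))" by (rule limI)
        then show ?thesis
          using uF[OF up] by (simp add: completion_ext_def G_def G'_def Mu.path_def Nu.path_def ip_WD[OF coef[OF uF[OF up]]])
      qed
      then have "(\<lambda>u. completion_ext (G \<omega>) u - completion_ext (G' \<omega>) u) ` optimal_potentials2 \<kappa> \<sigma> \<mu> \<nu> =
          (\<lambda>u. lim (\<lambda>j. ip (coef (u j)) (WD \<omega>))) ` ?OP"
        unfolding \<open>optimal_potentials2 \<kappa> \<sigma> \<mu> \<nu> = ?OP\<close> by (rule image_cong[OF refl])
      also have "\<dots> = (\<lambda>b. ip b (WD \<omega>)) ` M"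
        unfolding M_def A_def
        by (rule potentials_image(1)[OF coef \<beta>0 \<beta>(2) WD_sum ucD d_le two a_cont])
      finally show ?thesis by simp
    qed
    show "(\<lambda>\<omega>. SUP u\<in>optimal_potentials2 \<kappa> \<sigma> \<mu> \<nu>. completion_ext (G \<omega>) u - completion_ext (G' \<omega>) u) \<in> borel_measurable N"
      unfolding eq by (rule SUP_ip_measurable[OF M WD_meas WD_sum])
    show "AE \<omega> in N. (SUP u\<in>optimal_potentials2 \<kappa> \<sigma> \<mu> \<nu>. completion_ext (G \<omega>) u - completion_ext (G' \<omega>) u) = (SUP b\<in>M. ip b (WD \<omega>))"
      unfolding eq by simp
  qed (fact P.prob_space_axioms Np(1) WD_meas \<beta>0 \<beta>(2) A a_cont m_SUP M_def)+

  show ?thesis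
    using bridges indep conv1 conv2 unfolding m_def by blast
qed

end
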